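(* Let $H$ be a separable real Hilbert space and let $X$ be an $H$-valued random variable satisfying assumptions (A1), (A2) and (A3) stated in the context, with geometric median $m$. Let $\gamma_n=c_\gamma n^{-\alpha}$ for $n\ge1$, with $c_\gamma>0$ and $\alpha\in(\tfrac12,1)$, let $(Z_n)$ be the stochastic gradient algorithm defined in the context, and let $\overline{Z}_n=\frac1n\sum_{i=1}^n Z_i$ be its averaged version. Then, as $n\to\infty$, $$\sqrt{n}\left(\overline{Z}_n-m\right)\ \longrightarrow\ \mathcal{N}\left(0,\Gamma_m^{-1}\Sigma\,\Gamma_m^{-1}\right)\quad\text{in distribution in } H,$$ where $$\Sigma=\mathbb{E}\left[\frac{X-m}{\|X-m\|}\otimes\frac{X-m}{\|X-m\|}\right],\qquad \Gamma_m=\mathbb{E}\left[\frac{1}{\|X-m\|}\left(\mathbf{I}_H-\frac{(X-m)\otimes(X-m)}{\|X-m\|^2}\right)\right].$$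
   Context: $\langle\cdot,\cdot\rangle$ and $\|\cdot\|$ denote the inner product and norm of $H$; $\mathbf{I}_H$ is the identity operator of $H$; for $u,v,h\in H$, $(u\otimes v)(h)=\langle u,h\rangle v$. $\mathcal{N}(0,Q)$ is the centered Gaussian law on $H$ with covariance operator $Q$. Under the assumptions below the operator $\Gamma_m$ is bounded and has a bounded positive inverse $\Gamma_m^{-1}$. Geometric median: $m=\arg\min_{u\in H}\mathbb{E}\left[\|X-u\|-\|X\|\right]$ (no moment of $X$ is assumed; under (A1) the minimizer is unique). (A1) $X$ is not concentrated on a straight line: for every $v\in H$ there is $w\in H$ with $\langle v,w\rangle=0$ and $\mathrm{Var}(\langle w,X\rangle)>0$. (Since no moment is assumed, the variance may be $+\infty$; the condition means that $\langle w,X\rangle$ is not almost surely constant.) (A2) The law of $X$ is a mixture $\mu_X=\lambda\mu_c+(1-\lambda)\mu_d$, $\lambda\in[0,1]$, of two probability measures such that: (i) if $Y$ has law $\mu_c$, then for every $A>0$ there is $C_A\in[0,\infty)$ such that $\mathbb{E}\left[\|Y-\alpha\|^{-1}\right]\le C_A$ for all $\alpha\in H$ with $\|\alpha\|\le A$; (ii) $\mu_d=\sum_i p_i\delta_{x_i}$ is a discrete measure, with support $D$, and $m\notin D$. (A3) There are a constant $A>0$ and a constant $C_A\in[0,\infty)$ such that $\mathbb{E}\left[\|X-(m+h)\|^{-2}\right]\le C_A$ for all $h\in H$ with $\|h\|\le A$. Algorithm: $X_1,X_2,\dots$ are independent copies of $X$. The starting point $Z_0$ is either deterministic, or random, bounded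 and independent of $(X_n)_{n\ge1}$ (e.g. $Z_0=X_0\mathbf{1}_{\{\|X_0\|\le M\}}$ with $X_0$ an independent copy of $X$ and $M>0$ a constant). For $n\ge 0$, $$Z_{n+1}=Z_n+\gamma_n\frac{X_{n+1}-Z_n}{\|X_{n+1}-Z_n\|},$$ with the convention $Z_{n+1}=Z_n$ if $X_{n+1}=Z_n$; the first step $\gamma_0$ is an arbitrary fixed positive number. *)

theory Defs
  imports "HOL-Probability.Probability"
begin

text \<open>
  A separable real Hilbert space is a type of the classes
  \<^class>\<open>real_inner\<close>, \<^class>\<open>banach\<close> and \<^class>\<open>second_countable_topology\<close>.
\<close>

text \<open>
  Variance with values in \<open>[0, \<infinity>]\<close>: it is \<open>\<infinity>\<close> when the variable has no mean, and also when it
  has a mean but no second moment.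
\<close>

definition extended_variance :: "'w measure \<Rightarrow> ('w \<Rightarrow> real) \<Rightarrow> ennreal" where
  "extended_variance M Y =
     (if integrable M Y
      then \<integral>\<^sup>+\<omega>. ennreal ((Y \<omega> - integral\<^sup>L M Y)\<^sup>2) \<partial>M
      else \<infinity>)"

definition not_on_straight_line :: "'w measure \<Rightarrow> ('w \<Rightarrow> 'a::real_inner) \<Rightarrow> bool" where
  "not_on_straight_line M X \<longleftrightarrow>
     (\<forall>v. \<exists>w. inner v w = 0 \<and> extended_variance M (\<lambda>\<omega>. inner w (X \<omega>)) > 0)"

text \<open>
  The integrand is bounded by \<open>\<parallel>u\<parallel>\<close>, so no moment of \<open>X\<close> is needed.
\<close>

definition is_geometric_median ::
    "'w measure \<Rightarrow> ('w \<Rightarrow> 'a::real_inner) \<Rightarrow> 'a \<Rightarrow> bool" where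
  "is_geometric_median M X m \<longleftrightarrow>
     is_arg_min (\<lambda>u. \<integral>\<omega>. (norm (X \<omega> - u) - norm (X \<omega>)) \<partial>M) (\<lambda>_. True) m"

text \<open>
  Inverse moments are Lebesgue integrals of \<^typ>\<open>ennreal\<close>-valued functions, where the inverse of
  \<open>0\<close> is \<open>\<infinity>\<close>. (For real numbers it would be \<open>0\<close>, and atoms would go unnoticed.)
\<close>

definition inverse_moment_locally_bounded :: "'a::real_normed_vector measure \<Rightarrow> bool" where
  "inverse_moment_locally_bounded \<mu> \<longleftrightarrow>
     (\<forall>A>0. \<exists>C\<ge>0. \<forall>\<alpha>. norm \<alpha> \<le> A \<longrightarrow>
        (\<integral>\<^sup>+y. inverse (ennreal (norm (y - \<alpha>))) \<partial>\<mu>) \<le> ennreal C)"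

text \<open>
  The discrete measure \<open>\<mu>\<^sub>d = \<Sum>\<^sub>i p\<^sub>i \<delta>(x\<^sub>i)\<close> is given by its probability mass function \<open>p\<close>; its
  support is the set \<^term>\<open>set_pmf p\<close> of its atoms.
\<close>

definition mixture_condition ::
    "'w measure \<Rightarrow> ('w \<Rightarrow> 'a::real_normed_vector) \<Rightarrow> 'a \<Rightarrow> bool" where
  "mixture_condition M X m \<longleftrightarrow>
     (\<exists>(lam::real) (\<mu>\<^sub>c::'a measure) (p::'a pmf).
        0 \<le> lam \<and> lam \<le> 1 \<and>
        prob_space \<mu>\<^sub>c \<and> sets \<mu>\<^sub>c = sets borel \<and>
        (\<forall>B\<in>sets borel. emeasure (distr M borel X) B =
            ennreal lam * emeasure \<mu>\<^sub>c B + ennreal (1 - lam) * emeasure (measure_pmf p) B) \<and>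
        inverse_moment_locally_bounded \<mu>\<^sub>c \<and>
        m \<notin> set_pmf p)"

definition inverse_square_moment_bounded_near ::
    "'w measure \<Rightarrow> ('w \<Rightarrow> 'a::real_normed_vector) \<Rightarrow> 'a \<Rightarrow> bool" where
  "inverse_square_moment_bounded_near M X m \<longleftrightarrow>
     (\<exists>A>0. \<exists>C\<ge>0. \<forall>h. norm h \<le> A \<longrightarrow>
        (\<integral>\<^sup>+\<omega>. inverse ((ennreal (norm (X \<omega> - (m + h))))\<^sup>2) \<partial>M) \<le> ennreal C)"

text \<open>
  \<open>X\<^sub>1, X\<^sub>2, \<dots>\<close> are i.i.d.\ copies of \<open>X\<close> and \<open>Z\<^sub>0\<close> is independent of \<open>(X\<^sub>n)\<^sub>n\<^sub>\<ge>\<^sub>1\<close>, that is,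
  the family \<open>Z\<^sub>0, X\<^sub>1, X\<^sub>2, \<dots>\<close> is independent. A deterministic starting point is a constant \<open>Z\<^sub>0\<close>.
  The value \<open>Xs 0\<close> is not used.
\<close>

definition algorithm_input ::
    "'w measure \<Rightarrow> ('w \<Rightarrow> 'a::real_normed_vector) \<Rightarrow> (nat \<Rightarrow> 'w \<Rightarrow> 'a) \<Rightarrow> ('w \<Rightarrow> 'a) \<Rightarrow> bool" where
  "algorithm_input M X Xs Z\<^sub>0 \<longleftrightarrow>
     (\<forall>n\<ge>1. distr M borel (Xs n) = distr M borel X) \<and>
     prob_space.indep_vars M (\<lambda>_. borel) (\<lambda>n. if n = 0 then Z\<^sub>0 else Xs n) UNIV \<and>
     bounded (Z\<^sub>0 ` space M)"

text \<open>
  If \<open>X\<^sub>n\<^sub>+\<^sub>1 = Z\<^sub>n\<close>, the increment below is \<open>0\<close>, because \<^prop>\<open>0 /\<^sub>R norm 0 = 0\<close>.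
\<close>

primrec median_sgd ::
    "(nat \<Rightarrow> real) \<Rightarrow> (nat \<Rightarrow> 'w \<Rightarrow> 'a::real_normed_vector) \<Rightarrow> ('w \<Rightarrow> 'a) \<Rightarrow> nat \<Rightarrow> 'w \<Rightarrow> 'a" where
  "median_sgd \<gamma> Xs Z\<^sub>0 0 \<omega> = Z\<^sub>0 \<omega>"
| "median_sgd \<gamma> Xs Z\<^sub>0 (Suc n) \<omega> =
     (let z = median_sgd \<gamma> Xs Z\<^sub>0 n \<omega>
      in z + \<gamma> n *\<^sub>R ((Xs (Suc n) \<omega> - z) /\<^sub>R norm (Xs (Suc n) \<omega> - z)))"

definition averaged :: "(nat \<Rightarrow> 'w \<Rightarrow> 'a::real_vector) \<Rightarrow> nat \<Rightarrow> 'w \<Rightarrow> 'a" where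
  "averaged Z n \<omega> = (1 / real n) *\<^sub>R (\<Sum>i=1..n. Z i \<omega>)"

definition tensor :: "'a::real_inner \<Rightarrow> 'a \<Rightarrow> 'a \<Rightarrow> 'a" (infixl "\<otimes>\<^sub>H" 70) where
  "(u \<otimes>\<^sub>H v) h = inner u h *\<^sub>R v"

text \<open>
  Expectation of a random operator in the strong sense: \<open>(\<bbbE> T) h = \<bbbE> (T h)\<close>, a Bochner integral in
  the Hilbert space. It agrees with the Bochner integral for the operator norm whenever the latter
  exists; the space of bounded operators is not separable, so the library has no Bochner integral
  there.
\<close>

definition operator_expectation ::
    "'w measure \<Rightarrow> ('w \<Rightarrow> 'a \<Rightarrow> 'a::{banach, second_countable_topology}) \<Rightarrow> 'a \<Rightarrow> 'a" where
  "operator_expectation M T h = (\<integral>\<omega>. T \<omega> h \<partial>M)"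

definition Sigma_op ::
    "'w measure \<Rightarrow> ('w \<Rightarrow> 'a::{real_inner, banach, second_countable_topology}) \<Rightarrow> 'a \<Rightarrow> 'a \<Rightarrow> 'a" where
  "Sigma_op M X m = operator_expectation M
     (\<lambda>\<omega>. ((X \<omega> - m) /\<^sub>R norm (X \<omega> - m)) \<otimes>\<^sub>H ((X \<omega> - m) /\<^sub>R norm (X \<omega> - m)))"

definition Gamma_op ::
    "'w measure \<Rightarrow> ('w \<Rightarrow> 'a::{real_inner, banach, second_countable_topology}) \<Rightarrow> 'a \<Rightarrow> 'a \<Rightarrow> 'a" where
  "Gamma_op M X m = operator_expectation M
     (\<lambda>\<omega> h. (1 / norm (X \<omega> - m)) *\<^sub>R
        (h - (1 / (norm (X \<omega> - m))\<^sup>2) *\<^sub>R ((X \<omega> - m) \<otimes>\<^sub>H (X \<omega> - m)) h))"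

definition centered_normal_law :: "real measure \<Rightarrow> bool" where
  "centered_normal_law N \<longleftrightarrow>
     N = return borel 0 \<or> (\<exists>\<sigma>>0. N = density lborel (normal_density 0 \<sigma>))"

text \<open>
  \<open>\<nu>\<close> is the law \<open>\<N>(0, Q)\<close>: all its one-dimensional projections are centered Gaussian (possibly
  degenerate), and \<open>Q\<close> is its covariance operator. These two conditions determine \<open>\<nu>\<close>.
\<close>

definition centered_gaussian_law ::
    "'a::real_inner measure \<Rightarrow> ('a \<Rightarrow> 'a) \<Rightarrow> bool" where
  "centered_gaussian_law \<nu> Q \<longleftrightarrow>
     prob_space \<nu> \<and> sets \<nu> = sets borel \<and>
     (\<forall>h. centered_normal_law (distr \<nu> borel (\<lambda>x. inner h x))) \<and>
     (\<forall>h k. (\<integral>x. inner h x * inner k x \<partial>\<nu>) = inner (Q h) k)"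

text \<open>
  The library's \<^const>\<open>weak_conv_m\<close> is restricted to measures on the real line.
\<close>

definition converges_in_law ::
    "'w measure \<Rightarrow> (nat \<Rightarrow> 'w \<Rightarrow> 'a::topological_space) \<Rightarrow> 'a measure \<Rightarrow> bool" where
  "converges_in_law M Y \<nu> \<longleftrightarrow>
     (\<forall>f::'a \<Rightarrow> real. continuous_on UNIV f \<and> bounded (range f) \<longrightarrow>
        (\<lambda>n. \<integral>\<omega>. f (Y n \<omega>) \<partial>M) \<longlonglongrightarrow> (\<integral>x. f x \<partial>\<nu>))"

end

theory Submission
  imports Defs
begin

text \<open>
  Put \<open>T n = Z n - m\<close>, \<open>drift z = \<bbbE> sgn (X - z)\<close> and \<open>\<Gamma> = Gamma_op M X m\<close>. Since
  \<open>\<bbbE> \<parallel>X - m\<parallel>\<^sup>-\<^sup>2 < \<infinity>\<close>, \<open>drift (m + h) = - \<Gamma> h + O(\<parallel>h\<parallel>\<^sup>2)\<close>; as \<open>X\<close> does not live on a line, \<open>\<Gamma>\<close> is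
  coercive, and monotonicity of the drift gives \<open>\<langle>drift (m + h), h\<rangle> \<le> - c min (\<parallel>h\<parallel>\<^sup>2) \<parallel>h\<parallel>\<close> for all \<open>h\<close>.
  For the Lyapunov function \<open>exp (sqrt (1 + \<parallel>h\<parallel>\<^sup>2)) - exp 1\<close> the drift is a global contraction, hence
  \<open>\<bbbE> \<parallel>T n\<parallel>\<^sup>2 = O(\<gamma> n)\<close>.

  Now \<open>\<Gamma> (T n) = (T n - T (n + 1)) / \<gamma> n + U n + D n + \<delta> n\<close> with the i.i.d. centred
  \<open>U n = sgn (X (n + 1) - m)\<close>, orthogonal \<open>D n\<close> with \<open>\<bbbE> \<parallel>D n\<parallel>\<^sup>2 = O(\<gamma> n)\<close>, and \<open>\<parallel>\<delta> n\<parallel> = O(\<parallel>T n\<parallel>\<^sup>2)\<close>.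
  Summed and divided by \<open>sqrt n\<close>, all terms but the \<open>U n\<close> vanish in \<open>L\<^sup>1\<close>, so no martingale limit
  theorem is needed, only the central limit theorem for the vectors \<open>inv \<Gamma> (U n)\<close>.

  That theorem follows from the one on the line: averaging characters over \<open>h\<close> gives products of
  functions \<open>exp (- (\<langle>e, x\<rangle> - b)\<^sup>2)\<close>, these approximate products of functions \<open>exp (- \<parallel>x - a\<parallel>\<^sup>2)\<close>, and
  the latter span an algebra of functions that determines convergence in law.
\<close>

section \<open>Square roots of positive operators\<close>

text \<open>Signs are unit vectors, so the pull towards \<open>m\<close> is bounded and far away
  only linear in the distance: the squared norm alone obeys no contraction. The exponential in the
  Lyapunov function repairs this, and its moments exist because each \<open>T n\<close> is bounded
  after finitely many bounded steps. Expansions are made at \<open>m\<close>, never at the moving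
  point. The Taylor remainder of the sign map is at most
  \<open>12 * (norm h)\<^sup>2 / (norm y)\<^sup>2\<close> with \<open>y = X - m\<close>, for every
  \<open>h\<close>, so an inverse moment at \<open>m\<close> controls it however close a sample
  falls to the iterate. The iterates are functions of a finite past; conditioning on that past is
  integration over the law of the next sample. In infinite dimension bounded sets are not compact.
  Tightness is replaced by an identity: the covariance of the normalised sums does not depend on
  \<open>n\<close>, so their mean energy outside the first \<open>k\<close> frame vectors is small
  uniformly in \<open>n\<close>. The frame stems from Cholesky elimination, which also yields the
  coefficients of a random series with the limit law.\<close>

definition psd_op :: "('a::real_inner \<Rightarrow> 'a) \<Rightarrow> bool" where
  "psd_op Q \<longleftrightarrow> linear Q \<and> (\<forall>h k. inner (Q h) k = inner h (Q k)) \<and> (\<forall>h. inner (Q h) h \<ge> 0)"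

lemma psd_op_nonneg: "psd_op Q \<Longrightarrow> inner (Q h) h \<ge> 0"
  and psd_op_sym: "psd_op Q \<Longrightarrow> inner (Q h) k = inner (Q k) h"
  by (simp_all add: psd_op_def inner_commute)

lemma psd_op_Cauchy_Schwarz:
  assumes "psd_op Q"
  shows "(inner (Q h) k)\<^sup>2 \<le> inner (Q h) h * inner (Q k) k"
proof -
  have lin: "linear Q" and sym: "\<And>h k. inner (Q h) k = inner h (Q k)"
    and pos: "\<And>h. inner (Q h) h \<ge> 0" using assms by (auto simp: psd_op_def)
  interpret linear Q by fact
  have quad: "0 \<le> inner (Q h) h + 2 * t * inner (Q h) k + t\<^sup>2 * inner (Q k) k" for t
    using pos[of "h + t *\<^sub>R k"] sym[of k h]
    by (simp add: add scale inner_add_left inner_add_right algebra_simps power2_eq_square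
        inner_commute)
  show ?thesis
  proof (cases "inner (Q k) k = 0")
    case True
    have "inner (Q h) k = 0"
    proof (rule ccontr)
      assume ne: "inner (Q h) k \<noteq> 0"
      \<comment> \<open>If \<open>k\<close> is a null vector, the quadratic is affine in
        \<open>t\<close>; this \<open>t\<close> gives it the value -1.\<close>
      have "2 * (- (inner (Q h) h + 1) / (2 * inner (Q h) k)) * inner (Q h) k
              = - (inner (Q h) h + 1)"
        using ne by (simp add: field_simps)
      then show False
        using quad[of "- (inner (Q h) h + 1) / (2 * inner (Q h) k)"] True by simp
    qed
    then show ?thesis using True by simp
  next
    case False
    then have p: "inner (Q k) k > 0" using pos[of k] by simp
    have "0 \<le> inner (Q h) h - (inner (Q h) k)\<^sup>2 / inner (Q k) k"
      using quad[of "- inner (Q h) k / inner (Q k) k"] p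
      by (simp add: field_simps power2_eq_square)
    then show ?thesis using p by (simp add: field_simps)
  qed
qed

text \<open>Elimination with pivot vector \<open>d i\<close>: the rank-one operator that agrees with
  the current one at \<open>d i\<close> is subtracted. For a zero pivot the quotient is 0 and
  nothing changes.\<close>

primrec schur :: "('a::real_inner \<Rightarrow> 'a) \<Rightarrow> (nat \<Rightarrow> 'a) \<Rightarrow> nat \<Rightarrow> 'a \<Rightarrow> 'a" where
  "schur Q d 0 = Q"
| "schur Q d (Suc i) = (\<lambda>h. schur Q d i h -
     (inner (schur Q d i (d i)) h / inner (schur Q d i (d i)) (d i)) *\<^sub>R schur Q d i (d i))"

lemma schur_step_form:
  "inner (schur Q d (Suc i) h) h
     = inner (schur Q d i h) h - (inner (schur Q d i (d i)) h)\<^sup>2 / inner (schur Q d i (d i)) (d i)"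
  by (simp add: inner_diff_left power2_eq_square)

text \<open>Positivity of the complement is the Cauchy-Schwarz inequality of the previous form,
  taken at \<open>d i\<close> and \<open>h\<close>.\<close>

lemma psd_op_schur: "psd_op Q \<Longrightarrow> psd_op (schur Q d i)"
proof (induction i)
  case (Suc i)
  then have IH: "psd_op (schur Q d i)" by simp
  let ?S = "schur Q d i" and ?v = "schur Q d i (d i)"
  have lin: "linear ?S" and sym: "\<And>h k. inner (?S h) k = inner h (?S k)"
    and pos: "\<And>h. inner (?S h) h \<ge> 0" using IH by (auto simp: psd_op_def)
  interpret linear ?S by fact
  have "linear (schur Q d (Suc i))"
    by (rule linearI) (simp_all add: add scale inner_add_right algebra_simps add_divide_distrib)
  moreover have "inner (schur Q d (Suc i) h) k = inner h (schur Q d (Suc i) k)" for h k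
    using psd_op_sym[OF IH, of h k] psd_op_sym[OF IH, of "d i" k] psd_op_sym[OF IH, of "d i" h]
    by (simp add: inner_diff_left inner_diff_right inner_commute)
  moreover have "inner (schur Q d (Suc i) h) h \<ge> 0" for h
    using psd_op_Cauchy_Schwarz[OF IH, of "d i" h] pos[of h] pos[of "d i"]
    unfolding schur_step_form
    by (cases "inner ?v (d i) = 0") (auto simp: field_simps mult.commute)
  ultimately show ?case by (simp add: psd_op_def)
qed simp

lemma schur_antimono:
  assumes "psd_op Q" "i \<le> j"
  shows "inner (schur Q d j h) h \<le> inner (schur Q d i h) h"
  using assms(2)
proof (induction rule: dec_induct)
  case (step n)
  have "inner (schur Q d n (d n)) (d n) \<ge> 0"
    by (rule psd_op_nonneg[OF psd_op_schur[OF assms(1)]])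
  then show ?case using step unfolding schur_step_form by (smt (verit) divide_nonneg_nonneg zero_le_power2)
qed simp

text \<open>Right after its own elimination the form vanishes at \<open>d i\<close>; it stays 0
  there because later forms lie between 0 and that one.\<close>

lemma schur_annihilates:
  assumes "psd_op Q" "i < j"
  shows "inner (schur Q d j (d i)) (d i) = 0"
proof -
  have "inner (schur Q d (Suc i) (d i)) (d i) = 0"
    unfolding schur_step_form by (simp add: power2_eq_square)
  then show ?thesis
    using schur_antimono[OF assms(1), of "Suc i" j d "d i"] assms psd_op_nonneg[OF psd_op_schur[OF assms(1)], of d j "d i"]
    by simp
qed

text \<open>
  Cholesky factorisation along a dense sequence: \<open>a i\<close> is the \<open>i\<close>-th column, and the
  remaining Schur complements tend to \<open>0\<close> because they vanish on the pivots used so far.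
  For a vanishing pivot the column is \<open>0\<close>, as \<open>x / 0 = 0\<close>.
\<close>

lemma ex_square_root_frame:
  fixes Q :: "'a::{real_inner, second_countable_topology} \<Rightarrow> 'a"
  assumes Q: "psd_op Q" and C: "\<And>h. inner (Q h) h \<le> C * (norm h)\<^sup>2"
  shows "\<exists>a::nat \<Rightarrow> 'a. \<forall>h. (\<lambda>k. (inner (a k) h)\<^sup>2) sums inner (Q h) h"
proof -
  obtain D :: "'a set" where D: "countable D" "\<And>X. open X \<Longrightarrow> X \<noteq> {} \<Longrightarrow> \<exists>d\<in>D. d \<in> X"
    using countable_dense_exists by metis
  have "D \<noteq> {}" using D(2)[of UNIV] by auto
  then have rD: "range (from_nat_into D) = D" using D(1) by (rule range_from_nat_into)
  define d where "d = from_nat_into D"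
  define S where "S = schur Q d"
  define a where "a i = (1 / sqrt (inner (S i (d i)) (d i))) *\<^sub>R S i (d i)" for i
  have S: "psd_op (S i)" for i unfolding S_def by (rule psd_op_schur[OF Q])
  have a: "(inner (a i) h)\<^sup>2 = inner (S i h) h - inner (S (Suc i) h) h" for i h
    using psd_op_nonneg[OF S[of i], of "d i"] unfolding S_def schur_step_form
    by (simp add: a_def S_def power_mult_distrib power_divide)
  have sum: "(\<Sum>k<n. (inner (a k) h)\<^sup>2) = inner (Q h) h - inner (S n h) h" for n h
    unfolding a by (subst sum_lessThan_telescope') (simp add: S_def)
  have lim: "(\<lambda>n. inner (S n h) h) \<longlonglongrightarrow> 0" for h
  proof (rule LIMSEQ_I)
    fix r :: real assume r: "r > 0"
    \<comment> \<open>This makes \<open>\<bar>C\<bar> * \<epsilon>\<^sup>2\<close> smaller than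
      \<open>r\<close>; the added 1 covers \<open>C = 0\<close>.\<close>
    define \<epsilon> where "\<epsilon> = sqrt (r / (\<bar>C\<bar> + 1))"
    have "\<epsilon> > 0" using r by (simp add: \<epsilon>_def)
    then obtain i where i: "dist h (d i) < \<epsilon>"
      using D(2)[of "ball h \<epsilon>"] rD unfolding d_def by (metis centre_in_ball empty_iff imageE mem_ball open_ball rangeE)
    have "norm (inner (S n h) h - 0) < r" if n: "n \<ge> Suc i" for n
    proof -
      let ?x = "h - d i"
      have z: "inner (S n (d i)) (d i) = 0"
        unfolding S_def using schur_annihilates[OF Q] n by simp
      have lin: "linear (S n)" and sym: "\<And>h k. inner (S n h) k = inner h (S n k)"
        and pos: "\<And>h. inner (S n h) h \<ge> 0" using S[of n] by (auto simp: psd_op_def)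
      \<comment> \<open>A null vector of the form is a null vector of the operator, so
        \<open>h\<close> may be replaced by the short vector \<open>h - d i\<close>.\<close>
      have z': "inner (S n (d i)) k = 0" for k
        using psd_op_Cauchy_Schwarz[OF S, of n "d i" k] z by simp
      then have "inner (S n h) h = inner (S n ?x) ?x"
        using lin sym[of h "d i"] by (simp add: linear_diff inner_diff_left inner_diff_right inner_commute)
      also have "... \<le> inner (Q ?x) ?x"
        unfolding S_def using schur_antimono[OF Q, of 0 n d ?x] by simp
      also have "... \<le> \<bar>C\<bar> * (norm ?x)\<^sup>2" using C[of ?x] by (meson abs_ge_self mult_right_mono order_trans zero_le_power2)
      also have "... \<le> \<bar>C\<bar> * \<epsilon>\<^sup>2"
        using i by (intro mult_left_mono power_mono) (auto simp: dist_norm)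
      also have "... < r" using r by (simp add: \<epsilon>_def field_simps)
      finally show ?thesis using pos[of h] by simp
    qed
    then show "\<exists>no. \<forall>n\<ge>no. norm (inner (S n h) h - 0) < r" by blast
  qed
  have "(\<lambda>k. (inner (a k) h)\<^sup>2) sums inner (Q h) h" for h
    unfolding sums_def sum using tendsto_diff[OF tendsto_const lim] by simp
  then show ?thesis by blast
qed

text \<open>Stands in for an orthonormal basis. Only Parseval's identity is used later; vectors may
  be dependent or zero, so finite dimension is no separate case.\<close>

corollary ex_Parseval_frame:
  "\<exists>e::nat \<Rightarrow> 'a::{real_inner, second_countable_topology}. \<forall>h. (\<lambda>k. (inner (e k) h)\<^sup>2) sums (norm h)\<^sup>2"
  using ex_square_root_frame[of "\<lambda>h::'a. h" 1]
  by (simp add: psd_op_def power2_norm_eq_inner linear_iff inner_commute)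

section \<open>Gaussian laws\<close>

text \<open>Pythagoras for square integrable random vectors. It serves the Gaussian series, the
  normalised sums and the \<open>D n\<close>.\<close>

lemma (in prob_space) mean_square_orthogonal_sum:
  fixes D :: "'i \<Rightarrow> 'a \<Rightarrow> 'b::{real_inner, second_countable_topology, banach}"
  assumes fin: "finite I"
    and meas [measurable]: "\<And>i. i \<in> I \<Longrightarrow> D i \<in> borel_measurable M"
    and int: "\<And>i. i \<in> I \<Longrightarrow> integrable M (\<lambda>w. (norm (D i w))\<^sup>2)"
    and orth: "\<And>i j. i \<in> I \<Longrightarrow> j \<in> I \<Longrightarrow> i \<noteq> j \<Longrightarrow> (LINT w|M. inner (D i w) (D j w)) = 0"
  shows "integrable M (\<lambda>w. (norm (\<Sum>i\<in>I. D i w))\<^sup>2)"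
    and "(LINT w|M. (norm (\<Sum>i\<in>I. D i w))\<^sup>2) = (\<Sum>i\<in>I. LINT w|M. (norm (D i w))\<^sup>2)"
proof -
  have e: "(norm (\<Sum>i\<in>I. D i w))\<^sup>2 = (\<Sum>i\<in>I. \<Sum>j\<in>I. inner (D i w) (D j w))" for w
    by (simp add: power2_norm_eq_inner inner_sum_left inner_sum_right) (rule sum.swap)
  have ii: "integrable M (\<lambda>w. inner (D i w) (D j w))" if "i \<in> I" "j \<in> I" for i j
  proof (rule Bochner_Integration.integrable_bound[OF Bochner_Integration.integrable_add[OF int[OF that(1)] int[OF that(2)]]])
    show "(\<lambda>w. inner (D i w) (D j w)) \<in> borel_measurable M" using that by measurable
    have "\<bar>inner x y\<bar> \<le> (norm x)\<^sup>2 + (norm y)\<^sup>2" for x y :: 'b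
      using Cauchy_Schwarz_ineq2[of x y] sum_squares_bound[of "norm x" "norm y"]
        mult_nonneg_nonneg[OF norm_ge_zero[of x] norm_ge_zero[of y]] by linarith
    then show "AE w in M. norm (inner (D i w) (D j w)) \<le> norm ((norm (D i w))\<^sup>2 + (norm (D j w))\<^sup>2)"
      by simp
  qed
  show "integrable M (\<lambda>w. (norm (\<Sum>i\<in>I. D i w))\<^sup>2)"
    unfolding e using ii by (intro Bochner_Integration.integrable_sum) auto
  have "(LINT w|M. (norm (\<Sum>i\<in>I. D i w))\<^sup>2) = (\<Sum>i\<in>I. \<Sum>j\<in>I. LINT w|M. inner (D i w) (D j w))"
    unfolding e using ii by (simp add: Bochner_Integration.integral_sum Bochner_Integration.integrable_sum)
  also have "... = (\<Sum>i\<in>I. \<Sum>j\<in>I. if i = j then \<integral>w. (norm (D i w))\<^sup>2 \<partial>M else 0)"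
    using orth by (intro sum.cong refl) (auto simp: power2_norm_eq_inner)
  also have "... = (\<Sum>i\<in>I. LINT w|M. (norm (D i w))\<^sup>2)" using fin by simp
  finally show "(LINT w|M. (norm (\<Sum>i\<in>I. D i w))\<^sup>2) = (\<Sum>i\<in>I. LINT w|M. (norm (D i w))\<^sup>2)" .
qed

text \<open>Jensen for the square, read off from the nonnegative variance of the norm.\<close>

lemma (in prob_space) norm_le_root_mean_square:
  fixes f :: "'a \<Rightarrow> 'b::{banach, second_countable_topology}"
  assumes [measurable]: "f \<in> borel_measurable M" and int: "integrable M (\<lambda>w. (norm (f w))\<^sup>2)"
  shows "integrable M f" "(LINT w|M. norm (f w)) \<le> sqrt (LINT w|M. (norm (f w))\<^sup>2)"
proof -
  have 1: "integrable M (\<lambda>w. norm (f w))"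
    by (rule square_integrable_imp_integrable) (use int in auto)
  then show "integrable M f" by (simp add: integrable_norm_iff)
  have "(LINT w|M. norm (f w))\<^sup>2 \<le> (LINT w|M. (norm (f w))\<^sup>2)"
    using variance_eq[OF 1 int] variance_positive[of "\<lambda>w. norm (f w)"] by simp
  then show "(LINT w|M. norm (f w)) \<le> sqrt (LINT w|M. (norm (f w))\<^sup>2)"
    by (rule real_le_rsqrt)
qed

text \<open>As an image under scaling it includes the point mass at 0 for \<open>s = 0\<close>, so
  degenerate projections fit the same formulas.\<close>

definition normal_law :: "real \<Rightarrow> real measure" where
  "normal_law s = distr std_normal_distribution borel (\<lambda>x. s * x)"

interpretation std: real_distribution std_normal_distribution by (rule real_dist_normal_dist)

lemma real_distribution_normal_law: "real_distribution (normal_law s)"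
  unfolding normal_law_def by (rule std.real_distribution_distr) simp

lemma char_normal_law: "char (normal_law s) t = exp (- ((s * t)\<^sup>2) / 2)"
proof -
  have "char (normal_law s) t = char std_normal_distribution (s * t)"
    unfolding normal_law_def char_def by (subst integral_distr) (auto simp: mult_ac)
  then show ?thesis by (simp add: char_std_normal_distribution)
qed

lemma std_normal_moments: "(LINT x|std_normal_distribution. x) = 0" "(LINT x|std_normal_distribution. x\<^sup>2) = 1"
  "integrable std_normal_distribution (\<lambda>x. x)" "integrable std_normal_distribution (\<lambda>x. x\<^sup>2)"
  using integral_std_normal_distribution_moment_odd[of 1] std_normal_distribution_even_moments[of 1]
    integrable_std_normal_distribution_moment[of 1]
  by (simp_all)

lemma normal_law_square:
  "(\<integral>x. x\<^sup>2 \<partial>normal_law s) = s\<^sup>2" "integrable (normal_law s) (\<lambda>x. x\<^sup>2)"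
  unfolding normal_law_def
  by (simp_all add: integral_distr integrable_distr_eq power_mult_distrib std_normal_moments)

lemma centered_normal_law_iff: "centered_normal_law N \<longleftrightarrow> (\<exists>s\<ge>0. N = normal_law s)"
proof -
  have zero: "normal_law 0 = return borel 0"
  proof -
    have "(*) 0 = (\<lambda>x::real. 0::real)" by auto
    then show ?thesis unfolding normal_law_def using std.distr_const[of 0 borel] by simp
  qed
  have pos: "normal_law s = density lborel (normal_density 0 s)" if "s > 0" for s
  proof -
    have "distributed std_normal_distribution lborel (\<lambda>x. x) std_normal_density"
      unfolding distributed_def by (auto simp: distr_id2)
    from std.normal_density_affine[OF this, of s 0] that show ?thesis
      unfolding distributed_def normal_law_def by (auto cong: distr_cong)
  qed
  show ?thesis
  proof
    assume "centered_normal_law N"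
    then show "\<exists>s\<ge>0. N = normal_law s"
      unfolding centered_normal_law_def
    proof
      assume "N = return borel 0"
      then show ?thesis using zero by (intro exI[of _ 0]) simp
    next
      assume "\<exists>\<sigma>>0. N = density lborel (normal_density 0 \<sigma>)"
      then obtain s where "s > 0" "N = density lborel (normal_density 0 s)" by blast
      then show ?thesis using pos[of s] by (intro exI[of _ s]) auto
    qed
  next
    assume "\<exists>s\<ge>0. N = normal_law s"
    then obtain s where s: "s \<ge> 0" "N = normal_law s" by blast
    then show "centered_normal_law N"
    proof (cases "s = 0")
      case False
      then show ?thesis unfolding centered_normal_law_def
        using pos[of s] s by (intro disjI2 exI[of _ s]) auto
    qed (simp add: zero centered_normal_law_def)
  qed
qed

text \<open>The second moment of the projection on \<open>h\<close> fixes its standard deviation,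
  hence its characteristic function at 1.\<close>

lemma centered_gaussian_law_char:
  assumes "centered_gaussian_law \<nu> Q"
  shows "(LINT x|\<nu>. iexp (inner h x)) = exp (- (inner (Q h) h) / 2)"
proof -
  have s\<nu> [measurable_cong]: "sets \<nu> = sets borel" using assms by (simp add: centered_gaussian_law_def)
  have m: "(\<lambda>x. inner h x) \<in> borel_measurable \<nu>"
    unfolding measurable_cong_sets[OF s\<nu> refl]
    by (intro borel_measurable_continuous_onI continuous_intros)
  obtain s where s: "distr \<nu> borel (\<lambda>x. inner h x) = normal_law s"
    using assms unfolding centered_gaussian_law_def centered_normal_law_iff by blast
  have "inner (Q h) h = (LINT x|\<nu>. (inner h x)\<^sup>2)"
    using assms by (simp add: centered_gaussian_law_def power2_eq_square)
  also have "... = (\<integral>y. y\<^sup>2 \<partial>normal_law s)"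
    unfolding s[symmetric] by (subst integral_distr[OF m]) auto
  finally have "inner (Q h) h = s\<^sup>2" by (simp add: normal_law_square)
  moreover have "(LINT x|\<nu>. iexp (inner h x)) = char (normal_law s) 1"
    unfolding s[symmetric] char_def by (subst integral_distr[OF m]) auto
  ultimately show ?thesis by (simp add: char_normal_law)
qed

lemma (in prob_space) indep_vars_imp_indep_var:
  assumes "indep_vars (\<lambda>_. N) X I" "i \<in> I" "j \<in> I" "i \<noteq> j"
  shows "indep_var N (X i) N (X j)"
proof -
  have "indep_var (PiM {i} (\<lambda>_. N)) (\<lambda>w. restrict (\<lambda>k. X k w) {i})
      (PiM {j} (\<lambda>_. N)) (\<lambda>w. restrict (\<lambda>k. X k w) {j})"
    using assms by (intro indep_var_restrict[OF assms(1)]) auto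
  from indep_var_compose[OF this, of "\<lambda>f. f i" N "\<lambda>f. f j" N] show ?thesis by (simp add: comp_def)
qed

text \<open>\<open>\<nu>\<close> is the law of the random series with terms
  \<open>w k *\<^sub>R a k\<close> for independent standard normal \<open>w k\<close>. The terms are
  orthogonal in mean square; almost sure convergence along a subsequence of the partial sums is
  enough to identify all projections.\<close>

theorem ex_centered_gaussian_law:
  fixes a :: "nat \<Rightarrow> 'a::{real_inner, banach, second_countable_topology}"
  assumes a: "summable (\<lambda>k. (norm (a k))\<^sup>2)" and Q: "psd_op Q"
    and Qa: "\<And>h. (\<lambda>k. (inner (a k) h)\<^sup>2) sums inner (Q h) h"
  shows "\<exists>\<nu>. centered_gaussian_law \<nu> Q"
proof -
  define P where "P = PiM (UNIV :: nat set) (\<lambda>_. std_normal_distribution)"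
  interpret prod: product_prob_space "\<lambda>_. std_normal_distribution" "UNIV :: nat set" ..
  interpret P: prob_space P unfolding P_def by (rule prod.prob_space_axioms)
  have coord [measurable]: "(\<lambda>w. w k) \<in> borel_measurable P" for k
  proof -
    have "(\<lambda>w. w k) \<in> measurable P std_normal_distribution" unfolding P_def by (rule measurable_component_singleton) simp
    then show ?thesis by (simp add: measurable_cong_sets[OF refl, of std_normal_distribution borel])
  qed
  have distr_coord: "distr P borel (\<lambda>w. w k) = std_normal_distribution" for k
  proof -
    have "distr P borel (\<lambda>w. w k) = distr P std_normal_distribution (\<lambda>w. w k)" by (intro distr_cong) auto
    then show ?thesis unfolding P_def using prod.PiM_component[of k] by simp
  qed
  have indep: "P.indep_vars (\<lambda>_. borel) (\<lambda>k w. w k) (UNIV :: nat set)"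
  proof (subst P.indep_vars_iff_distr_eq_PiM)
    have "distr P (PiM UNIV (\<lambda>_. borel)) (\<lambda>x. x) = P"
      by (rule distr_id2) (auto simp: P_def intro!: sets_PiM_cong)
    then show "distr P (PiM UNIV (\<lambda>_. borel)) (\<lambda>x. \<lambda>i\<in>UNIV. x i) = (\<Pi>\<^sub>M i\<in>UNIV. distr P borel (\<lambda>w. w i))"
      unfolding distr_coord by (simp add: P_def restrict_UNIV)
  qed auto
  have int_coord: "integrable P (\<lambda>w. f (w k)) = integrable std_normal_distribution f"
    "(LINT w|P. f (w k)) = (LINT x|std_normal_distribution. f x)" if "f \<in> borel_measurable borel" for f :: "real \<Rightarrow> real" and k
    using that unfolding distr_coord[symmetric, of k]
    by (simp_all add: integrable_distr_eq integral_distr)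
  define D where "D k w = w k *\<^sub>R a k" for k and w :: "nat \<Rightarrow> real"
  have D_meas [measurable]: "D k \<in> borel_measurable P" for k unfolding D_def by measurable
  have D_int: "integrable P (\<lambda>w. (norm (D k w))\<^sup>2)" "(LINT w|P. (norm (D k w))\<^sup>2) = (norm (a k))\<^sup>2" for k
  proof -
    have e: "(norm (D k w))\<^sup>2 = (w k)\<^sup>2 * (norm (a k))\<^sup>2" for w
      by (simp add: D_def power_mult_distrib)
    have "integrable P (\<lambda>w. (w k)\<^sup>2)" "(LINT w|P. (w k)\<^sup>2) = 1"
      using int_coord[of power2 k] std_normal_moments(2,4) by auto
    then show "integrable P (\<lambda>w. (norm (D k w))\<^sup>2)" "(LINT w|P. (norm (D k w))\<^sup>2) = (norm (a k))\<^sup>2"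
      unfolding e by simp_all
  qed
  have D_orth: "(LINT w|P. inner (D k w) (D l w)) = 0" if "k \<noteq> l" for k l
  proof -
    have "P.indep_var borel (\<lambda>w. w k) borel (\<lambda>w. w l)"
      by (rule P.indep_vars_imp_indep_var[OF indep]) (use that in auto)
    moreover have id: "(\<lambda>x. x) \<in> borel_measurable (borel :: real measure)" by simp
    have "integrable P (\<lambda>w. w k)" for k
      by (rule int_coord(1)[OF id, THEN iffD2]) (rule std_normal_moments(3))
    moreover have "(LINT w|P. w k) = 0" for k
      by (rule trans[OF int_coord(2)[OF id] std_normal_moments(1)])
    ultimately have z: "(LINT w|P. w k * w l) = 0"
      using P.indep_var_lebesgue_integral[of "\<lambda>w. w k" "\<lambda>w. w l"] by simp
    have "inner (D k w) (D l w) = (w k * w l) * inner (a k) (a l)" for w by (simp add: D_def)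
    then show ?thesis using z by simp
  qed
  have D_sum: "integrable P (\<lambda>w. (norm (\<Sum>k\<in>I. D k w))\<^sup>2)"
    "(LINT w|P. (norm (\<Sum>k\<in>I. D k w))\<^sup>2) = (\<Sum>k\<in>I. (norm (a k))\<^sup>2)" if "finite I" for I
    using P.mean_square_orthogonal_sum[OF that D_meas D_int(1) D_orth] by (auto simp: D_int(2))

  \<comment> \<open>Blocks beyond \<open>N j\<close> have mean square below \<open>(1/4)^j\<close>,
    so their mean norms are at most \<open>(1/2)^j\<close> and summable.\<close>
  have "\<exists>N. \<forall>m\<ge>N. \<forall>n. (\<Sum>k=m..<n. (norm (a k))\<^sup>2) < (1/4)^j" for j :: nat
  proof -
    have "(0::real) < (1/4)^j" by simp
    moreover have "norm (\<Sum>k=m..<n. (norm (a k))\<^sup>2) = (\<Sum>k=m..<n. (norm (a k))\<^sup>2)" for m n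
      unfolding real_norm_def by (intro abs_of_nonneg sum_nonneg) simp
    ultimately show ?thesis using a unfolding summable_Cauchy by metis
  qed
  then obtain N where N: "\<And>j m n. m \<ge> N j \<Longrightarrow> (\<Sum>k=m..<n. (norm (a k))\<^sup>2) < (1/4)^j" by metis
  \<comment> \<open>Dominates \<open>N j\<close>, is nondecreasing, and tends to infinity because of
    the summand \<open>j\<close>.\<close>
  define r where "r j = (\<Sum>i\<le>j. N i) + j" for j
  have r_mono: "r j \<le> r (Suc j)" for j by (simp add: r_def)
  have r_ge: "N j \<le> r j" for j
    unfolding r_def by (intro trans_le_add1 member_le_sum) auto
  have r_lim: "filterlim r at_top sequentially"
    by (rule filterlim_at_top_mono[OF filterlim_ident]) (simp add: r_def)
  define B where "B j w = (\<Sum>k=r j..<r (Suc j). D k w)" for j w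
  have B_meas [measurable]: "B j \<in> borel_measurable P" for j unfolding B_def by measurable
  have B_int: "integrable P (B j)" "(LINT w|P. norm (B j w)) \<le> (1/2)^j" for j
  proof -
    have sq: "integrable P (\<lambda>w. (norm (B j w))\<^sup>2)" unfolding B_def by (rule D_sum(1)) simp
    show "integrable P (B j)" by (rule P.norm_le_root_mean_square(1)[OF B_meas sq])
    have "(LINT w|P. norm (B j w)) \<le> sqrt (LINT w|P. (norm (B j w))\<^sup>2)"
      by (rule P.norm_le_root_mean_square(2)[OF B_meas sq])
    also have "... \<le> sqrt ((1/4)^j)"
      unfolding B_def D_sum(2)[OF finite_atLeastLessThan]
      using N[OF r_ge[of j], of "r (Suc j)"] by simp
    also have "... = (1/2)^j" by (simp add: real_sqrt_power real_sqrt_divide)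
    finally show "(LINT w|P. norm (B j w)) \<le> (1/2)^j" .
  qed
  define S where "S n w = (\<Sum>k<n. D k w)" for n w
  have S_meas [measurable]: "S n \<in> borel_measurable P" for n unfolding S_def by measurable
  \<comment> \<open>\<open>lim\<close> is measurable on the whole space; off the set of convergence
    its value is arbitrary.\<close>
  define G where "G w = lim (\<lambda>j. S (r j) w)" for w
  have G_meas [measurable]: "G \<in> borel_measurable P" unfolding G_def by measurable
  have "AE w in P. summable (\<lambda>j. norm (B j w))"
  proof -
    have "(\<integral>\<^sup>+w. (\<Sum>j. ennreal (norm (B j w))) \<partial>P) = (\<Sum>j. \<integral>\<^sup>+w. ennreal (norm (B j w)) \<partial>P)"
      by (rule nn_integral_suminf) measurable
    also have "... \<le> (\<Sum>j. ennreal ((1/2)^j))"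
      using B_int by (intro suminf_le) (auto simp: nn_integral_eq_integral intro: ennreal_leI)
    also have "... = ennreal (\<Sum>j. (1/2)^j)" by (intro suminf_ennreal2) (auto intro: summable_geometric)
    also have "... < \<infinity>" by simp
    finally have "AE w in P. (\<Sum>j. ennreal (norm (B j w))) \<noteq> \<infinity>"
      by (intro nn_integral_PInf_AE) auto
    then show ?thesis by eventually_elim (auto intro: summable_suminf_not_top)
  qed
  then have S_lim: "AE w in P. (\<lambda>j. S (r j) w) \<longlonglongrightarrow> G w"
  proof eventually_elim
    case (elim w)
    then have "(\<lambda>j. \<Sum>i<j. B i w) \<longlonglongrightarrow> (\<Sum>i. B i w)"
      by (rule summable_LIMSEQ[OF summable_norm_cancel])
    then have "(\<lambda>j. S (r 0) w + (\<Sum>i<j. B i w)) \<longlonglongrightarrow> S (r 0) w + (\<Sum>i. B i w)"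
      by (intro tendsto_intros)
    moreover have "S (r 0) w + (\<Sum>i<j. B i w) = S (r j) w" for j
    proof (induction j)
      case (Suc j)
      have "S (r (Suc j)) w = S (r j) w + B j w"
        unfolding S_def B_def using sum.atLeastLessThan_concat[of 0 "r j" "r (Suc j)" "\<lambda>k. D k w"] r_mono[of j]
        by (simp add: atLeast0LessThan)
      then show ?case using Suc by (simp add: add.assoc)
    qed simp
    ultimately have "convergent (\<lambda>j. S (r j) w)" by (auto simp: convergent_def)
    then show ?case unfolding G_def by (simp add: convergent_LIMSEQ_iff)
  qed
  \<comment> \<open>The factor \<open>t\<close> supplies the whole characteristic function of the
    projection on \<open>h\<close>, as Levy's uniqueness theorem requires.\<close>
  have char_S: "(LINT w|P. iexp (t * inner h (S n w))) = exp (- (t\<^sup>2 * (\<Sum>k<n. (inner (a k) h)\<^sup>2)) / 2)" for t h n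
  proof -
    let ?c = "\<lambda>k. inner (a k) h"
    have i: "P.indep_vars (\<lambda>_. borel) (\<lambda>k w. ?c k * w k) {..<n}"
      by (rule P.indep_vars_compose2[OF P.indep_vars_subset[OF indep]]) auto
    have "distr P borel (\<lambda>w. ?c k * w k) = normal_law (?c k)" for k
      unfolding normal_law_def distr_coord[of k, symmetric] by (subst distr_distr) (auto simp: comp_def)
    then have "char (distr P borel (\<lambda>w. \<Sum>k<n. ?c k * w k)) t = (\<Prod>k<n. char (normal_law (?c k)) t)"
      using P.char_distr_sum[OF i] by simp
    also have "... = exp (\<Sum>k<n. - ((?c k * t)\<^sup>2) / 2)"
      by (simp add: char_normal_law exp_sum)
    also have "(\<Sum>k<n. - ((?c k * t)\<^sup>2) / 2) = - (t\<^sup>2 * (\<Sum>k<n. (?c k)\<^sup>2)) / 2"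
      by (simp add: sum_negf sum_divide_distrib[symmetric] sum_distrib_left power_mult_distrib mult.commute)
    finally show ?thesis
      by (simp add: char_def integral_distr S_def D_def inner_sum_right mult.commute inner_commute)
  qed
  have char_G: "(LINT w|P. iexp (t * inner h (G w))) = exp (- (t\<^sup>2 * inner (Q h) h) / 2)" for t h
  proof (rule LIMSEQ_unique)
    show "(\<lambda>j. LINT w|P. iexp (t * inner h (S (r j) w))) \<longlonglongrightarrow> (LINT w|P. iexp (t * inner h (G w)))"
    proof (rule integral_dominated_convergence[where w = "\<lambda>_. 1"])
      show "AE w in P. (\<lambda>j. iexp (t * inner h (S (r j) w))) \<longlonglongrightarrow> iexp (t * inner h (G w))"
        using S_lim by eventually_elim (intro tendsto_intros)
    qed auto
    have "(\<lambda>j. \<Sum>k<r j. (inner (a k) h)\<^sup>2) \<longlonglongrightarrow> inner (Q h) h"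
      using filterlim_compose[OF Qa[of h, unfolded sums_def] r_lim] .
    then show "(\<lambda>j. LINT w|P. iexp (t * inner h (S (r j) w))) \<longlonglongrightarrow> exp (- (t\<^sup>2 * inner (Q h) h) / 2)"
      unfolding char_S by (intro tendsto_intros) auto
  qed
  define \<nu> where "\<nu> = distr P borel G"
  have s\<nu> [measurable_cong, simp]: "sets \<nu> = sets borel" by (simp add: \<nu>_def)
  interpret \<nu>: prob_space \<nu> unfolding \<nu>_def by (rule P.prob_space_distr) measurable
  have proj: "distr \<nu> borel (\<lambda>x. inner h x) = normal_law (sqrt (inner (Q h) h))" for h
  proof (rule Levy_uniqueness)
    show "real_distribution (distr \<nu> borel (\<lambda>x. inner h x))"
      by (rule \<nu>.real_distribution_distr) measurable
    show "real_distribution (normal_law (sqrt (inner (Q h) h)))" by (rule real_distribution_normal_law)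
    show "char (distr \<nu> borel (\<lambda>x. inner h x)) = char (normal_law (sqrt (inner (Q h) h)))"
    proof
      fix t
      have "char (distr \<nu> borel (\<lambda>x. inner h x)) t = (LINT w|P. iexp (t * inner h (G w)))"
        unfolding char_def \<nu>_def by (simp add: distr_distr integral_distr comp_def)
      also have "... = char (normal_law (sqrt (inner (Q h) h))) t"
        unfolding char_G char_normal_law using psd_op_nonneg[OF Q, of h]
        by (simp add: power_mult_distrib mult.commute)
      finally show "char (distr \<nu> borel (\<lambda>x. inner h x)) t = char (normal_law (sqrt (inner (Q h) h))) t" .
    qed
  qed
  have sq: "integrable \<nu> (\<lambda>x. (inner h x)\<^sup>2)" "(LINT x|\<nu>. (inner h x)\<^sup>2) = inner (Q h) h" for h
  proof -
    have "integrable (distr \<nu> borel (\<lambda>x. inner h x)) (\<lambda>y. y\<^sup>2)"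
      unfolding proj by (rule normal_law_square)
    then show "integrable \<nu> (\<lambda>x. (inner h x)\<^sup>2)" by (subst (asm) integrable_distr_eq) auto
    have "(\<integral>y. y\<^sup>2 \<partial>distr \<nu> borel (\<lambda>x. inner h x)) = inner (Q h) h"
      unfolding proj normal_law_square using psd_op_nonneg[OF Q, of h] by simp
    then show "(LINT x|\<nu>. (inner h x)\<^sup>2) = inner (Q h) h" by (subst (asm) integral_distr) auto
  qed
  have "(LINT x|\<nu>. inner h x * inner k x) = inner (Q h) k" for h k
  proof -
    \<comment> \<open>Polarisation recovers the covariance from the variances of the
      projections.\<close>
    have "inner h x * inner k x = 1/4 * ((inner (h + k) x)\<^sup>2 - (inner (h - k) x)\<^sup>2)" for x
      by (simp add: inner_add_left inner_diff_left power2_eq_square algebra_simps)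
    then have "(LINT x|\<nu>. inner h x * inner k x) = (LINT x|\<nu>. 1/4 * ((inner (h + k) x)\<^sup>2 - (inner (h - k) x)\<^sup>2))"
      by (simp only:)
    also have "... = 1/4 * (inner (Q (h + k)) (h + k) - inner (Q (h - k)) (h - k))"
      using sq[of "h + k"] sq[of "h - k"]
      by (subst integral_mult_right_zero, subst Bochner_Integration.integral_diff) simp_all
    also have "... = inner (Q h) k"
      using Q psd_op_sym[OF Q, of h k]
      by (simp add: psd_op_def linear_add linear_diff inner_add_left inner_add_right inner_diff_left inner_diff_right)
    finally show ?thesis .
  qed
  then have "centered_gaussian_law \<nu> Q"
    unfolding centered_gaussian_law_def centered_normal_law_iff
    using proj psd_op_nonneg[OF Q] \<nu>.prob_space_axioms s\<nu> by (metis real_sqrt_ge_zero)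
  then show ?thesis by blast
qed

section \<open>Gaussian test functions determine convergence in law\<close>

text \<open>A list of centres turns products into concatenations, so the linear span is an algebra;
  the empty list gives the constant 1.\<close>

definition gexp :: "'a::real_inner list \<Rightarrow> 'a \<Rightarrow> real" where
  "gexp l x = exp (- (\<Sum>a\<leftarrow>l. (norm (x - a))\<^sup>2))"

lemma gexp_append: "gexp (l @ l') x = gexp l x * gexp l' x"
  by (simp add: gexp_def exp_add[symmetric])

lemma sum_list_sq_nonneg: "(\<Sum>a\<leftarrow>l. (norm (x - a))\<^sup>2) \<ge> 0"
  by (induction l) auto

lemma gexp_bounds: "0 \<le> gexp l x" "gexp l x \<le> 1"
  using sum_list_sq_nonneg[of x l] by (auto simp: gexp_def)

lemma continuous_on_gexp: "continuous_on UNIV (gexp l)"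
proof -
  have "continuous_on UNIV (\<lambda>x. \<Sum>a\<leftarrow>l. (norm (x - a))\<^sup>2)"
    by (induction l) (auto intro!: continuous_intros)
  then show ?thesis unfolding gexp_def by (intro continuous_intros)
qed

inductive gspan :: "('a::real_inner \<Rightarrow> real) \<Rightarrow> bool" where
  base: "gspan (\<lambda>x. c * gexp l x)"
| add: "gspan f \<Longrightarrow> gspan g \<Longrightarrow> gspan (\<lambda>x. f x + g x)"

lemma gspan_const: "gspan (\<lambda>_. c)"
  using gspan.base[of c "[]"] by (simp add: gexp_def)

lemma gspan_mult:
  assumes "gspan f" "gspan g"
  shows "gspan (\<lambda>x. f x * g x)"
  using assms(1)
proof (induction rule: gspan.induct)
  case (base c l)
  from assms(2) show ?case
  proof (induction rule: gspan.induct)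
    case (base c' l')
    show ?case using gspan.base[of "c * c'" "l @ l'"] by (simp add: gexp_append mult_ac)
  next
    case (add f g)
    then show ?case using gspan.add by (simp add: distrib_left)
  qed
next
  case (add f1 f2)
  then show ?case using gspan.add by (simp add: distrib_right)
qed

lemma gspan_polynomial:
  assumes "gspan f" "real_polynomial_function (q :: real \<Rightarrow> real)"
  shows "gspan (\<lambda>x. q (f x))"
  using assms(2)
proof (induction rule: real_polynomial_function.induct)
  case (linear h)
  have "h (f x) = h 1 * f x" for x
    using linear_scale[OF bounded_linear.linear[OF linear], of "f x" 1] by (simp add: mult.commute)
  then have "(\<lambda>x. h (f x)) = (\<lambda>x. h 1 * f x)" by (rule ext)
  then show ?case using gspan_mult[OF gspan_const[of "h 1"] assms(1)] by (simp only:)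
qed (auto intro: gspan_const gspan.add gspan_mult)

lemma gspan_bounded: "gspan f \<Longrightarrow> \<exists>B. \<forall>x. \<bar>f x\<bar> \<le> B"
proof (induction rule: gspan.induct)
  case (base c l)
  have "\<bar>c * gexp l x\<bar> \<le> \<bar>c\<bar>" for x
    using gexp_bounds[of l x] by (simp add: abs_mult mult_left_le)
  then show ?case by blast
next
  case (add f g)
  then obtain B B' where "\<And>x. \<bar>f x\<bar> \<le> B" "\<And>x. \<bar>g x\<bar> \<le> B'" by blast
  then have "\<bar>f x + g x\<bar> \<le> B + B'" for x by (meson abs_triangle_ineq add_mono order_trans)
  then show ?case by blast
qed

lemma gspan_continuous: "gspan f \<Longrightarrow> continuous_on UNIV f"
  by (induction rule: gspan.induct) (auto intro!: continuous_intros continuous_on_gexp)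

definition gclos :: "('a::real_inner \<Rightarrow> real) \<Rightarrow> bool" where
  "gclos g \<longleftrightarrow> (\<forall>e>0. \<exists>p. gspan p \<and> (\<forall>x. \<bar>g x - p x\<bar> \<le> e))"

lemma gclos_gspan: "gspan p \<Longrightarrow> gclos p"
  unfolding gclos_def by (intro allI impI exI[of _ p]) auto

lemma gclos_add:
  assumes "gclos f" "gclos g"
  shows "gclos (\<lambda>x. f x + g x)"
  unfolding gclos_def
proof (intro allI impI)
  fix e :: real assume "e > 0"
  then obtain p q where p: "gspan p" "\<And>x. \<bar>f x - p x\<bar> \<le> e/2" and q: "gspan q" "\<And>x. \<bar>g x - q x\<bar> \<le> e/2"
    using assms unfolding gclos_def by (meson half_gt_zero)
  have "\<bar>(f x + g x) - (p x + q x)\<bar> \<le> e" for x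
    using p(2)[of x] q(2)[of x] by linarith
  then show "\<exists>p. gspan p \<and> (\<forall>x. \<bar>f x + g x - p x\<bar> \<le> e)"
    using gspan.add[OF p(1) q(1)] by blast
qed

text \<open>\<open>f\<close> stays close to a bounded element \<open>p\<close> of the span, so
  Weierstrass on a compact interval containing the values of \<open>p\<close> approximates
  \<open>u\<close>. With the absolute value for \<open>u\<close> the uniform closure becomes a
  lattice, although the underlying space need not be locally compact.\<close>

lemma gclos_continuous_compose:
  assumes "gclos f" and u: "uniformly_continuous_on UNIV (u :: real \<Rightarrow> real)"
  shows "gclos (\<lambda>x. u (f x))"
  unfolding gclos_def
proof (intro allI impI)
  fix e :: real assume e: "e > 0"
  then obtain d where d: "d > 0" "\<And>s t. \<bar>s - t\<bar> < d \<Longrightarrow> \<bar>u s - u t\<bar> < e/2"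
    using u unfolding uniformly_continuous_on_def dist_real_def by (metis UNIV_I half_gt_zero)
  obtain p where p: "gspan p" "\<And>x. \<bar>f x - p x\<bar> \<le> d/2"
    using assms(1) d(1) unfolding gclos_def by (meson half_gt_zero)
  obtain B where B: "\<And>x. \<bar>p x\<bar> \<le> B" using gspan_bounded[OF p(1)] by blast
  have "continuous_on {-B..B} u"
    using uniformly_continuous_imp_continuous[OF u] continuous_on_subset by blast
  then obtain q where q: "real_polynomial_function q" "\<And>t. t \<in> {-B..B} \<Longrightarrow> \<bar>u t - q t\<bar> < e/2"
    using Stone_Weierstrass_real_polynomial_function[of "{-B..B}" u "e/2"] e by auto
  have "\<bar>u (f x) - q (p x)\<bar> \<le> e" for x
  proof -
    have "\<bar>f x - p x\<bar> < d" "p x \<in> {-B..B}" using B[of x] p(2)[of x] d(1) by auto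
    then show ?thesis using d(2)[of "f x" "p x"] q(2)[of "p x"] by linarith
  qed
  then show "\<exists>p. gspan p \<and> (\<forall>x. \<bar>u (f x) - p x\<bar> \<le> e)"
    using gspan_polynomial[OF p(1) q(1)] by blast
qed

lemma gclos_cmult: "gclos f \<Longrightarrow> gclos (\<lambda>x. c * f x)"
  by (erule gclos_continuous_compose)
    (rule bounded_linear.uniformly_continuous_on[OF bounded_linear_mult_right uniformly_continuous_on_id])

lemma gclos_max:
  assumes "gclos f" "gclos g"
  shows "gclos (\<lambda>x. max (f x) (g x))"
proof -
  have "gclos (\<lambda>x. \<bar>f x + -1 * g x\<bar>)"
    by (intro gclos_continuous_compose[where u = abs] gclos_add gclos_cmult assms)
      (use abs_triangle_ineq3 in \<open>fastforce simp: uniformly_continuous_on_def dist_real_def\<close>)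
  then have "gclos (\<lambda>x. 1/2 * (f x + g x + \<bar>f x + -1 * g x\<bar>))"
    by (intro gclos_cmult gclos_add assms)
  moreover have "1/2 * (a + b + \<bar>a + -1 * b\<bar>) = max a b" for a b :: real
    by (simp add: max_def abs_if)
  ultimately show ?thesis by (simp only:)
qed

text \<open>A Gaussian bump at \<open>x\<close>, shifted down and cut off at 0: near
  \<open>x\<close> it stays below the values of \<open>f\<close>, elsewhere it vanishes.\<close>

lemma gclos_below:
  fixes f :: "'a::real_inner \<Rightarrow> real"
  assumes f: "continuous_on UNIV f" and nonneg: "\<And>y. f y \<ge> 0" and e: "e > 0"
  shows "\<exists>g. gclos g \<and> continuous_on UNIV g \<and> (\<forall>y. 0 \<le> g y \<and> g y \<le> f y) \<and> g x \<ge> f x - e"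
proof (cases "f x - e \<le> 0")
  case True
  then show ?thesis using nonneg
    by (intro exI[of _ "\<lambda>_. 0"]) (auto intro!: gclos_gspan gspan_const)
next
  case False
  define a where "a = f x - e"
  have a: "a > 0" using False by (simp add: a_def)
  obtain d where d: "d > 0" "\<And>y. dist y x < d \<Longrightarrow> dist (f y) (f x) < e"
    using f e unfolding continuous_on_iff by (metis UNIV_I)
  \<comment> \<open>With this amplitude the shifted bump has height \<open>a\<close> at
    \<open>x\<close> and reaches 0 at distance \<open>d\<close>.\<close>
  define u where "u = a / (1 - exp (- d\<^sup>2))"
  have ex: "exp (- d\<^sup>2) < 1" using d(1) by simp
  have u: "u > 0" "u * exp (- d\<^sup>2) = u - a" using a ex by (auto simp: u_def field_simps)
  define g where "g y = max 0 (u * gexp [x] y + (a - u))" for y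
  have "gclos g" unfolding g_def
    by (intro gclos_max gclos_add gclos_cmult gclos_gspan gspan_const)
      (use gspan.base[of 1 "[x]"] in simp)
  moreover have "continuous_on UNIV g"
    unfolding g_def by (intro continuous_intros continuous_on_gexp)
  moreover have "g y \<le> f y" for y
  proof (cases "dist y x < d")
    case True
    have "u * gexp [x] y \<le> u * 1" using u gexp_bounds[of "[x]" y] by (intro mult_left_mono) auto
    moreover have "a < f y" using d(2)[OF True] by (auto simp: a_def dist_real_def)
    ultimately show ?thesis using nonneg[of y] by (simp add: g_def)
  next
    case False
    have "d\<^sup>2 \<le> (norm (y - x))\<^sup>2" using False d(1) by (intro power_mono) (auto simp: dist_norm)
    then have "u * gexp [x] y \<le> u * exp (- d\<^sup>2)"
      using u(1) unfolding gexp_def by (intro mult_left_mono) auto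
    then show ?thesis using nonneg[of y] u by (simp add: g_def)
  qed
  moreover have "g x \<ge> f x - e" by (simp add: g_def gexp_def a_def)
  moreover have "0 \<le> g y" for y by (simp add: g_def)
  ultimately show ?thesis by blast
qed

lemma (in prob_space) abs_integral_diff_le:
  fixes f g :: "'a \<Rightarrow> real"
  assumes "integrable M f" "integrable M g" "\<And>x. \<bar>f x - g x\<bar> \<le> e"
  shows "\<bar>(LINT x|M. f x) - (LINT x|M. g x)\<bar> \<le> e"
proof -
  have "\<bar>LINT x|M. f x - g x\<bar> \<le> (LINT x|M. e)"
    using assms by (intro order.trans[OF integral_abs_bound] integral_mono) auto
  then show ?thesis using assms by (simp add: prob_space)
qed

text \<open>No tightness of the laws of the \<open>Y n\<close> is assumed: that the limit is a
  probability measure is what excludes a loss of mass.\<close>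

locale gaussian_tests = prob_space M for M :: "'w measure" +
  fixes Y :: "nat \<Rightarrow> 'w \<Rightarrow> 'a::{real_inner, second_countable_topology}" and \<nu> :: "'a measure"
  assumes Y_measurable [measurable]: "\<And>n. Y n \<in> borel_measurable M"
    and \<nu>: "prob_space \<nu>" and sets_\<nu> [measurable_cong, simp]: "sets \<nu> = sets borel"
    and gexp_tendsto: "\<And>l. (\<lambda>n. LINT w|M. gexp l (Y n w)) \<longlonglongrightarrow> (LINT x|\<nu>. gexp l x)"
begin

lemma integrable_bounded:
  fixes f :: "'a \<Rightarrow> real"
  assumes "f \<in> borel_measurable borel" "\<And>x. \<bar>f x\<bar> \<le> B"
  shows "integrable M (\<lambda>w. f (Y n w))" "integrable \<nu> f"
  using assms
  by (auto intro!: integrable_const_bound[where B = B] finite_measure.integrable_const_bound[where B = B]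
      prob_space.finite_measure[OF \<nu>] measurable_compose[OF Y_measurable] simp: measurable_cong_sets[OF sets_\<nu> refl])

lemma gspan_tendsto: "gspan p \<Longrightarrow> (\<lambda>n. LINT w|M. p (Y n w)) \<longlonglongrightarrow> (LINT x|\<nu>. p x)"
proof (induction rule: gspan.induct)
  case (base c l)
  show ?case by (simp add: tendsto_mult_left[OF gexp_tendsto])
next
  case (add f g)
  have *: "integrable M (\<lambda>w. p (Y n w))" "integrable \<nu> p" if "gspan p" for p n
    using integrable_bounded[OF borel_measurable_continuous_onI[OF gspan_continuous[OF that]]] gspan_bounded[OF that]
    by blast+
  show ?case using *[OF add(1)] *[OF add(2)] tendsto_add[OF add(3,4)] by simp
qed

lemma gclos_tendsto:
  assumes g: "gclos g" "continuous_on UNIV g" and B: "\<And>x. \<bar>g x\<bar> \<le> B"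
  shows "(\<lambda>n. LINT w|M. g (Y n w)) \<longlonglongrightarrow> (LINT x|\<nu>. g x)"
proof (rule LIMSEQ_I)
  fix e :: real assume e: "e > 0"
  obtain p where p: "gspan p" "\<And>x. \<bar>g x - p x\<bar> \<le> e/4" 
    using g(1) e unfolding gclos_def by (meson divide_pos_pos zero_less_numeral)
  obtain C where C: "\<And>x. \<bar>p x\<bar> \<le> C" using gspan_bounded[OF p(1)] by blast
  have gi: "integrable M (\<lambda>w. g (Y n w))" "integrable \<nu> g" for n
    using integrable_bounded[OF borel_measurable_continuous_onI[OF g(2)] B] by auto
  have pi: "integrable M (\<lambda>w. p (Y n w))" "integrable \<nu> p" for n
    using integrable_bounded[OF borel_measurable_continuous_onI[OF gspan_continuous[OF p(1)]] C] by auto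
  have 1: "\<bar>(LINT w|M. g (Y n w)) - (LINT w|M. p (Y n w))\<bar> \<le> e/4" for n
    using gi pi p(2) by (intro abs_integral_diff_le) auto
  have 2: "\<bar>(LINT x|\<nu>. g x) - (LINT x|\<nu>. p x)\<bar> \<le> e/4"
    using gi pi p(2) by (intro prob_space.abs_integral_diff_le \<nu>) auto
  obtain N where N: "\<And>n. n \<ge> N \<Longrightarrow> \<bar>(LINT w|M. p (Y n w)) - (LINT x|\<nu>. p x)\<bar> < e/4"
    using LIMSEQ_D[OF gspan_tendsto[OF p(1)], of "e/4"] e by auto
  show "\<exists>N. \<forall>n\<ge>N. norm ((LINT w|M. g (Y n w)) - (LINT x|\<nu>. g x)) < e"
  proof (intro exI[of _ N] allI impI)
    fix n assume "n \<ge> N"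
    then show "norm ((LINT w|M. g (Y n w)) - (LINT x|\<nu>. g x)) < e"
      using N[of n] 1[of n] 2 e unfolding real_norm_def by linarith
  qed
qed

text \<open>Below \<open>f\<close> lie countably many functions of the closure; at every point their
  finite maxima \<open>G j\<close> eventually come within \<open>2 * e'\<close> of \<open>f\<close>.
  Dominated convergence under the single measure \<open>\<nu>\<close> selects \<open>j\<close>, and
  \<open>G j \<le> f\<close> carries the bound over to all laws of large index.\<close>

lemma lower_semicontinuity:
  fixes f :: "'a \<Rightarrow> real"
  assumes f: "continuous_on UNIV f" and nonneg: "\<And>y. f y \<ge> 0" and B: "\<And>y. f y \<le> B" and e: "e > 0"
  shows "\<exists>N. \<forall>n\<ge>N. (LINT x|\<nu>. f x) - e \<le> (LINT w|M. f (Y n w))"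
proof -
  interpret \<nu>: prob_space \<nu> by (rule \<nu>)
  \<comment> \<open>The losses are \<open>2 * e'\<close> from the definition of \<open>U\<close>,
    \<open>e'\<close> from the shortfall \<open>h\<close> and \<open>e'\<close> from the convergence
    for \<open>G j\<close>.\<close>
  define e' where "e' = e / 5"
  have e': "e' > 0" using e by (simp add: e'_def)
  obtain g where g: "\<And>x. gclos (g x)" "\<And>x. continuous_on UNIV (g x)" "\<And>x y. 0 \<le> g x y"
      "\<And>x y. g x y \<le> f y" "\<And>x. g x x \<ge> f x - e'"
    using gclos_below[OF f nonneg e'] by metis
  define U where "U x = {y. f y - 2 * e' < g x y}" for x
  have U: "open (U x)" for x
    unfolding U_def using f g(2)[of x] by (intro open_Collect_less continuous_intros) auto
  \<comment> \<open>Second countability reduces the open cover by the sets \<open>U x\<close> to a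
    countable one.\<close>
  obtain F where F: "F \<subseteq> range U" "countable F" "\<Union>F = \<Union>(range U)"
    using Lindelof[of "range U"] U by blast
  have "x \<in> U x" for x using g(5)[of x] e' by (simp add: U_def)
  then have cover: "\<Union>F = UNIV" unfolding F(3) by blast
  then have "F \<noteq> {}" by auto
  obtain z where z: "F = range (\<lambda>j::nat. U (z j))"
  proof -
    have r: "range (from_nat_into F) = F" using \<open>F \<noteq> {}\<close> F(2) by (rule range_from_nat_into)
    then have "\<forall>j. \<exists>x. from_nat_into F j = U x" using F(1) by blast
    then obtain z where "\<forall>j. from_nat_into F j = U (z j)" by (rule choice[THEN exE])
    then show ?thesis using r that[of z] by simp
  qed
  define G where "G = rec_nat (g (z 0)) (\<lambda>j h y. max (h y) (g (z (Suc j)) y))"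
  have G0: "G 0 = g (z 0)" and GS: "G (Suc j) = (\<lambda>y. max (G j y) (g (z (Suc j)) y))" for j
    by (simp_all add: G_def)
  have G: "gclos (G j) \<and> continuous_on UNIV (G j) \<and> (\<forall>y. 0 \<le> G j y \<and> G j y \<le> f y)" for j
    by (induction j) (auto simp: G0 GS g intro!: gclos_max continuous_intros max.coboundedI1)
  have Gge: "g (z i) y \<le> G j y" if "i \<le> j" for i j y
    using that
  proof (induction j)
    case (Suc j)
    then show ?case by (cases "i = Suc j") (auto simp: GS le_max_iff_disj)
  qed (simp add: G0)
  have fB: "\<bar>f y\<bar> \<le> B" for y using nonneg[of y] B[of y] by simp
  have GB: "\<bar>G j y\<bar> \<le> B" for j y using G[of j] B[of y] by (auto intro: order.trans)
  have meas [measurable]: "f \<in> borel_measurable borel" "G j \<in> borel_measurable borel" for j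
    using f G[of j] by (auto intro!: borel_measurable_continuous_onI)
  note fi = integrable_bounded[OF meas(1) fB] and Gi = integrable_bounded[OF meas(2) GB]
  define h where "h j y = max 0 (f y - 2 * e' - G j y)" for j y
  have hB: "\<bar>h j y\<bar> \<le> B" for j y
    using G[of j] B[of y] nonneg[of y] e' unfolding h_def by (smt (verit))
  have "(\<lambda>j. LINT y|\<nu>. h j y) \<longlonglongrightarrow> (LINT y|\<nu>. 0)"
  proof (rule integral_dominated_convergence[where w = "\<lambda>_. B"])
    show "AE y in \<nu>. (\<lambda>j. h j y) \<longlonglongrightarrow> 0"
    proof (rule AE_I2, rule tendsto_eventually)
      fix y
      obtain i where "y \<in> U (z i)" using cover z by blast
      then have "f y - 2 * e' - G j y \<le> 0" if "j \<ge> i" for j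
        using Gge[OF that, of y] by (auto simp: U_def)
      then show "\<forall>\<^sub>F j in sequentially. h j y = 0"
        unfolding eventually_sequentially h_def by (intro exI[of _ i]) auto
    qed
  qed (use hB in \<open>auto simp: h_def\<close>)
  then obtain j where j: "\<bar>\<integral>y. h j y \<partial>\<nu>\<bar> < e'"
    using LIMSEQ_D[of _ _ e'] e' by fastforce
  have hi: "integrable \<nu> (h j)"
    by (rule integrable_bounded(2)[OF _ hB]) (simp add: h_def)
  have "(LINT y|\<nu>. f y - 2 * e') \<le> (LINT y|\<nu>. G j y + h j y)"
    using fi Gi hi by (intro integral_mono) (auto simp: h_def)
  then have 1: "(LINT y|\<nu>. f y) \<le> (LINT y|\<nu>. G j y) + 3 * e'"
    using fi Gi hi j by (simp add: \<nu>.prob_space)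
  have "(\<lambda>n. LINT w|M. G j (Y n w)) \<longlonglongrightarrow> (LINT x|\<nu>. G j x)"
    using G[of j] GB[of j] by (intro gclos_tendsto[of _ B]) auto
  from LIMSEQ_D[OF this e'] obtain N
    where N: "\<And>n. n \<ge> N \<Longrightarrow> \<bar>(LINT w|M. G j (Y n w)) - (LINT x|\<nu>. G j x)\<bar> < e'"
    unfolding real_norm_def by blast
  have 2: "(LINT w|M. G j (Y n w)) \<le> (LINT w|M. f (Y n w))" for n
    using fi Gi G[of j] by (intro integral_mono) auto
  show ?thesis
  proof (intro exI[of _ N] allI impI)
    fix n assume "n \<ge> N"
    then show "(LINT x|\<nu>. f x) - e \<le> (LINT w|M. f (Y n w))"
      using N[of n] 1 2[of n] e' unfolding e'_def by linarith
  qed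
qed

text \<open>The one-sided bound, applied to the nonnegative functions \<open>f + B\<close> and
  \<open>B - f\<close>, gives both inequalities.\<close>

theorem converges_in_law: "converges_in_law M Y \<nu>"
  unfolding converges_in_law_def
proof (intro allI impI, elim conjE)
  fix f :: "'a \<Rightarrow> real" assume f: "continuous_on UNIV f" and "bounded (range f)"
  then obtain B where B: "\<And>x. \<bar>f x\<bar> \<le> B" by (auto simp: bounded_iff)
  interpret \<nu>: prob_space \<nu> by (rule \<nu>)
  note fi = integrable_bounded[OF borel_measurable_continuous_onI[OF f] B]
  show "(\<lambda>n. LINT w|M. f (Y n w)) \<longlonglongrightarrow> (LINT x|\<nu>. f x)"
  proof (rule LIMSEQ_I)
    fix r :: real assume r: "r > 0"
    have fb: "- B \<le> f x" "f x \<le> B" for x using B[of x] by auto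
    have "0 \<le> f x + B" "f x + B \<le> 2 * B" "0 \<le> B - f x" "B - f x \<le> 2 * B" for x
      using fb[of x] by linarith+
    moreover have "continuous_on UNIV (\<lambda>x. f x + B)" "continuous_on UNIV (\<lambda>x. B - f x)"
      using f by (auto intro!: continuous_intros)
    moreover have "r / 2 > 0" using r by simp
    ultimately have "\<exists>N. \<forall>n\<ge>N. (LINT x|\<nu>. f x + B) - r/2 \<le> (LINT w|M. f (Y n w) + B)"
      and "\<exists>N. \<forall>n\<ge>N. (LINT x|\<nu>. B - f x) - r/2 \<le> (LINT w|M. B - f (Y n w))"
      by (auto intro!: lower_semicontinuity[where B = "2 * B"])
    then obtain N1 N2 where N1: "\<And>n. n \<ge> N1 \<Longrightarrow> (LINT x|\<nu>. f x + B) - r/2 \<le> (LINT w|M. f (Y n w) + B)"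
      and N2: "\<And>n. n \<ge> N2 \<Longrightarrow> (LINT x|\<nu>. B - f x) - r/2 \<le> (LINT w|M. B - f (Y n w))"
      by blast
    show "\<exists>N. \<forall>n\<ge>N. norm ((LINT w|M. f (Y n w)) - (LINT x|\<nu>. f x)) < r"
    proof (intro exI[of _ "max N1 N2"] allI impI)
      fix n assume "n \<ge> max N1 N2"
      then show "norm ((LINT w|M. f (Y n w)) - (LINT x|\<nu>. f x)) < r"
        using N1[of n] N2[of n] fi r by (simp add: prob_space \<nu>.prob_space)
    qed
  qed
qed

end

section \<open>Central limit theorem for bounded independent vectors\<close>

definition fgauss :: "('a::real_inner \<times> real) list \<Rightarrow> 'a \<Rightarrow> real" where
  "fgauss l x = exp (- (\<Sum>(e, b)\<leftarrow>l. (inner e x - b)\<^sup>2))"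

lemma fgauss_Cons: "fgauss ((e, b) # l) x = exp (- (inner e x - b)\<^sup>2) * fgauss l x"
  by (simp add: fgauss_def exp_add[symmetric])

lemma fgauss_bounds: "0 \<le> fgauss l x" "fgauss l x \<le> 1"
proof -
  have "(\<Sum>(e, b)\<leftarrow>l. (inner e x - b)\<^sup>2) \<ge> 0" by (induction l) auto
  then show "0 \<le> fgauss l x" "fgauss l x \<le> 1" by (auto simp: fgauss_def)
qed

lemma borel_measurable_fgauss [measurable]:
  "fgauss l \<in> borel_measurable (borel :: 'a::{real_inner, second_countable_topology} measure)"
proof (rule borel_measurable_continuous_onI)
  have "continuous_on UNIV (\<lambda>x. \<Sum>(e, b)\<leftarrow>l. (inner e x - b)\<^sup>2)"
    by (induction l) (auto intro!: continuous_intros)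
  then show "continuous_on UNIV (fgauss l)" unfolding fgauss_def by (intro continuous_intros)
qed

text \<open>A Gaussian factor is a mixture of characters, and the mixing integral can be exchanged with \<open>\<mu>\<close>.\<close>

lemma fgauss_Cons_integral:
  fixes \<mu> :: "'a::{real_inner, second_countable_topology} measure"
  assumes "prob_space \<mu>" and s\<mu> [measurable_cong]: "sets \<mu> = sets borel"
  shows "(LINT x|\<mu>. iexp (inner h x) * fgauss ((e, b) # l) x)
    = (LINT g|std_normal_distribution. iexp (- (sqrt 2 * g * b)) * (LINT x|\<mu>. iexp (inner (h + (sqrt 2 * g) *\<^sub>R e) x) * fgauss l x))"
proof -
  interpret \<mu>: prob_space \<mu> by fact
  interpret pair: pair_prob_space \<mu> std_normal_distribution ..
  define F where "F x g = iexp (inner h x) * fgauss l x * iexp (sqrt 2 * g * (inner e x - b))" for x g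
  have F_meas [measurable]: "case_prod F \<in> borel_measurable (\<mu> \<Otimes>\<^sub>M std_normal_distribution)"
    unfolding F_def by measurable
  have "cmod (F x g) \<le> 1" for x g
    unfolding F_def using fgauss_bounds[of l x] by (simp add: norm_mult)
  then have int: "integrable (\<mu> \<Otimes>\<^sub>M std_normal_distribution) (case_prod F)"
    by (intro pair.P.integrable_const_bound[where B = 1]) auto
  \<comment> \<open>The factor \<open>sqrt 2\<close> turns the normal characteristic function
    \<open>exp (- t\<^sup>2 / 2)\<close> into \<open>exp (- y\<^sup>2)\<close>.\<close>
  have g: "(LINT g|std_normal_distribution. iexp (sqrt 2 * g * y)) = exp (- y\<^sup>2)" for y :: real
  proof -
    have "(LINT g|std_normal_distribution. iexp (sqrt 2 * g * y)) = char std_normal_distribution (sqrt 2 * y)"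
      by (simp add: char_def mult_ac)
    then show ?thesis by (simp add: char_std_normal_distribution power_mult_distrib)
  qed
  have "(LINT x|\<mu>. iexp (inner h x) * fgauss ((e, b) # l) x) = (LINT x|\<mu>. LINT g|std_normal_distribution. F x g)"
    unfolding F_def fgauss_Cons by (simp only: integral_mult_right_zero g) (simp add: mult_ac)
  also have "... = (LINT g|std_normal_distribution. LINT x|\<mu>. F x g)"
    using pair.Fubini_integral[OF int] by simp
  also have "... = (LINT g|std_normal_distribution. iexp (- (sqrt 2 * g * b)) * (LINT x|\<mu>. iexp (inner (h + (sqrt 2 * g) *\<^sub>R e) x) * fgauss l x))"
  proof (rule Bochner_Integration.integral_cong[OF refl])
    fix g
    have "F x g = iexp (- (sqrt 2 * g * b)) * (iexp (inner (h + (sqrt 2 * g) *\<^sub>R e) x) * fgauss l x)" for x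
    proof -
      have "iexp (inner h x) * iexp (sqrt 2 * g * (inner e x - b))
          = iexp (- (sqrt 2 * g * b)) * iexp (inner (h + (sqrt 2 * g) *\<^sub>R e) x)"
        by (simp add: exp_add[symmetric] inner_add_left algebra_simps)
      then show ?thesis by (simp add: F_def mult_ac)
    qed
    then show "(LINT x|\<mu>. F x g) = iexp (- (sqrt 2 * g * b)) * (LINT x|\<mu>. iexp (inner (h + (sqrt 2 * g) *\<^sub>R e) x) * fgauss l x)"
      by (simp only: integral_mult_right_zero)
  qed
  finally show ?thesis .
qed

text \<open>Removing one factor shifts \<open>h\<close> to
  \<open>h + (sqrt 2 * g) *\<^sub>R e\<close>. This is why the statement carries a character and the
  induction keeps \<open>h\<close> arbitrary; dominated convergence in \<open>g\<close> passes to
  the limit.\<close>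

lemma char_tendsto_imp_fgauss_tendsto:
  fixes \<mu> :: "nat \<Rightarrow> 'a::{real_inner, second_countable_topology} measure"
  assumes \<mu>: "\<And>n. prob_space (\<mu> n)" "\<And>n. sets (\<mu> n) = sets borel"
    and \<nu>: "prob_space \<nu>" "sets \<nu> = sets borel"
    and conv: "\<And>h. (\<lambda>n. \<integral>x. iexp (inner h x) \<partial>\<mu> n) \<longlonglongrightarrow> (LINT x|\<nu>. iexp (inner h x))"
  shows "(\<lambda>n. \<integral>x. iexp (inner h x) * fgauss l x \<partial>\<mu> n) \<longlonglongrightarrow> (LINT x|\<nu>. iexp (inner h x) * fgauss l x)"
proof (induction l arbitrary: h)
  case Nil
  then show ?case using conv[of h] by (simp add: fgauss_def)
next
  case (Cons p l)
  obtain e b where p: "p = (e, b)" by (cases p)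
  let ?J = "\<lambda>\<rho> g. LINT x|\<rho>. iexp (inner (h + (sqrt 2 * g) *\<^sub>R e) x) * fgauss l x"
  have meas: "?J \<rho> \<in> borel_measurable borel"
    and bound: "cmod (LINT x|\<rho>. iexp (inner k x) * fgauss l x) \<le> 1"
    if "prob_space \<rho>" "sets \<rho> = sets borel" for \<rho> :: "'a measure" and k
  proof -
    interpret prob_space \<rho> by fact
    note that(2) [measurable_cong]
    show "?J \<rho> \<in> borel_measurable borel"
      by measurable
    have "cmod (LINT x|\<rho>. iexp (inner k x) * fgauss l x) \<le> (LINT x|\<rho>. 1)"
      using fgauss_bounds[of l]
      by (intro order.trans[OF integral_norm_bound] integral_mono integrable_norm integrable_const_bound[where B = 1])
        (auto simp: norm_mult)
    then show "cmod (LINT x|\<rho>. iexp (inner k x) * fgauss l x) \<le> 1" by (simp add: prob_space)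
  qed
  show ?case
    unfolding p fgauss_Cons_integral[OF \<mu>] fgauss_Cons_integral[OF \<nu>]
  proof (rule integral_dominated_convergence[where w = "\<lambda>_. 1"])
    show "AE g in std_normal_distribution. (\<lambda>n. iexp (- (sqrt 2 * g * b)) * ?J (\<mu> n) g)
      \<longlonglongrightarrow> iexp (- (sqrt 2 * g * b)) * ?J \<nu> g"
      by (intro AE_I2 tendsto_mult tendsto_const Cons.IH)
    show "AE g in std_normal_distribution. cmod (iexp (- (sqrt 2 * g * b)) * ?J (\<mu> n) g) \<le> 1" for n
      using bound[OF \<mu>] by (auto simp: norm_mult)
    note meas[OF \<mu>, measurable] meas[OF \<nu>, measurable]
    show "(\<lambda>g. iexp (- (sqrt 2 * g * b)) * ?J (\<mu> n) g) \<in> borel_measurable std_normal_distribution" for n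
      by measurable
    show "(\<lambda>g. iexp (- (sqrt 2 * g * b)) * ?J \<nu> g) \<in> borel_measurable std_normal_distribution"
      by measurable
  qed simp
qed

section \<open>Averaging over one new independent variable\<close>

lemma (in prob_space) integral_indep_var:
  fixes f :: "'b \<times> 'b \<Rightarrow> real"
  assumes ind: "indep_var S P T Y" and f [measurable]: "f \<in> borel_measurable (S \<Otimes>\<^sub>M T)"
    and int: "integrable M (\<lambda>w. f (P w, Y w))"
  shows "(LINT w|M. f (P w, Y w)) = (\<integral>w. (\<integral>y. f (P w, y) \<partial>distr M T Y) \<partial>M)"
proof -
  have P [measurable]: "P \<in> measurable M S" and Y [measurable]: "Y \<in> measurable M T"
    using ind by (auto simp: indep_var_distribution_eq)
  interpret P: prob_space "distr M S P" by (rule prob_space_distr) measurable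
  interpret Y: prob_space "distr M T Y" by (rule prob_space_distr) measurable
  interpret pair: pair_prob_space "distr M S P" "distr M T Y" ..
  have "(LINT w|M. f (P w, Y w)) = (\<integral>z. f z \<partial>distr M (S \<Otimes>\<^sub>M T) (\<lambda>w. (P w, Y w)))"
    by (subst integral_distr) auto
  also have "... = (\<integral>z. f z \<partial>(distr M S P \<Otimes>\<^sub>M distr M T Y))"
    using ind by (simp add: indep_var_distribution_eq)
  also have "... = (\<integral>x. \<integral>y. f (x, y) \<partial>distr M T Y \<partial>distr M S P)"
  proof (rule pair.integral_fst'[symmetric])
    have "distr M S P \<Otimes>\<^sub>M distr M T Y = distr M (S \<Otimes>\<^sub>M T) (\<lambda>w. (P w, Y w))"
      using ind by (simp add: indep_var_distribution_eq)
    then show "integrable (distr M S P \<Otimes>\<^sub>M distr M T Y) f" using int by (simp add: integrable_distr_eq)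
  qed
  also have "... = (\<integral>w. (\<integral>y. f (P w, y) \<partial>distr M T Y) \<partial>M)"
    by (subst integral_distr) auto
  finally show ?thesis .
qed

text \<open>Conditioning on the past in integral form: the block \<open>A\<close> and the single
  coordinate \<open>j\<close> are independent, so the latter can be integrated out against its own
  law with the block frozen.\<close>

lemma (in prob_space) integral_past_next:
  fixes g :: "('i \<Rightarrow> 'b) \<Rightarrow> 'b \<Rightarrow> real"
  assumes ind: "indep_vars (\<lambda>_. N) W UNIV" and j: "j \<notin> A"
    and g [measurable]: "case_prod g \<in> borel_measurable (PiM A (\<lambda>_. N) \<Otimes>\<^sub>M N)"
    and int: "integrable M (\<lambda>w. g (restrict (\<lambda>i. W i w) A) (W j w))"
  shows "(LINT w|M. g (restrict (\<lambda>i. W i w) A) (W j w))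
    = (\<integral>w. (\<integral>y. g (restrict (\<lambda>i. W i w) A) y \<partial>distr M N (W j)) \<partial>M)"
proof -
  let ?P = "\<lambda>w. restrict (\<lambda>i. W i w) A" and ?Y = "\<lambda>w. restrict (\<lambda>i. W i w) {j}"
  have W [measurable]: "W i \<in> measurable M N" for i using ind by (simp add: indep_vars_def)
  have P [measurable]: "?P \<in> measurable M (PiM A (\<lambda>_. N))" by measurable
  have "indep_var (PiM A (\<lambda>_. N)) ?P (PiM {j} (\<lambda>_. N)) ?Y"
    using j by (intro indep_var_restrict[OF ind]) auto
  then have "(LINT w|M. g (?P w) (?Y w j))
      = (\<integral>w. (\<integral>y. g (?P w) (y j) \<partial>distr M (PiM {j} (\<lambda>_. N)) ?Y) \<partial>M)"
    using integral_indep_var[of "PiM A (\<lambda>_. N)" ?P "PiM {j} (\<lambda>_. N)" ?Y "\<lambda>(x, y). g x (y j)"] int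
    by (simp add: split_beta')
  also have "... = (\<integral>w. (\<integral>y. g (?P w) y \<partial>distr M N (W j)) \<partial>M)"
  proof (rule Bochner_Integration.integral_cong[OF refl])
    fix w assume "w \<in> space M"
    then have "?P w \<in> space (PiM A (\<lambda>_. N))" using measurable_space[OF P] by simp
    then have [measurable]: "g (?P w) \<in> borel_measurable N" using g by measurable
    show "(\<integral>y. g (?P w) (y j) \<partial>distr M (PiM {j} (\<lambda>_. N)) ?Y) = (\<integral>y. g (?P w) y \<partial>distr M N (W j))"
      by (subst integral_distr, measurable, subst integral_distr) auto
  qed
  finally show ?thesis by simp
qed

lemma abs_exp_neg_diff_le: "u \<ge> 0 \<Longrightarrow> v \<ge> 0 \<Longrightarrow> \<bar>exp (- u) - exp (- v)\<bar> \<le> \<bar>u - v\<bar>" for u v :: real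
proof (induction u v rule: linorder_wlog)
  case (le u v)
  have "1 - exp (- (v - u)) \<le> v - u" using exp_ge_add_one_self[of "- (v - u)"] by linarith
  then have "exp (- u) * (1 - exp (- (v - u))) \<le> 1 * (v - u)"
    using le by (intro mult_mono) auto
  then have "exp (- u) - exp (- v) \<le> v - u" by (simp add: right_diff_distrib exp_add[symmetric])
  then show ?case using le by simp
qed (simp add: abs_minus_commute)

text \<open>For \<open>t \<ge> 0\<close> the profile \<open>exp (- t\<^sup>2)\<close> has slope at
  most 1 in modulus, since \<open>2 * t \<le> 1 + t\<^sup>2 \<le> exp (t\<^sup>2)\<close>.\<close>

lemma gexp_single_Lipschitz: "\<bar>gexp [a] x - gexp [a] y\<bar> \<le> norm (x - y)"
proof -
  have *: "\<bar>exp (- p\<^sup>2) - exp (- q\<^sup>2)\<bar> \<le> \<bar>p - q\<bar>" if "p \<ge> 0" "q \<ge> 0" for p q :: real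
    using that
  proof (induction p q rule: linorder_wlog)
    case (le p q)
    show ?case
    proof (cases "p = q")
      case False
      have "((\<lambda>t. exp (- t\<^sup>2)) has_real_derivative exp (- t\<^sup>2) * (- (2 * t))) (at t)" for t :: real
        by (auto intro!: derivative_eq_intros)
      with False obtain z where z: "p < z" "z < q" "exp (- q\<^sup>2) - exp (- p\<^sup>2) = (q - p) * (exp (- z\<^sup>2) * (- (2 * z)))"
        using le MVT2[of p q "\<lambda>t. exp (- t\<^sup>2)" "\<lambda>t. exp (- t\<^sup>2) * (- (2 * t))"]
        by force
      have "2 * z \<le> 1 + z\<^sup>2" using sum_squares_bound[of 1 z] by simp
      also have "... \<le> exp (z\<^sup>2)" by (rule exp_ge_add_one_self)
      finally have "exp (- z\<^sup>2) * (2 * z) \<le> exp (- z\<^sup>2) * exp (z\<^sup>2)" by (intro mult_left_mono) auto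
      then have "exp (- z\<^sup>2) * (2 * z) \<le> 1" by (simp add: exp_minus)
      have "\<bar>exp (- p\<^sup>2) - exp (- q\<^sup>2)\<bar> = (q - p) * (exp (- z\<^sup>2) * (2 * z))"
        using z le by (simp add: abs_minus_commute[of "exp (- p\<^sup>2)"] abs_mult)
      also have "... \<le> (q - p) * 1"
        using le \<open>exp (- z\<^sup>2) * (2 * z) \<le> 1\<close> by (intro mult_left_mono) auto
      also have "... = \<bar>p - q\<bar>" using le by simp
      finally show ?thesis .
    qed simp
  qed (simp add: abs_minus_commute)
  have "\<bar>gexp [a] x - gexp [a] y\<bar> \<le> \<bar>norm (x - a) - norm (y - a)\<bar>"
    using *[of "norm (x - a)" "norm (y - a)"] by (simp add: gexp_def)
  also have "... \<le> norm (x - y)" using norm_triangle_ineq3[of "x - a" "y - a"] by simp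
  finally show ?thesis .
qed

text \<open>Makes an error that tends to 0 in mean norm invisible to the test functions.\<close>

lemma gexp_Lipschitz: "\<bar>gexp l x - gexp l y\<bar> \<le> real (length l) * norm (x - y)"
proof (induction l)
  case (Cons a l)
  have "gexp (a # l) x - gexp (a # l) y
      = (gexp [a] x - gexp [a] y) * gexp l x + gexp [a] y * (gexp l x - gexp l y)"
    unfolding gexp_append[of "[a]" l, simplified] by (simp add: algebra_simps)
  also have "\<bar>...\<bar> \<le> \<bar>(gexp [a] x - gexp [a] y) * gexp l x\<bar> + \<bar>gexp [a] y * (gexp l x - gexp l y)\<bar>"
    by (rule abs_triangle_ineq)
  also have "... \<le> norm (x - y) * 1 + 1 * (real (length l) * norm (x - y))"
    unfolding abs_mult using gexp_bounds[of l x] gexp_bounds[of "[a]" y]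
    by (intro add_mono mult_mono gexp_single_Lipschitz Cons.IH) auto
  finally show ?case by (simp add: algebra_simps)
qed (simp add: gexp_def)

section \<open>Approximation of Gaussian test functions along a frame\<close>

locale Parseval_frame =
  fixes e :: "nat \<Rightarrow> 'a::{real_inner, second_countable_topology, banach}"
  assumes Parseval: "\<And>x. (\<lambda>k. (inner (e k) x)\<^sup>2) sums (norm x)\<^sup>2"
begin

text \<open>The part of the energy of \<open>x\<close> that the first \<open>k\<close> frame vectors
  miss.\<close>

definition tail :: "nat \<Rightarrow> 'a \<Rightarrow> real" where
  "tail k x = (norm x)\<^sup>2 - (\<Sum>j<k. (inner (e j) x)\<^sup>2)"

lemma tail_nonneg: "tail k x \<ge> 0"
proof -
  have "(\<Sum>j<k. (inner (e j) x)\<^sup>2) \<le> (norm x)\<^sup>2"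
    using Parseval[of x] by (metis finite_lessThan sum_le_suminf sums_iff zero_le_power2)
  then show ?thesis by (simp add: tail_def)
qed

lemma tail_le: "tail k x \<le> (norm x)\<^sup>2" by (simp add: tail_def sum_nonneg)

lemma tail_tendsto: "(\<lambda>k. tail k x) \<longlonglongrightarrow> 0"
  unfolding tail_def using tendsto_diff[OF tendsto_const[of "(norm x)\<^sup>2"] Parseval[of x, unfolded sums_def]] by simp

text \<open>Parallelogram identity for the nonnegative quadratic form \<open>tail k\<close>.\<close>

lemma tail_diff_le: "tail k (x - a) \<le> 2 * tail k x + 2 * tail k a"
proof -
  have "tail k (x - a) + tail k (x + a) = 2 * tail k x + 2 * tail k a"
    by (simp add: tail_def power2_norm_eq_inner inner_add_left inner_add_right inner_diff_left inner_diff_right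
        power2_sum power2_diff sum.distrib sum_subtractf sum_distrib_left algebra_simps)
  then show ?thesis using tail_nonneg[of k "x + a"] by linarith
qed

lemma borel_measurable_tail [measurable]: "tail k \<in> borel_measurable borel"
  unfolding tail_def by measurable

text \<open>With this list \<open>fgauss\<close> becomes \<open>gexp l\<close> in which every
  squared distance is replaced by its partial sum over the first \<open>k\<close> frame
  vectors.\<close>

definition cut :: "nat \<Rightarrow> 'a list \<Rightarrow> ('a \<times> real) list" where
  "cut k l = concat (map (\<lambda>a. map (\<lambda>j. (e j, inner (e j) a)) [0..<k]) l)"

lemma fgauss_cut: "fgauss (cut k l) x = exp (- (\<Sum>a\<leftarrow>l. (norm (x - a))\<^sup>2 - tail k (x - a)))"
proof -
  have "(\<Sum>(u, b)\<leftarrow>cut k l. (inner u x - b)\<^sup>2) = (\<Sum>a\<leftarrow>l. (norm (x - a))\<^sup>2 - tail k (x - a))"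
  proof (induction l)
    case (Cons a l)
    have "(\<Sum>(u, b)\<leftarrow>map (\<lambda>j. (e j, inner (e j) a)) [0..<k]. (inner u x - b)\<^sup>2) = (\<Sum>j<k. (inner (e j) (x - a))\<^sup>2)"
      by (simp add: comp_def inner_diff_right interv_sum_list_conv_sum_set_nat atLeast0LessThan)
    then show ?case using Cons by (simp add: cut_def tail_def)
  qed (simp add: cut_def)
  then show ?thesis by (simp add: fgauss_def)
qed

text \<open>On the right only \<open>tail k x\<close> depends on \<open>x\<close>, and its mean is
  the same under all normalised sums. This makes the approximation uniform in their index.\<close>

lemma gexp_fgauss_diff:
  "\<bar>gexp l x - fgauss (cut k l) x\<bar> \<le> 2 * real (length l) * tail k x + 2 * (\<Sum>a\<leftarrow>l. tail k a)"
proof -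
  have nn: "(\<Sum>a\<leftarrow>l. (norm (x - a))\<^sup>2 - tail k (x - a)) \<ge> 0"
    using tail_le by (intro sum_list_nonneg) auto
  have "\<bar>gexp l x - fgauss (cut k l) x\<bar> \<le> \<bar>(\<Sum>a\<leftarrow>l. (norm (x - a))\<^sup>2) - (\<Sum>a\<leftarrow>l. (norm (x - a))\<^sup>2 - tail k (x - a))\<bar>"
    unfolding fgauss_cut unfolding gexp_def by (intro abs_exp_neg_diff_le sum_list_sq_nonneg nn)
  also have "... = (\<Sum>a\<leftarrow>l. tail k (x - a))"
  proof -
    have "(\<Sum>a\<leftarrow>l. tail k (x - a)) \<ge> 0" by (intro sum_list_nonneg) (auto simp: tail_nonneg)
    then show ?thesis by (simp add: sum_list_subtractf)
  qed
  also have "... \<le> (\<Sum>a\<leftarrow>l. 2 * tail k x + 2 * tail k a)"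
    by (intro sum_list_mono tail_diff_le)
  also have "... = 2 * real (length l) * tail k x + 2 * (\<Sum>a\<leftarrow>l. tail k a)"
    by (simp add: sum_list_addf sum_list_const_mult sum_list_triv)
  finally show ?thesis .
qed

lemma fgauss_cut_tendsto: "(\<lambda>k. fgauss (cut k l) x) \<longlonglongrightarrow> gexp l x"
proof -
  have "(\<lambda>k. \<Sum>a\<leftarrow>l. (norm (x - a))\<^sup>2 - tail k (x - a)) \<longlonglongrightarrow> (\<Sum>a\<leftarrow>l. (norm (x - a))\<^sup>2)"
  proof (induction l)
    case (Cons a l)
    have "(\<lambda>k. (norm (x - a))\<^sup>2 - tail k (x - a)) \<longlonglongrightarrow> (norm (x - a))\<^sup>2"
      using tendsto_diff[OF tendsto_const[of "(norm (x - a))\<^sup>2"] tail_tendsto[of "x - a"]] by simp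
    then show ?case using tendsto_add[OF _ Cons] by simp
  qed simp
  then show ?thesis unfolding fgauss_cut gexp_def by (intro tendsto_intros)
qed

end

section \<open>Normalised sums of bounded independent vectors\<close>

locale bounded_iid = prob_space M for M :: "'w measure" +
  fixes V :: "nat \<Rightarrow> 'w \<Rightarrow> 'a::{real_inner, banach, second_countable_topology}" and B :: real
  assumes indep: "indep_vars (\<lambda>_. borel) V UNIV"
    and ident: "\<And>n. distr M borel (V n) = distr M borel (V 0)"
    and bdd: "\<And>n w. norm (V n w) \<le> B"
    and mean: "(LINT w|M. V 0 w) = 0"
begin

lemma V_measurable [measurable]: "V n \<in> borel_measurable M"
  using indep by (simp add: indep_vars_def)

lemma ident_integral:
  fixes f :: "'a \<Rightarrow> 'b::{banach, second_countable_topology}"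
  assumes "f \<in> borel_measurable borel"
  shows "(LINT w|M. f (V n w)) = (LINT w|M. f (V 0 w))"
proof -
  have "(LINT w|M. f (V n w)) = (\<integral>x. f x \<partial>distr M borel (V n))" using assms by (subst integral_distr) auto
  also have "... = (LINT w|M. f (V 0 w))" unfolding ident[of n] using assms by (subst integral_distr) auto
  finally show ?thesis .
qed

lemma V_integrable [simp]: "integrable M (V n)" 
  by (rule integrable_const_bound[where B = B]) (auto simp: bdd)

lemma mean_n: "(LINT w|M. V n w) = 0"
  using ident_integral[of "\<lambda>x. x" n] mean by simp

lemma inner_bdd: "\<bar>inner h (V n w)\<bar> \<le> norm h * B"
  by (rule order.trans[OF Cauchy_Schwarz_ineq2 mult_left_mono[OF bdd norm_ge_zero]])

lemma inner_V_square_integrable [simp]: "integrable M (\<lambda>w. (inner h (V n w))\<^sup>2)"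
proof (rule integrable_const_bound[where B = "(norm h * B)\<^sup>2"])
  show "AE w in M. norm ((inner h (V n w))\<^sup>2) \<le> (norm h * B)\<^sup>2"
    by (intro AE_I2) (simp only: real_norm_def abs_power2, rule power_mono[OF inner_bdd abs_ge_zero, where n = 2, simplified])
qed measurable

lemma V_square_integrable [simp]: "integrable M (\<lambda>w. (norm (V n w))\<^sup>2)"
  by (rule integrable_const_bound[where B = "B\<^sup>2"]) (auto intro!: power_mono bdd)

lemma V_orthogonal:
  assumes "i \<noteq> j"
  shows "(LINT w|M. inner (V i w) (V j w)) = 0"
proof -
  have "integrable M (\<lambda>w. inner (V i w) (V j w))"
  proof (rule integrable_const_bound[where B = "B * B"])
    have "\<bar>inner (V i w) (V j w)\<bar> \<le> B * B" for w
      by (rule order.trans[OF Cauchy_Schwarz_ineq2 mult_mono'[OF bdd bdd norm_ge_zero norm_ge_zero]])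
    then show "AE w in M. norm (inner (V i w) (V j w)) \<le> B * B" by simp
  qed measurable
  then have "(LINT w|M. inner (V i w) (V j w)) = (\<integral>w. (\<integral>y. inner (V i w) y \<partial>distr M borel (V j)) \<partial>M)"
    using integral_past_next[OF indep, of j "{i}" "\<lambda>f y. inner (f i) y"] assms by simp
  also have "... = (LINT w|M. (LINT w'|M. inner (V i w) (V j w')))"
    by (intro Bochner_Integration.integral_cong refl, subst integral_distr) simp_all
  also have "... = 0" by (simp add: mean_n)
  finally show ?thesis .
qed

definition S :: "nat \<Rightarrow> 'w \<Rightarrow> 'a" where
  "S n w = (1 / sqrt (real n)) *\<^sub>R (\<Sum>i<n. V i w)"

lemma S_measurable [measurable]: "S n \<in> borel_measurable M" unfolding S_def by measurable

text \<open>Neither the total second moment nor that in a direction changes with \<open>n\<close>,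
  hence neither does the mean of \<open>tail k\<close>. Index 0 is excluded because
  \<open>S 0\<close> is 0.\<close>

lemma S_second_moments:
  assumes "n > 0"
  shows "integrable M (\<lambda>w. (norm (S n w))\<^sup>2)"
    "(LINT w|M. (norm (S n w))\<^sup>2) = (LINT w|M. (norm (V 0 w))\<^sup>2)"
    "integrable M (\<lambda>w. (inner h (S n w))\<^sup>2)"
    "(LINT w|M. (inner h (S n w))\<^sup>2) = (LINT w|M. (inner h (V 0 w))\<^sup>2)"
proof -
  have 1: "(norm (S n w))\<^sup>2 = 1 / n * (norm (\<Sum>i<n. V i w))\<^sup>2" for w
    by (simp add: S_def power_divide)
  have n1: "integrable M (\<lambda>w. (norm (\<Sum>i<n. V i w))\<^sup>2)"
    "(LINT w|M. (norm (\<Sum>i<n. V i w))\<^sup>2) = (\<Sum>i<n. LINT w|M. (norm (V i w))\<^sup>2)"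
    using V_orthogonal by (intro mean_square_orthogonal_sum; simp)+
  have "(\<Sum>i<n. LINT w|M. (norm (V i w))\<^sup>2) = (\<Sum>i<n. LINT w|M. (norm (V 0 w))\<^sup>2)"
    by (intro sum.cong refl ident_integral) measurable
  then have c: "(\<Sum>i<n. LINT w|M. (norm (V i w))\<^sup>2) = n * (LINT w|M. (norm (V 0 w))\<^sup>2)"
    by simp
  show "integrable M (\<lambda>w. (norm (S n w))\<^sup>2)"
    "(LINT w|M. (norm (S n w))\<^sup>2) = (LINT w|M. (norm (V 0 w))\<^sup>2)"
    unfolding 1 using n1 c assms by simp_all
  have 2: "(inner h (S n w))\<^sup>2 = 1 / n * (norm (\<Sum>i<n. inner h (V i w)))\<^sup>2" for w
    by (simp add: S_def power_divide inner_sum_right)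
  have o: "(LINT w|M. inner (inner h (V i w)) (inner h (V j w))) = 0" if "i \<noteq> j" for i j
  proof -
    have "indep_var borel (\<lambda>w. inner h (V i w)) borel (\<lambda>w. inner h (V j w))"
      by (rule indep_vars_imp_indep_var[OF indep_vars_compose2[OF indep]]) (use that in auto)
    from indep_var_lebesgue_integral[OF this] show ?thesis by (simp add: mean_n)
  qed
  have n2: "integrable M (\<lambda>w. (norm (\<Sum>i<n. inner h (V i w)))\<^sup>2)"
    "(LINT w|M. (norm (\<Sum>i<n. inner h (V i w)))\<^sup>2) = (\<Sum>i<n. LINT w|M. (norm (inner h (V i w)))\<^sup>2)"
    by (rule mean_square_orthogonal_sum; use o in simp)+
  have "(\<Sum>i<n. LINT w|M. (norm (inner h (V i w)))\<^sup>2) = (\<Sum>i<n. LINT w|M. (norm (inner h (V 0 w)))\<^sup>2)"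
    by (intro sum.cong refl ident_integral[where f = "\<lambda>x. (norm (inner h x))\<^sup>2"]) measurable
  then have c2: "(\<Sum>i<n. LINT w|M. (norm (inner h (V i w)))\<^sup>2) = n * (LINT w|M. (inner h (V 0 w))\<^sup>2)"
    by simp
  show "integrable M (\<lambda>w. (inner h (S n w))\<^sup>2)"
    "(LINT w|M. (inner h (S n w))\<^sup>2) = (LINT w|M. (inner h (V 0 w))\<^sup>2)"
    unfolding 2 using n2 c2 assms by simp_all
qed

text \<open>The central limit theorem on the line for the projections on \<open>h\<close>. A
  direction of zero variance, where one cannot normalise, is treated apart: there the projections
  vanish almost surely.\<close>

lemma char_S_tendsto:
  "(\<lambda>n. LINT w|M. iexp (inner h (S n w))) \<longlonglongrightarrow> exp (- (LINT w|M. (inner h (V 0 w))\<^sup>2) / 2)"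
proof -
  define q where "q = (LINT w|M. (inner h (V 0 w))\<^sup>2)"
  have q0: "q \<ge> 0" unfolding q_def by (intro integral_nonneg_AE) simp
  have qn: "(LINT w|M. (inner h (V n w))\<^sup>2) = q" for n
    unfolding q_def by (rule ident_integral) measurable
  show ?thesis
  proof (cases "q = 0")
    case True
    have "AE w in M. inner h (V i w) = 0" for i
    proof -
      have "AE w in M. (inner h (V i w))\<^sup>2 = 0"
        using integral_nonneg_eq_0_iff_AE[of M "\<lambda>w. (inner h (V i w))\<^sup>2"] qn[of i] True by simp
      then show ?thesis by eventually_elim simp
    qed
    then have "AE w in M. \<forall>i. inner h (V i w) = 0" by (simp add: AE_all_countable)
    then have "(LINT w|M. iexp (inner h (S n w))) = (LINT w|M. 1)" for n
      by (intro integral_cong_AE) (auto simp: S_def inner_sum_right elim!: eventually_mono)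
    then show ?thesis using True by (simp add: prob_space q_def)
  next
    case False
    define \<sigma> where "\<sigma> = sqrt q"
    have \<sigma>: "\<sigma> > 0" "\<sigma>\<^sup>2 = q" using False q0 by (auto simp: \<sigma>_def)
    let ?X = "\<lambda>n w. inner h (V n w)"
    have mean0: "expectation (?X n) = 0" for n by (simp add: mean_n)
    have "weak_conv_m (\<lambda>n. distr M borel (\<lambda>w. (\<Sum>i<n. ?X i w) / sqrt (n * \<sigma>\<^sup>2))) std_normal_distribution"
    proof (rule central_limit_theorem_zero_mean)
      show "indep_vars (\<lambda>i. borel) ?X UNIV" by (rule indep_vars_compose2[OF indep]) auto
      show "distr M borel (?X n) = distr M borel (?X 0)" for n
      proof -
        have "distr M borel (?X n) = distr (distr M borel (V n)) borel (inner h)" for n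
          by (subst distr_distr) (auto simp: comp_def)
        then show ?thesis by (simp add: ident[of n])
      qed
      show "variance (?X n) = \<sigma>\<^sup>2" for n
        unfolding mean0 \<sigma> using qn[of n] by simp
    qed (use mean0 \<sigma> in auto)
    \<comment> \<open>Evaluating at \<open>\<sigma>\<close> undoes the division by the standard
      deviation.\<close>
    then have "(\<lambda>n. char (distr M borel (\<lambda>w. (\<Sum>i<n. ?X i w) / sqrt (n * \<sigma>\<^sup>2))) \<sigma>) \<longlonglongrightarrow> char std_normal_distribution \<sigma>"
      by (intro levy_continuity1 real_distribution_distr real_dist_normal_dist) measurable
    moreover have "char (distr M borel (\<lambda>w. (\<Sum>i<n. ?X i w) / sqrt (n * \<sigma>\<^sup>2))) \<sigma> = (LINT w|M. iexp (inner h (S n w)))" for n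
    proof -
      have "\<sigma> * ((\<Sum>i<n. ?X i w) / sqrt (n * \<sigma>\<^sup>2)) = inner h (S n w)" for w
        using \<sigma>(1) by (simp add: S_def inner_sum_right real_sqrt_mult)
      then show ?thesis unfolding char_def by (subst integral_distr) simp_all
    qed
    ultimately show ?thesis using \<sigma> by (simp add: char_std_normal_distribution q_def)
  qed
qed

text \<open>Slutsky's theorem is built in: \<open>Y\<close> may differ from \<open>S\<close> by an
  error that vanishes in mean norm. For \<open>S\<close> the tests \<open>fgauss\<close> converge,
  and \<open>gexp l\<close> differs from them by a mean error \<open>d k\<close> that does not
  depend on \<open>n\<close>.\<close>

theorem converges_in_law_gaussian:
  assumes \<nu>: "centered_gaussian_law \<nu> Q" and Q: "\<And>h. inner (Q h) h = (LINT w|M. (inner h (V 0 w))\<^sup>2)"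
    and Y [measurable]: "\<And>n. Y n \<in> borel_measurable M"
    and diff_int: "\<And>n. integrable M (\<lambda>w. Y n w - S n w)"
    and diff: "(\<lambda>n. LINT w|M. norm (Y n w - S n w)) \<longlonglongrightarrow> 0"
  shows "converges_in_law M Y \<nu>"
proof -
  have p\<nu>: "prob_space \<nu>" and s\<nu> [measurable_cong]: "sets \<nu> = sets borel"
    using \<nu> by (auto simp: centered_gaussian_law_def)
  interpret \<nu>: prob_space \<nu> by (rule p\<nu>)
  obtain e where "\<And>h::'a. (\<lambda>k. (inner (e k) h)\<^sup>2) sums (norm h)\<^sup>2" for k :: nat
    using ex_Parseval_frame[where 'a = 'a] by metis
  then interpret Parseval_frame e by unfold_locales
  have fg: "(\<lambda>n. LINT w|M. fgauss l (S n w)) \<longlonglongrightarrow> (LINT x|\<nu>. fgauss l x)" for l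
  proof -
    \<comment> \<open>At \<open>h = 0\<close> the character is 1 and the complex integrals are
      real.\<close>
    have "(\<lambda>n. \<integral>x. iexp (inner 0 x) * fgauss l x \<partial>distr M borel (S n)) \<longlonglongrightarrow> (LINT x|\<nu>. iexp (inner 0 x) * fgauss l x)"
    proof (rule char_tendsto_imp_fgauss_tendsto)
      show "(\<lambda>n. \<integral>x. iexp (inner h x) \<partial>distr M borel (S n)) \<longlonglongrightarrow> (LINT x|\<nu>. iexp (inner h x))" for h
        unfolding centered_gaussian_law_char[OF \<nu>] Q using char_S_tendsto[of h]
        by (simp add: integral_distr)
    qed (simp_all add: prob_space_distr p\<nu> s\<nu>)
    then have "(\<lambda>n. complex_of_real (LINT w|M. fgauss l (S n w))) \<longlonglongrightarrow> complex_of_real (LINT x|\<nu>. fgauss l x)"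
      by (simp add: integral_distr)
    then show ?thesis by (simp only: tendsto_of_real_iff)
  qed
  have tail_int: "integrable M (\<lambda>w. tail k (V 0 w))" for k
    unfolding tail_def by simp
  have tail_S: "integrable M (\<lambda>w. tail k (S n w))" "(LINT w|M. tail k (S n w)) = (LINT w|M. tail k (V 0 w))"
    if "n > 0" for k n
    using S_second_moments[OF that] unfolding tail_def by simp_all
  have tail0: "(\<lambda>k. LINT w|M. tail k (V 0 w)) \<longlonglongrightarrow> 0"
  proof -
    have "(\<lambda>k. LINT w|M. tail k (V 0 w)) \<longlonglongrightarrow> (LINT w|M. 0)"
    proof (rule integral_dominated_convergence[where w = "\<lambda>w. (norm (V 0 w))\<^sup>2"])
      show "AE w in M. norm (tail k (V 0 w)) \<le> (norm (V 0 w))\<^sup>2" for k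
        using tail_nonneg tail_le by simp
    qed (auto simp: tail_tendsto)
    then show ?thesis by simp
  qed
  have ge_int: "integrable M (\<lambda>w. gexp l (Y n w))" "integrable M (\<lambda>w. gexp l (S n w))"
    "integrable M (\<lambda>w. fgauss l' (S n w))" for l l' n
  proof -
    note borel_measurable_continuous_onI[OF continuous_on_gexp, measurable]
    show "integrable M (\<lambda>w. gexp l (Y n w))" "integrable M (\<lambda>w. gexp l (S n w))"
      "integrable M (\<lambda>w. fgauss l' (S n w))"
      using gexp_bounds[of l] fgauss_bounds[of l']
      by (auto intro!: integrable_const_bound[where B = 1])
  qed
  have S_lim: "(\<lambda>n. LINT w|M. gexp l (S n w)) \<longlonglongrightarrow> (LINT x|\<nu>. gexp l x)" for l
  proof (rule LIMSEQ_I)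
    fix r :: real assume r: "r > 0"
    define d where "d k = 2 * real (length l) * (LINT w|M. tail k (V 0 w)) + 2 * (\<Sum>a\<leftarrow>l. tail k a)" for k
    have "(\<lambda>k. \<Sum>a\<leftarrow>l. tail k a) \<longlonglongrightarrow> 0"
    proof (induction l)
      case (Cons a l)
      then show ?case using tendsto_add[OF tail_tendsto Cons] by simp
    qed simp
    then have "d \<longlonglongrightarrow> 2 * real (length l) * 0 + 2 * 0"
      unfolding d_def by (intro tendsto_intros tail0)
    then have "\<forall>\<^sub>F k in sequentially. d k < r / 3" using r by (intro order_tendstoD) auto
    moreover have "(\<lambda>k. LINT x|\<nu>. fgauss (cut k l) x) \<longlonglongrightarrow> (LINT x|\<nu>. gexp l x)"
    proof (rule integral_dominated_convergence[where w = "\<lambda>_. 1"])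
      note borel_measurable_continuous_onI[OF continuous_on_gexp, measurable]
      show "gexp l \<in> borel_measurable \<nu>" by measurable
    qed (auto simp: fgauss_cut_tendsto fgauss_bounds)
    then have "\<forall>\<^sub>F k in sequentially. \<bar>(LINT x|\<nu>. fgauss (cut k l) x) - (LINT x|\<nu>. gexp l x)\<bar> < r / 3"
      using r unfolding tendsto_iff dist_real_def by (meson divide_pos_pos zero_less_numeral)
    ultimately obtain k where k: "d k < r / 3" "\<bar>(LINT x|\<nu>. fgauss (cut k l) x) - (LINT x|\<nu>. gexp l x)\<bar> < r / 3"
      using eventually_happens[OF eventually_conj] by (metis (no_types, lifting) sequentially_bot)
    have 1: "\<bar>(LINT w|M. gexp l (S n w)) - (LINT w|M. fgauss (cut k l) (S n w))\<bar> \<le> d k" if n: "n > 0" for n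
    proof -
      have "\<bar>(LINT w|M. gexp l (S n w) - fgauss (cut k l) (S n w))\<bar>
          \<le> (LINT w|M. 2 * real (length l) * tail k (S n w) + 2 * (\<Sum>a\<leftarrow>l. tail k a))"
        using tail_S(1)[OF n] ge_int gexp_fgauss_diff
        by (intro order.trans[OF integral_abs_bound] integral_mono) auto
      also have "... = d k" using tail_S[OF n] by (simp add: d_def prob_space)
      finally show ?thesis using ge_int by simp
    qed
    obtain N where N: "\<And>n. n \<ge> N \<Longrightarrow> \<bar>(LINT w|M. fgauss (cut k l) (S n w)) - (LINT x|\<nu>. fgauss (cut k l) x)\<bar> < r / 3"
      using LIMSEQ_D[OF fg[of "cut k l"], of "r / 3"] r by auto
    \<comment> \<open>The bound by \<open>d k\<close> holds for positive indices, hence the maximum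
      with 1 below.\<close>
    show "\<exists>N. \<forall>n\<ge>N. norm ((LINT w|M. gexp l (S n w)) - (LINT x|\<nu>. gexp l x)) < r"
    proof (intro exI[of _ "max N 1"] allI impI)
      fix n assume "n \<ge> max N 1"
      then show "norm ((LINT w|M. gexp l (S n w)) - (LINT x|\<nu>. gexp l x)) < r"
        using N[of n] 1[of n] k by (simp only: real_norm_def) linarith
    qed
  qed
  have "(\<lambda>n. LINT w|M. gexp l (Y n w)) \<longlonglongrightarrow> (LINT x|\<nu>. gexp l x)" for l
  proof -
    have "(\<lambda>n. (LINT w|M. gexp l (Y n w)) - (LINT w|M. gexp l (S n w))) \<longlonglongrightarrow> 0"
    proof (rule Lim_null_comparison)
      have "\<bar>(LINT w|M. gexp l (Y n w) - gexp l (S n w))\<bar> \<le> (LINT w|M. real (length l) * norm (Y n w - S n w))" for n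
        using ge_int diff_int gexp_Lipschitz
        by (intro order.trans[OF integral_abs_bound] integral_mono) auto
      then show "\<forall>\<^sub>F n in sequentially. norm ((LINT w|M. gexp l (Y n w)) - (LINT w|M. gexp l (S n w)))
          \<le> real (length l) * (LINT w|M. norm (Y n w - S n w))"
        using ge_int by simp
      show "(\<lambda>n. real (length l) * (LINT w|M. norm (Y n w - S n w))) \<longlonglongrightarrow> 0"
        using tendsto_mult_left[OF diff, of "real (length l)"] by simp
    qed
    from tendsto_add[OF this S_lim[of l]] show ?thesis by simp
  qed
  then interpret gaussian_tests M Y \<nu>
    using p\<nu> s\<nu> by unfold_locales auto
  show ?thesis by (rule converges_in_law)
qed

text \<open>The trace of \<open>Q\<close> is finite: expanded along the frame \<open>e\<close>, the
  squared norms of the columns \<open>a k\<close> add up to at most the sum of the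
  \<open>inner (Q (e j)) (e j)\<close>, whose partial sums are bounded by the mean of
  \<open>(norm (V 0 w))\<^sup>2\<close>.\<close>

lemma ex_gaussian:
  assumes Q: "psd_op Q" and QV: "\<And>h. inner (Q h) h = (LINT w|M. (inner h (V 0 w))\<^sup>2)"
  shows "\<exists>\<nu>. centered_gaussian_law \<nu> Q"
proof -
  have Q_le: "inner (Q h) h \<le> B\<^sup>2 * (norm h)\<^sup>2" for h
  proof -
    have "(inner h (V 0 w))\<^sup>2 \<le> B\<^sup>2 * (norm h)\<^sup>2" for w
      using power_mono[OF inner_bdd[of h 0 w] abs_ge_zero, where n = 2] by (simp add: power_mult_distrib mult.commute)
    then have "(LINT w|M. (inner h (V 0 w))\<^sup>2) \<le> (LINT w|M. B\<^sup>2 * (norm h)\<^sup>2)"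
      by (intro integral_mono) auto
    then show ?thesis by (simp add: QV prob_space)
  qed
  obtain a where a: "\<And>h. (\<lambda>k::nat. (inner (a k) h)\<^sup>2) sums inner (Q h) h"
    using ex_square_root_frame[OF Q Q_le] by blast
  obtain e :: "nat \<Rightarrow> 'a" where e: "\<And>h. (\<lambda>k. (inner (e k) h)\<^sup>2) sums (norm h)\<^sup>2"
    using ex_Parseval_frame[where 'a = 'a] by metis
  have fin: "(\<Sum>j<J. (inner (e j) x)\<^sup>2) \<le> (norm x)\<^sup>2" for J x
    using e[of x] by (metis finite_lessThan sum_le_suminf sums_iff zero_le_power2)
  have "(\<Sum>k<n. (norm (a k))\<^sup>2) \<le> B\<^sup>2" for n
  proof (rule LIMSEQ_le_const2)
    show "(\<lambda>J. \<Sum>k<n. \<Sum>j<J. (inner (e j) (a k))\<^sup>2) \<longlonglongrightarrow> (\<Sum>k<n. (norm (a k))\<^sup>2)"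
      using e unfolding sums_def by (intro tendsto_sum) auto
    have "(\<Sum>k<n. \<Sum>j<J. (inner (e j) (a k))\<^sup>2) \<le> B\<^sup>2" for J
    proof -
      have "(\<Sum>k<n. \<Sum>j<J. (inner (e j) (a k))\<^sup>2) = (\<Sum>j<J. \<Sum>k<n. (inner (a k) (e j))\<^sup>2)"
        by (subst sum.swap) (simp add: inner_commute)
      also have "... \<le> (\<Sum>j<J. inner (Q (e j)) (e j))"
        using a by (intro sum_mono) (metis finite_lessThan sum_le_suminf sums_iff zero_le_power2)
      also have "... = (LINT w|M. (\<Sum>j<J. (inner (e j) (V 0 w))\<^sup>2))" by (simp add: QV)
      also have "... \<le> (LINT w|M. B\<^sup>2)"
        by (intro integral_mono order.trans[OF fin] power_mono bdd) auto
      finally show ?thesis by (simp add: prob_space)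
    qed
    then show "\<exists>N. \<forall>J\<ge>N. (\<Sum>k<n. \<Sum>j<J. (inner (e j) (a k))\<^sup>2) \<le> B\<^sup>2" by blast
  qed
  then have "summable (\<lambda>k. (norm (a k))\<^sup>2)" by (intro summableI_nonneg_bounded) auto
  then show ?thesis using ex_centered_gaussian_law[OF _ Q a] by blast
qed

end

section \<open>The mean drift near the median\<close>

lemma inner_sgn_self: "inner (sgn c) c = norm (c::'a::real_inner)"
  by (cases "c = 0") (simp_all add: sgn_div_norm power2_norm_eq_inner[symmetric] power2_eq_square)

lemma inner_sgn_le: "inner (sgn c) d \<le> norm (d::'a::real_inner)"
proof -
  have "inner (sgn c) d \<le> norm (sgn c) * norm d" by (rule norm_cauchy_schwarz)
  also have "... \<le> norm d" by (simp add: norm_sgn)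
  finally show ?thesis .
qed

text \<open>Monotonicity of a subgradient of the norm.\<close>

lemma sgn_mono:
  fixes a b :: "'a::real_inner"
  shows "inner (sgn a - sgn b) (a - b) \<ge> 0"
  using inner_sgn_self[of a] inner_sgn_self[of b] inner_sgn_le[of a b] inner_sgn_le[of b a]
  by (simp add: inner_diff_left inner_diff_right)

text \<open>Minus \<open>sgn (x - u)\<close> is a subgradient at \<open>u\<close> of the distance to
  \<open>x\<close>.\<close>

lemma norm_subgradient:
  fixes x u m :: "'a::real_inner"
  shows "norm (x - u) + inner (sgn (x - u)) (u - m) \<le> norm (x - m)"
proof -
  have "norm (x - u) + inner (sgn (x - u)) (u - m) = inner (sgn (x - u)) (x - m)"
    unfolding inner_sgn_self[symmetric] by (simp add: inner_add_right[symmetric])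
  also have "... \<le> norm (x - m)" by (rule inner_sgn_le)
  finally show ?thesis .
qed

text \<open>Valid for \<open>h\<close> of any size, and only the distance to the base point enters:
  an inverse moment at \<open>m\<close> thus controls the sign taken at any other point.\<close>

lemma norm_sgn_diff_le:
  fixes y h :: "'a::real_normed_vector"
  assumes "y \<noteq> 0"
  shows "norm (sgn (y - h) - sgn y) \<le> 2 * norm h / norm y"
proof (cases "y = h")
  case True
  then show ?thesis using assms by (simp add: norm_sgn)
next
  case False
  let ?N = "norm (y - h)"
  have N: "?N > 0" and Y: "norm y > 0" using False assms by auto
  have "sgn (y - h) - sgn y = ((norm y - ?N) / (norm y * ?N)) *\<^sub>R (y - h) - (1 / norm y) *\<^sub>R h"
    using N Y by (simp add: sgn_div_norm scaleR_diff_right diff_divide_distrib scaleR_diff_left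
        inverse_eq_divide)
  also have "norm ... \<le> \<bar>norm y - ?N\<bar> / norm y + norm h / norm y"
    using N Y by (intro order.trans[OF norm_triangle_ineq4] add_mono) (auto simp: abs_divide abs_mult)
  also have "\<bar>norm y - ?N\<bar> \<le> norm h" using norm_triangle_ineq3[of y "y - h"] by simp
  finally show ?thesis using Y by (simp add: divide_right_mono)
qed

text \<open>For a unit vector \<open>y\<close>, \<open>t = inner y h\<close>,
  \<open>q = (norm h)\<^sup>2\<close> and \<open>N = norm (y - h)\<close> this is the expansion
  \<open>1 / N = 1 + t + O(q)\<close>, multiplied by \<open>N\<close>.\<close>

lemma norm_unit_diff_aux:
  fixes t q N :: real
  assumes N: "N \<ge> 0" "N\<^sup>2 = 1 - 2 * t + q" and t: "t\<^sup>2 \<le> q" and q: "q \<le> 1/4"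
  shows "\<bar>1 - N * (1 + t)\<bar> \<le> 2 * q"
proof -
  have q0: "q \<ge> 0" using t by (meson order_trans zero_le_power2)
  have "t\<^sup>2 \<le> (1/2)\<^sup>2" using t q by (simp add: power2_eq_square)
  then have t2: "\<bar>t\<bar> \<le> 1/2" unfolding abs_le_square_iff[symmetric] by simp
  have low: "1 - t \<le> N"
    by (rule power2_le_imp_le) (use assms in \<open>auto simp: power2_eq_square algebra_simps\<close>)
  have up: "N \<le> 1 - t + q"
  proof (rule power2_le_imp_le)
    have "1 - 2 * t + q \<le> (1 - t)\<^sup>2 + 2 * (1 - t) * q"
    proof -
      have "t * q \<le> 1/2 * q" using t2 q0 by (intro mult_right_mono) auto
      moreover have "(1 - t)\<^sup>2 + 2 * (1 - t) * q = 1 - 2 * t + t\<^sup>2 + 2 * q - 2 * (t * q)"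
        by (simp add: power2_eq_square algebra_simps)
      moreover have "t\<^sup>2 \<ge> 0" by simp
      ultimately show ?thesis by linarith
    qed
    also have "... \<le> (1 - t + q)\<^sup>2" by (simp add: power2_eq_square algebra_simps)
    finally show "N\<^sup>2 \<le> (1 - t + q)\<^sup>2" using assms by simp
    show "0 \<le> 1 - t + q" using t2 q0 by auto
  qed
  have "(1 - t) * (1 + t) \<le> N * (1 + t)" using low t2 by (intro mult_right_mono) auto
  moreover have "N * (1 + t) \<le> (1 - t + q) * (1 + t)" using up t2 by (intro mult_right_mono) auto
  moreover have "q * t \<le> q * (1/2)" using t2 q0 by (intro mult_left_mono) auto
  moreover have "(1 - t) * (1 + t) = 1 - t\<^sup>2" "(1 - t + q) * (1 + t) = 1 - t\<^sup>2 + q + q * t"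
    by (simp_all add: algebra_simps power2_eq_square)
  ultimately show ?thesis using t q0 zero_le_power2[of t] by linarith
qed

text \<open>Long \<open>h\<close> determine the constant: for \<open>norm h > 1/2\<close> the crude
  bound is \<open>2 + 2 * norm h\<close>, where 2 is at most \<open>8 * (norm h)\<^sup>2\<close> and
  \<open>2 * norm h\<close> at most \<open>4 * (norm h)\<^sup>2\<close>. For short \<open>h\<close>
  the expansion of \<open>norm (y - h)\<close> gives the factor 3.\<close>

lemma norm_sgn_taylor_unit:
  fixes y h :: "'a::real_inner"
  assumes y: "norm y = 1"
  shows "norm (sgn (y - h) - y + (h - inner y h *\<^sub>R y)) \<le> 12 * (norm h)\<^sup>2"
proof (cases "norm h \<le> 1/2")
  case False
  have "norm (h - inner y h *\<^sub>R y) \<le> norm h + \<bar>inner y h\<bar>"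
    using norm_triangle_ineq4[of h "inner y h *\<^sub>R y"] y by simp
  also have "\<bar>inner y h\<bar> \<le> norm h" using Cauchy_Schwarz_ineq2[of y h] y by simp
  finally have 1: "norm (h - inner y h *\<^sub>R y) \<le> 2 * norm h" by simp
  have "norm (sgn (y - h) - y) \<le> 1 + 1"
    by (intro order.trans[OF norm_triangle_ineq4] add_mono) (auto simp: norm_sgn y)
  with 1 have "norm (sgn (y - h) - y + (h - inner y h *\<^sub>R y)) \<le> 2 + 2 * norm h"
    using norm_triangle_ineq[of "sgn (y - h) - y" "h - inner y h *\<^sub>R y"] by linarith
  also have "... \<le> 12 * (norm h)\<^sup>2"
  proof -
    have "(norm h) * norm h \<ge> (1/2) * norm h" using False by (intro mult_right_mono) auto
    then show ?thesis using False unfolding power2_eq_square by linarith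
  qed
  finally show ?thesis .
next
  case True
  let ?N = "norm (y - h)" and ?t = "inner y h" and ?q = "(norm h)\<^sup>2"
  have N: "?N > 0" using y True by (auto simp: )
  have N2: "?N\<^sup>2 = 1 - 2 * ?t + ?q"
    using y by (simp add: power2_norm_eq_inner inner_diff_left inner_diff_right inner_commute
        norm_eq_1)
  have t: "?t\<^sup>2 \<le> ?q" using Cauchy_Schwarz_ineq[of y h] y by (simp add: power2_norm_eq_inner norm_eq_1)
  have q: "?q \<le> 1/4" using power_mono[OF True, of 2] by (simp add: power2_eq_square)
  have "sgn (y - h) - y + (h - ?t *\<^sub>R y) = ((1 - ?N * (1 + ?t)) / ?N) *\<^sub>R (y - h) - ?t *\<^sub>R h"
    using N by (simp add: sgn_div_norm scaleR_diff_right scaleR_add_left scaleR_diff_left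
        diff_divide_distrib inverse_eq_divide)
  also have "norm ... \<le> \<bar>1 - ?N * (1 + ?t)\<bar> + \<bar>?t\<bar> * norm h"
    using N by (intro order.trans[OF norm_triangle_ineq4] add_mono) auto
  also have "... \<le> 2 * ?q + norm h * norm h"
    using norm_unit_diff_aux[OF _ N2 t q] Cauchy_Schwarz_ineq2[of y h] y
    by (intro add_mono mult_right_mono) auto
  also have "... \<le> 12 * ?q" by (simp add: power2_eq_square)
  finally show ?thesis .
qed

text \<open>Invariance of the sign under positive scaling reduces this to a unit vector.\<close>

lemma norm_sgn_taylor:
  fixes y h :: "'a::real_inner"
  assumes y: "y \<noteq> 0"
  shows "norm (sgn (y - h) - sgn y + (1 / norm y) *\<^sub>R (h - (1 / (norm y)\<^sup>2) *\<^sub>R (y \<otimes>\<^sub>H y) h))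
    \<le> 12 * (norm h)\<^sup>2 / (norm y)\<^sup>2"
proof -
  let ?u = "sgn y" and ?k = "h /\<^sub>R norm y"
  have "sgn (?u - ?k) = sgn (y - h)"
    using y by (simp add: sgn_div_norm scaleR_diff_right[symmetric] del: scaleR_diff_right)
  moreover have "?k - inner ?u ?k *\<^sub>R ?u = (1 / norm y) *\<^sub>R (h - (1 / (norm y)\<^sup>2) *\<^sub>R (y \<otimes>\<^sub>H y) h)"
    using y by (simp add: sgn_div_norm tensor_def scaleR_diff_right power2_eq_square inverse_eq_divide)
  moreover have "norm (sgn (?u - ?k) - ?u + (?k - inner ?u ?k *\<^sub>R ?u)) \<le> 12 * (norm ?k)\<^sup>2"
    using y by (intro norm_sgn_taylor_unit) (simp add: norm_sgn)
  moreover have "12 * (norm ?k)\<^sup>2 = 12 * (norm h)\<^sup>2 / (norm y)\<^sup>2"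
    by (simp add: power_mult_distrib power_divide inverse_eq_divide)
  ultimately show ?thesis by simp
qed

text \<open>Lax-Milgram: a preimage of \<open>y\<close> is the fixed point of
  \<open>\<lambda>x. x - \<tau> *\<^sub>R (G x - y)\<close>.\<close>

lemma coercive_bij:
  fixes G :: "'a::{real_inner, banach} \<Rightarrow> 'a"
  assumes G: "bounded_linear G" and c: "c > 0" and co: "\<And>h. c * (norm h)\<^sup>2 \<le> inner (G h) h"
  shows "bij G" "bounded_linear (inv G)"
proof -
  interpret G: bounded_linear G by fact
  obtain K where K: "K > 0" "\<And>x. norm (G x) \<le> norm x * K" using G.pos_bounded by blast
  have below: "c * norm h \<le> norm (G h)" for h
  proof (cases "h = 0")
    case False
    have "c * norm h * norm h \<le> norm (G h) * norm h"
      using co[of h] norm_cauchy_schwarz[of "G h" h] by (simp add: power2_eq_square)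
    then show ?thesis using False by simp
  qed (simp add: G.zero)
  have inj: "inj G"
  proof (rule injI)
    fix x y assume "G x = G y"
    then have "c * norm (x - y) \<le> 0" using below[of "x - y"] by (simp add: G.diff)
    then show "x = y" using c by (simp add: mult_le_0_iff)
  qed
  have surj: "surj G"
    unfolding surj_def
  proof
    fix y
    \<comment> \<open>Then \<open>\<tau>\<^sup>2 * K\<^sup>2 + \<tau>\<^sup>2 * c\<^sup>2 = \<tau> *
      c\<close>, so the factor \<open>q\<close> for squared distances is below
      \<open>1 - \<tau> * c\<close>.\<close>
    define \<tau> where "\<tau> = c / (K\<^sup>2 + c\<^sup>2)"
    have Kc: "K\<^sup>2 + c\<^sup>2 > 0" using K c by (simp add: add_pos_pos)
    have \<tau>: "\<tau> > 0" using c Kc by (simp add: \<tau>_def)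
    define q where "q = 1 - 2 * \<tau> * c + \<tau>\<^sup>2 * K\<^sup>2"
    have q_lt: "q < 1"
    proof -
      have "\<tau> * (K\<^sup>2 + c\<^sup>2) = c" using Kc by (simp add: \<tau>_def)
      then have "\<tau>\<^sup>2 * K\<^sup>2 + \<tau>\<^sup>2 * c\<^sup>2 = \<tau> * c" by (metis (no_types) distrib_left mult.assoc power2_eq_square)
      moreover have "\<tau>\<^sup>2 * c\<^sup>2 \<ge> 0" "\<tau> * c > 0" using \<tau> c by auto
      ultimately show ?thesis unfolding q_def by linarith
    qed
    have contr: "(norm ((x - \<tau> *\<^sub>R (G x - y)) - (x' - \<tau> *\<^sub>R (G x' - y))))\<^sup>2 \<le> q * (norm (x - x'))\<^sup>2" for x x'
    proof -
      let ?d = "x - x'"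
      have e: "(x - \<tau> *\<^sub>R (G x - y)) - (x' - \<tau> *\<^sub>R (G x' - y)) = ?d - \<tau> *\<^sub>R G ?d"
        by (simp add: G.diff algebra_simps)
      have "(norm (?d - \<tau> *\<^sub>R G ?d))\<^sup>2 = (norm ?d)\<^sup>2 - 2 * \<tau> * inner (G ?d) ?d + \<tau>\<^sup>2 * (norm (G ?d))\<^sup>2"
        unfolding power2_norm_eq_inner
        by (simp add: inner_diff_left inner_diff_right inner_commute power2_eq_square algebra_simps)
      also have "... \<le> (norm ?d)\<^sup>2 - 2 * \<tau> * (c * (norm ?d)\<^sup>2) + \<tau>\<^sup>2 * (norm ?d * K)\<^sup>2"
        using \<tau> co[of ?d] K(2)[of ?d]
        by (intro add_mono diff_mono mult_left_mono power_mono) auto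
      also have "... = q * (norm ?d)\<^sup>2" by (simp add: q_def algebra_simps power_mult_distrib)
      finally show ?thesis unfolding e .
    qed
    have "\<exists>!x. x - \<tau> *\<^sub>R (G x - y) = x"
    \<comment> \<open>Only in the zero space can \<open>q\<close> be negative; the maximum under the
      root covers that.\<close>
    proof (rule banach_fix_type[where c = "sqrt (max q 0)"])
      show "0 \<le> sqrt (max q 0)" "sqrt (max q 0) < 1" using q_lt by auto
      show "\<forall>x x'. dist (x - \<tau> *\<^sub>R (G x - y)) (x' - \<tau> *\<^sub>R (G x' - y)) \<le> sqrt (max q 0) * dist x x'"
      proof (intro allI)
        fix x x' :: 'a
        have "q * (norm (x - x'))\<^sup>2 \<le> max q 0 * (norm (x - x'))\<^sup>2" by (intro mult_right_mono) auto
        also have "... = (sqrt (max q 0) * norm (x - x'))\<^sup>2" by (simp only: power_mult_distrib) simp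
        finally have "(norm ((x - \<tau> *\<^sub>R (G x - y)) - (x' - \<tau> *\<^sub>R (G x' - y))))\<^sup>2
            \<le> (sqrt (max q 0) * norm (x - x'))\<^sup>2"
          using contr[of x x'] by (rule order.trans[rotated])
        then show "dist (x - \<tau> *\<^sub>R (G x - y)) (x' - \<tau> *\<^sub>R (G x' - y)) \<le> sqrt (max q 0) * dist x x'"
          unfolding dist_norm by (rule power2_le_imp_le) simp
      qed
    qed
    then obtain x where "x - \<tau> *\<^sub>R (G x - y) = x" by blast
    then have "G x = y" using \<tau> by simp
    then show "\<exists>x. y = G x" by blast
  qed
  show bij: "bij G" using inj surj by (rule bijI)
  show "bounded_linear (inv G)"
  proof (rule bounded_linear_intro[where K = "1 / c"])
    have GI: "G (inv G x) = x" for x using surj by (rule surj_f_inv_f)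
    show "inv G (x + y) = inv G x + inv G y" for x y
      using inj by (intro inv_f_eq) (simp_all add: G.add GI)
    show "inv G (r *\<^sub>R x) = r *\<^sub>R inv G x" for r x
      using inj by (intro inv_f_eq) (simp_all add: G.scaleR GI)
    show "norm (inv G x) \<le> norm x * (1 / c)" for x
      using below[of "inv G x"] c by (simp add: GI field_simps)
  qed
qed

lemma borel_measurable_sgn_vec [measurable]:
  "sgn \<in> borel_measurable (borel :: 'a::{real_normed_vector, second_countable_topology} measure)"
  unfolding sgn_div_norm[abs_def] by measurable

section \<open>The averaged sign field and its derivative at the median\<close>

locale inverse_moments = prob_space M for M :: "'w measure" +
  fixes X :: "'w \<Rightarrow> 'a::{real_inner, banach, second_countable_topology}" and m :: 'a
  assumes X_measurable [measurable]: "X \<in> borel_measurable M"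
    and X_ne: "AE w in M. X w \<noteq> m"
    and integrable_inverse_square: "integrable M (\<lambda>w. 1 / (norm (X w - m))\<^sup>2)"
begin

abbreviation "\<Gamma> \<equiv> Gamma_op M X m"

text \<open>Minus a subgradient at \<open>z\<close> of the objective that the geometric median
  minimises.\<close>

definition drift :: "'a \<Rightarrow> 'a" where "drift z = (LINT w|M. sgn (X w - z))"

text \<open>For \<open>X w \<noteq> m\<close> the Hessian at \<open>m\<close> of the distance to
  \<open>X w\<close>.\<close>

definition hess :: "'w \<Rightarrow> 'a \<Rightarrow> 'a" where
  "hess w h = (1 / norm (X w - m)) *\<^sub>R
     (h - (1 / (norm (X w - m))\<^sup>2) *\<^sub>R ((X w - m) \<otimes>\<^sub>H (X w - m)) h)"

definition "inv_sq = (LINT w|M. 1 / (norm (X w - m))\<^sup>2)"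

lemma inv_sq_nonneg: "inv_sq \<ge> 0"
  unfolding inv_sq_def by (intro integral_nonneg_AE) simp

lemma integrable_inverse: "integrable M (\<lambda>w. 1 / norm (X w - m))"
  by (rule square_integrable_imp_integrable)
    (use integrable_inverse_square in \<open>simp_all add: power_divide\<close>)

lemma integrable_sgn [simp]: "integrable M (\<lambda>w. sgn (X w - z))"
  by (rule integrable_const_bound[where B = 1]) (auto simp: norm_sgn)

lemma hess_eq: "hess w h = (1 / norm (X w - m)) *\<^sub>R (h - inner (sgn (X w - m)) h *\<^sub>R sgn (X w - m))"
  by (simp add: hess_def tensor_def sgn_div_norm inverse_eq_divide power2_eq_square)

lemma inner_hess_self:
  "inner (hess w h) h = (1 / norm (X w - m)) * ((norm h)\<^sup>2 - (inner (sgn (X w - m)) h)\<^sup>2)"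
  unfolding hess_eq power2_norm_eq_inner by (simp add: inner_diff_left power2_eq_square)

lemma norm_hess_le: "norm (hess w h) \<le> 2 * norm h * (1 / norm (X w - m))"
proof -
  let ?u = "sgn (X w - m)"
  have u: "norm ?u \<le> 1" by (simp add: norm_sgn)
  have "norm (inner ?u h *\<^sub>R ?u) \<le> norm h * 1"
    using Cauchy_Schwarz_ineq2[of ?u h] u mult_right_mono[OF u, of "norm h"]
    by (simp del: mult_1_right) (intro mult_mono, auto)
  then have "norm (h - inner ?u h *\<^sub>R ?u) \<le> 2 * norm h"
    using norm_triangle_ineq4[of h "inner ?u h *\<^sub>R ?u"] by linarith
  then show ?thesis unfolding hess_eq by (simp add: divide_right_mono)
qed

lemma hess_measurable [measurable]: "(\<lambda>w. hess w h) \<in> borel_measurable M"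
  unfolding hess_eq by measurable

lemma integrable_hess [simp]: "integrable M (\<lambda>w. hess w h)"
  by (rule Bochner_Integration.integrable_bound[OF integrable_mult_right[OF integrable_inverse, of "2 * norm h"]])
    (use norm_hess_le in auto)

lemma Gamma_eq: "\<Gamma> h = (LINT w|M. hess w h)"
  by (simp add: Gamma_op_def operator_expectation_def hess_def)

lemma bounded_linear_Gamma: "bounded_linear (\<Gamma>)"
proof (rule bounded_linear_intro[where K = "2 * (LINT w|M. 1 / norm (X w - m))"])
  have "hess w (h + k) = hess w h + hess w k" for w h k
    by (simp add: hess_eq inner_add_right algebra_simps add_divide_distrib)
  then show "\<Gamma> (h + k) = \<Gamma> h + \<Gamma> k" for h k
    by (simp add: Gamma_eq)
  have "hess w (r *\<^sub>R h) = r *\<^sub>R hess w h" for w r h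
    by (simp add: hess_eq algebra_simps)
  then show "\<Gamma> (r *\<^sub>R h) = r *\<^sub>R \<Gamma> h" for r h
    by (simp add: Gamma_eq)
  show "norm (\<Gamma> h) \<le> norm h * (2 * (LINT w|M. 1 / norm (X w - m)))" for h
  proof -
    have "norm (\<Gamma> h) \<le> (LINT w|M. 2 * norm h * (1 / norm (X w - m)))"
      unfolding Gamma_eq
      by (intro order.trans[OF integral_norm_bound] integral_mono integrable_mult_right integrable_inverse
          integrable_norm integrable_hess norm_hess_le)
    also have "... = norm h * (2 * (LINT w|M. 1 / norm (X w - m)))"
      by (subst integral_mult_right_zero) simp
    finally show ?thesis .
  qed
qed

lemma Gamma_sym: "inner (\<Gamma> h) k = inner h (\<Gamma> k)"
proof -
  have "inner (hess w h) k = inner h (hess w k)" for w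
    by (simp add: hess_eq inner_diff_left inner_diff_right inner_commute)
  then have "(LINT w|M. inner (hess w h) k) = (LINT w|M. inner h (hess w k))" by simp
  then show ?thesis by (simp add: Gamma_eq)
qed

lemma drift_taylor: "norm (drift (m + h) - drift m + \<Gamma> h) \<le> 12 * inv_sq * (norm h)\<^sup>2"
proof -
  have "norm (drift (m + h) - drift m + \<Gamma> h)
      = norm (LINT w|M. sgn (X w - (m + h)) - sgn (X w - m) + hess w h)"
    by (simp add: drift_def Gamma_eq)
  also have "... \<le> (LINT w|M. norm (sgn (X w - (m + h)) - sgn (X w - m) + hess w h))"
    by (rule integral_norm_bound)
  also have "... \<le> (LINT w|M. 12 * (norm h)\<^sup>2 * (1 / (norm (X w - m))\<^sup>2))"
  proof (rule integral_mono_AE)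
    show "AE w in M. norm (sgn (X w - (m + h)) - sgn (X w - m) + hess w h)
        \<le> 12 * (norm h)\<^sup>2 * (1 / (norm (X w - m))\<^sup>2)"
      using X_ne
    proof eventually_elim
      case (elim w)
      then show ?case using norm_sgn_taylor[of "X w - m" h] by (simp add: hess_def diff_diff_eq)
    qed
  qed (intro integrable_mult_right integrable_inverse_square integrable_norm
      Bochner_Integration.integrable_add Bochner_Integration.integrable_diff integrable_sgn integrable_hess)+
  also have "... = 12 * inv_sq * (norm h)\<^sup>2"
    by (subst integral_mult_right_zero) (simp add: inv_sq_def)
  finally show ?thesis .
qed

text \<open>Source of the decay of the \<open>D n\<close>: the sign seen from \<open>z\<close>
  differs from the one seen from \<open>m\<close> by \<open>O(norm (z - m))\<close> in mean
  square.\<close>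

lemma mean_square_sgn_diff:
  "(LINT w|M. (norm (sgn (X w - z) - sgn (X w - m)))\<^sup>2) \<le> 4 * inv_sq * (norm (z - m))\<^sup>2"
proof -
  have "(LINT w|M. (norm (sgn (X w - z) - sgn (X w - m)))\<^sup>2)
      \<le> (LINT w|M. 4 * (norm (z - m))\<^sup>2 * (1 / (norm (X w - m))\<^sup>2))"
  proof (rule integral_mono_AE)
    show "AE w in M. (norm (sgn (X w - z) - sgn (X w - m)))\<^sup>2
        \<le> 4 * (norm (z - m))\<^sup>2 * (1 / (norm (X w - m))\<^sup>2)"
      using X_ne
    proof eventually_elim
      case (elim w)
      then have "norm (sgn (X w - z) - sgn (X w - m)) \<le> 2 * norm (z - m) / norm (X w - m)"
        using norm_sgn_diff_le[of "X w - m" "z - m"] by simp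
      then have "(norm (sgn (X w - z) - sgn (X w - m)))\<^sup>2 \<le> (2 * norm (z - m) / norm (X w - m))\<^sup>2"
        by (rule power_mono) simp
      then show ?case by (simp add: power_divide power_mult_distrib)
    qed
    show "integrable M (\<lambda>w. (norm (sgn (X w - z) - sgn (X w - m)))\<^sup>2)"
    proof (rule integrable_const_bound[where B = 4])
      have "norm (sgn (X w - z) - sgn (X w - m)) \<le> 2" for w
        by (rule order.trans[OF norm_triangle_ineq4]) (auto simp: norm_sgn)
      then have "(norm (sgn (X w - z) - sgn (X w - m)))\<^sup>2 \<le> 2\<^sup>2" for w
        by (intro power_mono) auto
      then show "AE w in M. norm ((norm (sgn (X w - z) - sgn (X w - m)))\<^sup>2) \<le> 4" by simp
    qed measurable
  qed (intro integrable_mult_right integrable_inverse_square)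
  also have "... = 4 * inv_sq * (norm (z - m))\<^sup>2"
    by (subst integral_mult_right_zero) (simp add: inv_sq_def)
  finally show ?thesis .
qed

lemma drift_antimono: "inner (drift z - drift z') (z - z') \<le> 0"
proof -
  have "inner (drift z - drift z') (z - z') = (LINT w|M. inner (sgn (X w - z) - sgn (X w - z')) (z - z'))"
    by (simp add: drift_def del: inner_diff_right)
  also have "... \<le> (LINT w|M. 0)"
  proof (rule integral_mono)
    fix w
    show "inner (sgn (X w - z) - sgn (X w - z')) (z - z') \<le> 0"
      using sgn_mono[of "X w - z" "X w - z'"] by (simp add: inner_diff_left inner_diff_right)
  qed (auto intro!: integrable_inner_left Bochner_Integration.integrable_diff)
  finally show ?thesis by simp
qed

text \<open>The objective is never differentiated. Convexity and minimality give
  \<open>inner (drift (m + h)) h \<le> 0\<close>; inserting \<open>h = t *\<^sub>R drift m\<close>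
  and the Taylor bound leaves \<open>(norm (drift m))\<^sup>2 \<le> t * C\<close> for
  \<open>0 < t \<le> 1\<close>.\<close>

lemma drift_median:
  assumes "is_geometric_median M X m"
  shows "drift m = 0"
proof -
  have int: "integrable M (\<lambda>w. norm (X w - u) - norm (X w))" for u
  proof (rule integrable_const_bound[where B = "norm u"])
    show "AE w in M. norm (norm (X w - u) - norm (X w)) \<le> norm u"
    proof (rule AE_I2)
      fix w
      show "norm (norm (X w - u) - norm (X w)) \<le> norm u"
        using norm_triangle_ineq3[of "X w - u" "X w"] by simp
    qed
  qed measurable
  have 1: "inner (drift (m + h)) h \<le> 0" for h
  proof -
    let ?G = "\<lambda>u. LINT w|M. (norm (X w - u) - norm (X w))"
    have "?G m \<le> ?G (m + h)"
      using assms by (auto simp: is_geometric_median_def is_arg_min_def not_less)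
    moreover have "?G (m + h) + inner (drift (m + h)) h \<le> ?G m"
    proof -
      have "?G (m + h) + inner (drift (m + h)) h
          = (LINT w|M. (norm (X w - (m + h)) - norm (X w)) + inner (sgn (X w - (m + h))) h)"
        by (simp add: drift_def int)
      also have "... \<le> ?G m"
      proof (rule integral_mono)
        fix w
        show "(norm (X w - (m + h)) - norm (X w)) + inner (sgn (X w - (m + h))) h \<le> norm (X w - m) - norm (X w)"
          using norm_subgradient[of "X w" "m + h" m] by simp
      qed (auto intro!: int integrable_inner_left Bochner_Integration.integrable_add)
      finally show ?thesis .
    qed
    ultimately show ?thesis by linarith
  qed
  obtain L where L: "L > 0" "\<And>h. norm (\<Gamma> h) \<le> norm h * L"
    using bounded_linear.pos_bounded[OF bounded_linear_Gamma] by blast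
  let ?d = "drift m"
  have 2: "t * (norm ?d)\<^sup>2 \<le> t\<^sup>2 * C" if t: "0 < t" "t \<le> 1" and C: "C = (L + 12 * inv_sq * norm ?d) * (norm ?d)\<^sup>2" for t C
  proof -
    let ?h = "t *\<^sub>R ?d"
    let ?r = "drift (m + ?h) - ?d + \<Gamma> ?h"
    have "inner ?d ?h = inner (drift (m + ?h)) ?h + inner (\<Gamma> ?h) ?h - inner ?r ?h"
      by (simp add: inner_diff_left inner_add_left algebra_simps)
    also have "... \<le> 0 + norm (\<Gamma> ?h) * norm ?h + norm ?r * norm ?h"
      using 1[of ?h] norm_cauchy_schwarz[of "\<Gamma> ?h" ?h] Cauchy_Schwarz_ineq2[of ?r ?h]
      by linarith
    also have "... \<le> 0 + (norm ?h * L) * norm ?h + (12 * inv_sq * (norm ?h)\<^sup>2) * norm ?h"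
      using drift_taylor[of ?h] L(2)[of ?h] by (intro add_mono mult_right_mono) auto
    also have "... = t\<^sup>2 * ((L + 12 * inv_sq * (t * norm ?d)) * (norm ?d)\<^sup>2)"
      using t by (simp add: power2_eq_square algebra_simps)
    also have "... \<le> t\<^sup>2 * C"
      unfolding C using t inv_sq_nonneg
      by (intro mult_left_mono mult_right_mono add_mono order.refl mult_left_le_one_le) auto
    finally show ?thesis by (simp add: power2_norm_eq_inner)
  qed
  define C where "C = (L + 12 * inv_sq * norm ?d) * (norm ?d)\<^sup>2"
  have 3: "(norm ?d)\<^sup>2 \<le> t * C" if t: "0 < t" "t \<le> 1" for t
    using 2[OF t C_def] t by (simp add: power2_eq_square mult.assoc)
  have "((\<lambda>t. t * C) \<longlongrightarrow> 0 * C) (at_right 0)" by (intro tendsto_intros)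
  then have "(norm ?d)\<^sup>2 \<le> 0 * C"
    by (rule tendsto_lowerbound) (use 3 in \<open>auto simp: eventually_at_right_field intro!: exI[of _ 1]\<close>)
  then show ?thesis by simp
qed

text \<open>Otherwise the form tends to 0 along unit vectors \<open>k n\<close>. These need not
  converge, but along a subsequence almost every direction \<open>u w\<close> becomes parallel to
  \<open>k (r n)\<close>; hence almost all directions are parallel to one another and
  \<open>X\<close> stays on a line through \<open>m\<close>.\<close>

lemma Gamma_coercive:
  assumes "not_on_straight_line M X"
  shows "\<exists>c>0. \<forall>h. c * (norm h)\<^sup>2 \<le> inner (\<Gamma> h) h"
proof (rule ccontr)
  assume neg: "\<not> ?thesis"
  have form: "inner (\<Gamma> h) h = (LINT w|M. inner (hess w h) h)" for h
    by (simp add: Gamma_eq)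
  have hess_nonneg: "inner (hess w h) h \<ge> 0" for w h
  proof -
    have "(inner (sgn (X w - m)) h)\<^sup>2 \<le> (norm h)\<^sup>2"
    proof (rule power2_le_iff_abs_le[THEN iffD2])
      have "\<bar>inner (sgn (X w - m)) h\<bar> \<le> norm (sgn (X w - m)) * norm h"
        by (rule Cauchy_Schwarz_ineq2)
      also have "... \<le> norm h" by (simp add: norm_sgn)
      finally show "\<bar>inner (sgn (X w - m)) h\<bar> \<le> norm h" .
    qed simp
    then show ?thesis unfolding inner_hess_self by simp
  qed
  have "\<exists>k. norm k = 1 \<and> inner (\<Gamma> k) k \<le> 1 / real (Suc n)" for n
  proof -
    obtain h where h: "inner (\<Gamma> h) h < 1 / real (Suc n) * (norm h)\<^sup>2"
      using neg by (meson not_le of_nat_0_less_iff zero_less_Suc zero_less_divide_1_iff)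
    interpret G: bounded_linear "\<Gamma>" by (rule bounded_linear_Gamma)
    have h0: "h \<noteq> 0" using h by (auto simp: G.zero)
    have "inner (\<Gamma> (h /\<^sub>R norm h)) (h /\<^sub>R norm h) = inner (\<Gamma> h) h / (norm h)\<^sup>2"
      by (simp add: G.scaleR power2_eq_square divide_inverse)
    also have "... \<le> 1 / real (Suc n)" using h h0 by (simp add: divide_le_eq del: of_nat_Suc)
    finally show ?thesis using h0 by (intro exI[of _ "h /\<^sub>R norm h"]) simp
  qed
  then obtain k where k: "\<And>n. norm (k n) = 1" "\<And>n. inner (\<Gamma> (k n)) (k n) \<le> 1 / real (Suc n)"
    by metis
  have "(\<lambda>n. LINT w|M. norm (inner (hess w (k n)) (k n))) \<longlonglongrightarrow> 0"
  proof (rule tendsto_sandwich[OF _ _ tendsto_const LIMSEQ_inverse_real_of_nat])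
    show "\<forall>\<^sub>F n in sequentially. (LINT w|M. norm (inner (hess w (k n)) (k n))) \<le> inverse (real (Suc n))"
      using k(2) hess_nonneg unfolding form by (simp add: inverse_eq_divide)
  qed (simp add: integral_nonneg_AE)
  \<comment> \<open>Convergence to 0 in mean gives almost sure convergence along a
    subsequence.\<close>
  then obtain r where r: "strict_mono r"
      "AE w in M. (\<lambda>n. inner (hess w (k (r n))) (k (r n))) \<longlonglongrightarrow> 0"
    using tendsto_L1_AE_subseq[of M "\<lambda>n w. inner (hess w (k n)) (k n)"] by auto
  define u where "u w = sgn (X w - m)" for w
  define good where "good w \<longleftrightarrow> X w \<noteq> m \<and> (\<lambda>n. (inner (u w) (k (r n)))\<^sup>2) \<longlonglongrightarrow> 1" for w
  have good: "AE w in M. good w"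
    using r(2) X_ne
  proof eventually_elim
    case (elim w)
    then have "(\<lambda>n. 1 - norm (X w - m) * inner (hess w (k (r n))) (k (r n))) \<longlonglongrightarrow> 1 - norm (X w - m) * 0"
      by (intro tendsto_intros)
    moreover have "1 - norm (X w - m) * inner (hess w (k (r n))) (k (r n)) = (inner (u w) (k (r n)))\<^sup>2" for n
      using elim unfolding inner_hess_self by (simp add: k(1) u_def)
    ultimately show ?case using elim by (simp add: good_def)
  qed
  \<comment> \<open>One typical sample point fixes the line; (A1) then supplies \<open>p\<close>
    orthogonal to its direction.\<close>
  then obtain w\<^sub>0 where w\<^sub>0: "good w\<^sub>0"
    by (metis (mono_tags, lifting) AE_False eventually_mono)
  obtain p where p: "inner (u w\<^sub>0) p = 0" "extended_variance M (\<lambda>w. inner p (X w)) > 0"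
    using assms unfolding not_on_straight_line_def by blast
  have "inner p (X w) = inner p m" if g: "good w" for w
  proof -
    have unit: "norm (u w') = 1" if "good w'" for w' using that by (simp add: good_def u_def norm_sgn)
    \<comment> \<open>The component of \<open>u w'\<close> orthogonal to
      \<open>k (r n)\<close>.\<close>
    define d where "d w' n = u w' - inner (u w') (k (r n)) *\<^sub>R k (r n)" for w' n
    have d: "d w' \<longlonglongrightarrow> 0" if g: "good w'" for w'
    proof -
      have e: "(norm (d w' n))\<^sup>2 = 1 - (inner (u w') (k (r n)))\<^sup>2" for n
      proof -
        have "inner (k (r n)) (k (r n)) = 1" "inner (u w') (u w') = 1"
          using k(1)[of "r n"] unit[OF g] by (simp_all add: norm_eq_1)
        then show ?thesis unfolding d_def power2_norm_eq_inner
          by (simp add: inner_diff_left inner_diff_right power2_eq_square inner_commute)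
      qed
      have "(\<lambda>n. sqrt ((norm (d w' n))\<^sup>2)) \<longlonglongrightarrow> sqrt (1 - 1)"
        unfolding e using g by (intro tendsto_intros) (simp add: good_def)
      then show ?thesis by (simp add: tendsto_norm_zero_iff)
    qed
    \<comment> \<open>The two terms containing \<open>inner (k (r n)) p\<close> cancel; as
      \<open>p\<close> is orthogonal to \<open>u w\<^sub>0\<close>, only the product with
      \<open>inner (u w) p\<close> remains.\<close>
    have "(\<lambda>n. inner (u w\<^sub>0) (k (r n)) * inner (d w n) p - inner (u w) (k (r n)) * inner (d w\<^sub>0 n) p) \<longlonglongrightarrow> 0"
    proof -
      have b: "(\<lambda>n. inner (u w') (k (r n)) * inner (d w'' n) p) \<longlonglongrightarrow> 0" if "good w''" "good w'" for w' w''
      proof (rule Lim_null_comparison)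
        show "(\<lambda>n. \<bar>inner (d w'' n) p\<bar>) \<longlonglongrightarrow> 0"
          using tendsto_inner[OF d[OF that(1)] tendsto_const[of p]] by (simp add: tendsto_rabs_zero_iff)
        have "\<bar>inner (u w') (k (r n))\<bar> \<le> 1" for n
          using Cauchy_Schwarz_ineq2[of "u w'" "k (r n)"] unit[OF that(2)] k(1) by simp
        then show "\<forall>\<^sub>F n in sequentially. norm (inner (u w') (k (r n)) * inner (d w'' n) p) \<le> \<bar>inner (d w'' n) p\<bar>"
          by (intro always_eventually allI) (simp add: abs_mult mult_left_le_one_le)
      qed
      show ?thesis using tendsto_diff[OF b[OF g w\<^sub>0] b[OF w\<^sub>0 g]] by simp
    qed
    moreover have "inner (u w\<^sub>0) (k (r n)) * inner (d w n) p - inner (u w) (k (r n)) * inner (d w\<^sub>0 n) p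
        = inner (u w\<^sub>0) (k (r n)) * inner (u w) p" for n
      unfolding d_def by (simp add: inner_diff_left p(1) algebra_simps)
    ultimately have "(\<lambda>n. inner (u w\<^sub>0) (k (r n)) * inner (u w) p) \<longlonglongrightarrow> 0" by simp
    from tendsto_power[OF this, of 2]
    have "(\<lambda>n. (inner (u w\<^sub>0) (k (r n)))\<^sup>2 * (inner (u w) p)\<^sup>2) \<longlonglongrightarrow> 0" by (simp add: power_mult_distrib)
    moreover have "(\<lambda>n. (inner (u w\<^sub>0) (k (r n)))\<^sup>2 * (inner (u w) p)\<^sup>2) \<longlonglongrightarrow> 1 * (inner (u w) p)\<^sup>2"
      using w\<^sub>0 by (intro tendsto_intros) (simp add: good_def)
    ultimately have "1 * (inner (u w) p)\<^sup>2 = 0" by (rule LIMSEQ_unique[rotated])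
    then have "inner (X w - m) p = 0" using g by (simp add: u_def good_def sgn_div_norm)
    then show ?thesis by (simp add: inner_diff_left inner_commute[of p])
  qed
  with good have const: "AE w in M. inner p (X w) = inner p m" by (auto elim: eventually_mono)
  have int: "integrable M (\<lambda>w. inner p (X w))"
    using const by (subst integrable_cong_AE[where g = "\<lambda>_. inner p m"]) auto
  have mean: "(LINT w|M. inner p (X w)) = inner p m"
    using const by (subst integral_cong_AE[where g = "\<lambda>_. inner p m"]) (auto simp: prob_space)
  have "(\<integral>\<^sup>+w. ennreal ((inner p (X w) - inner p m)\<^sup>2) \<partial>M) = (\<integral>\<^sup>+w. 0 \<partial>M)"
    using const by (intro nn_integral_cong_AE) (auto elim!: eventually_mono)
  then show False using p(2) int mean by (simp add: extended_variance_def)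
qed

text \<open>Within radius \<open>\<rho>\<close> coercivity beats the Taylor remainder. Along a ray
  from \<open>m\<close> the outward component of the drift cannot increase, so its negative value at
  radius \<open>\<rho>\<close> persists further out and the bound becomes linear.\<close>

lemma drift_inward:
  assumes "is_geometric_median M X m" "not_on_straight_line M X"
  shows "\<exists>c>0. \<forall>h. inner (drift (m + h)) h \<le> - c * min ((norm h)\<^sup>2) (norm h)"
proof -
  obtain c where c: "c > 0" "\<And>h. c * (norm h)\<^sup>2 \<le> inner (\<Gamma> h) h"
    using Gamma_coercive[OF assms(2)] by blast
  have d0: "drift m = 0" by (rule drift_median[OF assms(1)])
  define K where "K = 12 * inv_sq + 1"
  have K: "K > 0" using inv_sq_nonneg by (simp add: K_def)
  \<comment> \<open>Up to this radius the remainder, cubic in \<open>norm h\<close>, takes at most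
    half of \<open>c * (norm h)\<^sup>2\<close>; the 1 in \<open>K\<close> keeps the divisor
    positive.\<close>
  define \<rho> where "\<rho> = c / (2 * K)"
  have \<rho>: "\<rho> > 0" using c K by (simp add: \<rho>_def)
  have near: "inner (drift (m + h)) h \<le> - (c / 2) * (norm h)\<^sup>2" if h: "norm h \<le> \<rho>" for h
  proof -
    let ?r = "drift (m + h) - drift m + \<Gamma> h"
    have "inner (drift (m + h)) h = inner ?r h - inner (\<Gamma> h) h"
      by (simp add: d0 inner_add_left)
    also have "... \<le> norm ?r * norm h - c * (norm h)\<^sup>2"
      using c(2)[of h] norm_cauchy_schwarz[of ?r h] by linarith
    also have "norm ?r * norm h \<le> (K * (norm h)\<^sup>2) * \<rho>"
    proof (rule mult_mono)
      show "norm ?r \<le> K * (norm h)\<^sup>2"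
        using drift_taylor[of h] by (rule order.trans) (simp add: K_def mult_right_mono)
    qed (use h K in auto)
    also have "... = c / 2 * (norm h)\<^sup>2" using K by (simp add: \<rho>_def)
    finally show ?thesis by simp
  qed
  define c' where "c' = (c / 2) * min 1 \<rho>"
  have "inner (drift (m + h)) h \<le> - c' * min ((norm h)\<^sup>2) (norm h)" for h
  proof (cases "norm h \<le> \<rho>")
    case True
    have "c' * min ((norm h)\<^sup>2) (norm h) \<le> (c / 2) * (norm h)\<^sup>2"
      unfolding c'_def using c by (intro mult_mono) (auto intro: order.trans[OF min.cobounded1])
    then show ?thesis using near[OF True] by simp
  next
    case False
    let ?n = "norm h" and ?t = "\<rho> / norm h"
    have n: "?n > 0" using False \<rho> by linarith
    have t: "0 < ?t" "?t < 1" using False \<rho> n by auto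
    have "inner (drift (m + h) - drift (m + ?t *\<^sub>R h)) ((1 - ?t) *\<^sub>R h) \<le> 0"
      using drift_antimono[of "m + h" "m + ?t *\<^sub>R h"] by (simp add: algebra_simps)
    then have "inner (drift (m + h)) h \<le> inner (drift (m + ?t *\<^sub>R h)) h"
      using t by (simp add: mult_le_0_iff inner_diff_left)
    also have "... = inner (drift (m + ?t *\<^sub>R h)) (?t *\<^sub>R h) / ?t" using \<rho> n by simp
    also have "... \<le> (- (c / 2) * (norm (?t *\<^sub>R h))\<^sup>2) / ?t"
      using t n \<rho> by (intro divide_right_mono near) auto
    also have "... = - ((c / 2) * \<rho> * ?n)" using n \<rho> by (simp add: power2_eq_square)
    finally have "inner (drift (m + h)) h \<le> - ((c / 2) * \<rho> * ?n)" .
    moreover have "c' * min (?n\<^sup>2) ?n \<le> (c / 2) * \<rho> * ?n"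
      unfolding c'_def using c \<rho> n by (intro mult_mono) auto
    ultimately show ?thesis by simp
  qed
  moreover have "c' > 0" using c \<rho> by (simp add: c'_def)
  ultimately show ?thesis by blast
qed

end

section \<open>Decay of the Lyapunov function\<close>

lemma powr_Suc_diff_le:
  fixes \<alpha> :: real
  assumes "0 < \<alpha>" "\<alpha> < 1" "n \<ge> 1"
  shows "real n powr (- \<alpha>) - real (Suc n) powr (- \<alpha>) \<le> real n powr (- \<alpha>) / n"
proof -
  have "real n / real (Suc n) = (real n / real (Suc n)) powr 1" using assms by simp
  also have "... \<le> (real n / real (Suc n)) powr \<alpha>"
    using assms by (intro powr_mono') auto
  also have "... = real (Suc n) powr (- \<alpha>) / real n powr (- \<alpha>)"
    using assms by (simp add: powr_divide powr_minus inverse_eq_divide)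
  finally have "real n powr (- \<alpha>) * (real n / real (Suc n)) \<le> real (Suc n) powr (- \<alpha>)"
    using assms by (simp add: pos_le_divide_eq mult.commute)
  moreover have "real n powr (- \<alpha>) * (real n / real (Suc n)) = real n powr (- \<alpha>) - real n powr (- \<alpha>) / real (Suc n)"
    using assms by (simp add: field_simps)
  moreover have "real n powr (- \<alpha>) / real (Suc n) \<le> real n powr (- \<alpha>) / n"
    using assms by (intro divide_left_mono) auto
  ultimately show ?thesis by linarith
qed

text \<open>Comparison with the integral, by the mean value theorem on each unit interval.\<close>

lemma sum_powr_le:
  fixes \<alpha> :: real
  assumes "0 < \<alpha>" "\<alpha> < 1"
  shows "(\<Sum>n=1..N. real n powr (- \<alpha>)) \<le> real N powr (1 - \<alpha>) / (1 - \<alpha>)"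
proof (induction N)
  case (Suc N)
  have "(1 - \<alpha>) * real (Suc N) powr (- \<alpha>) \<le> real (Suc N) powr (1 - \<alpha>) - real N powr (1 - \<alpha>)"
  proof (cases "N = 0")
    case True
    then show ?thesis using assms by simp
  next
    case False
    then obtain z where z: "real N < z" "z < real (Suc N)"
      "real (Suc N) powr (1 - \<alpha>) - real N powr (1 - \<alpha>) = (real (Suc N) - real N) * ((1 - \<alpha>) * z powr (1 - \<alpha> - 1))"
      using MVT2[of "real N" "real (Suc N)" "\<lambda>x. x powr (1 - \<alpha>)" "\<lambda>x. (1 - \<alpha>) * x powr (1 - \<alpha> - 1)"]
        has_real_derivative_powr[of _ "1 - \<alpha>"] by force
    have "real (Suc N) powr (- \<alpha>) \<le> z powr (- \<alpha>)"
      using z assms False by (intro powr_mono2') auto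
    then show ?thesis using z(3) assms by (simp add: mult_left_mono)
  qed
  then have "real (Suc N) powr (- \<alpha>) \<le> (real (Suc N) powr (1 - \<alpha>) - real N powr (1 - \<alpha>)) / (1 - \<alpha>)"
    using assms by (simp add: pos_le_divide_eq mult.commute)
  then show ?case using Suc by (simp add: diff_divide_distrib)
qed simp

text \<open>The claim \<open>y n \<le> C * \<gamma> n\<close> reproduces itself:
  \<open>\<gamma>\<close> loses at most the fraction \<open>1 / n\<close> in one step, which for
  \<open>\<alpha> < 1\<close> is eventually below \<open>a / 4 * \<gamma> n\<close>, so the
  contraction outruns the decay of the bound.\<close>

lemma stochastic_recursion_rate:
  fixes y :: "nat \<Rightarrow> real"
  assumes \<alpha>: "0 < \<alpha>" "\<alpha> < 1" and c: "c > 0" and \<gamma>: "\<And>n. n \<ge> 1 \<Longrightarrow> \<gamma> n = c * real n powr (- \<alpha>)"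
    and a: "a > 0" and b: "b \<ge> 0" and y: "\<And>n. y n \<ge> 0"
    and rec: "\<And>n. n \<ge> 1 \<Longrightarrow> \<gamma> n \<le> 1/2 \<Longrightarrow> y (Suc n) \<le> (1 - a * \<gamma> n + b * (\<gamma> n)\<^sup>2) * y n + d * (\<gamma> n)\<^sup>2"
  shows "\<exists>C. \<forall>n\<ge>1. y n \<le> C * real n powr (- \<alpha>)"
proof -
  have \<gamma>_pos: "\<gamma> n > 0" if "n \<ge> 1" for n using that c by (simp add: \<gamma>)
  have lim: "(\<lambda>n. real n powr (- \<alpha>)) \<longlonglongrightarrow> 0"
    using \<alpha> by real_asymp
  have lim2: "(\<lambda>n. c * real n powr (- \<alpha>)) \<longlonglongrightarrow> 0" using tendsto_mult_left[OF lim, of c] by simp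
  have lim3: "filterlim (\<lambda>n. real n powr (1 - \<alpha>)) at_top sequentially"
    using \<alpha> by real_asymp
  \<comment> \<open>In this order the thresholds make the recursion applicable, limit the cost of
    \<open>b * (\<gamma> n)\<^sup>2\<close> to half of the contraction, and keep
    \<open>1 - a / 2 * \<gamma> n\<close> nonnegative.\<close>
  have "\<forall>\<^sub>F n in sequentially. c * real n powr (- \<alpha>) < min (1/2) (min (a / (2 * (b + 1))) (2 / a))"
    using a b by (intro order_tendstoD[OF lim2]) auto
  \<comment> \<open>A rewriting of \<open>1 / n \<le> a / 4 * \<gamma> n\<close>.\<close>
  moreover have "\<forall>\<^sub>F n in sequentially. real n powr (1 - \<alpha>) \<ge> 4 / (a * c)"
    using lim3 by (simp add: filterlim_at_top)
  ultimately have "\<forall>\<^sub>F n in sequentially. n \<ge> 1 \<and> c * real n powr (- \<alpha>) < min (1/2) (min (a / (2 * (b + 1))) (2 / a))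
      \<and> real n powr (1 - \<alpha>) \<ge> 4 / (a * c)"
    using eventually_ge_at_top[of 1] by eventually_elim auto
  then obtain N where N: "\<And>n. n \<ge> N \<Longrightarrow> n \<ge> 1 \<and> c * real n powr (- \<alpha>) < min (1/2) (min (a / (2 * (b + 1))) (2 / a))
      \<and> real n powr (1 - \<alpha>) \<ge> 4 / (a * c)"
    unfolding eventually_sequentially by blast
  define d' where "d' = \<bar>d\<bar>"
  \<comment> \<open>The first entry starts the induction at \<open>N\<close>; the second lets the
    share \<open>a / 4\<close> of the contraction absorb the noise.\<close>
  define C where "C = max (y N / \<gamma> N) (4 * d' / a)"
  have N1: "N \<ge> 1" using N[of N] by simp
  have C0: "C \<ge> 0" unfolding C_def using a by (simp add: d'_def le_max_iff_disj)
  have large: "y n \<le> C * \<gamma> n" if "n \<ge> N" for n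
    using that
  proof (induction rule: dec_induct)
    case base
    have "y N / \<gamma> N \<le> C" by (simp add: C_def)
    then show ?case using \<gamma>_pos[OF N1] by (simp add: pos_divide_le_eq)
  next
    case (step n)
    define g where "g = \<gamma> n"
    have n1: "n \<ge> 1" and g: "g > 0" "g < 1/2" "g < a / (2 * (b + 1))" "g < 2 / a"
      and pw: "real n powr (1 - \<alpha>) \<ge> 4 / (a * c)"
      using N[of n] step \<gamma>_pos[of n] by (auto simp: g_def \<gamma>)
    have "y (Suc n) \<le> (1 - a * g + b * g\<^sup>2) * y n + d * g\<^sup>2"
      using rec[of n] n1 g by (simp add: g_def)
    also have "... \<le> (1 - a / 2 * g) * y n + d' * g\<^sup>2"
    proof (intro add_mono mult_right_mono)
      have "(b + 1) * g \<le> a / 2" using g(3) b by (simp add: field_simps)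
      then have "b * g \<le> a / 2" using g(1) by (simp add: algebra_simps)
      then have "b * g * g \<le> a / 2 * g" using g(1) by (intro mult_right_mono) auto
      then show "1 - a * g + b * g\<^sup>2 \<le> 1 - a / 2 * g" by (simp add: power2_eq_square mult.assoc)
    qed (use y in \<open>auto simp: d'_def\<close>)
    also have "... \<le> (1 - a / 2 * g) * (C * g) + d' * g\<^sup>2"
    proof -
      have "a * g \<le> 2" using g(4) a by (simp add: field_simps)
      then show ?thesis using step.IH by (intro add_mono mult_left_mono) (auto simp: g_def d'_def)
    qed
    also have "... = C * g - (C * (a / 2) - d') * g\<^sup>2" by (simp add: power2_eq_square algebra_simps)
    also have "... \<le> C * g - C * (a / 4) * g\<^sup>2"
    proof -
      have "4 * d' / a \<le> C" by (simp add: C_def)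
      then have "d' \<le> C * (a / 4)" using a by (simp add: field_simps)
      then have "(C * (a / 4)) * g\<^sup>2 \<le> (C * (a / 2) - d') * g\<^sup>2" by (intro mult_right_mono) (auto simp: field_simps)
      then show ?thesis by simp
    qed
    also have "... \<le> C * \<gamma> (Suc n)"
    proof -
      have "1 / n \<le> a / 4 * g"
      proof -
        have "real n powr (1 - \<alpha>) = n * real n powr (- \<alpha>)"
          using n1 by (simp add: powr_diff powr_minus divide_inverse)
        then have "4 / (a * c) \<le> n * real n powr (- \<alpha>)" using pw by simp
        then have "1 \<le> n * (a / 4 * g)"
          using a c n1 by (simp add: g_def \<gamma> field_simps)
        then show ?thesis using n1 by (simp add: field_simps)
      qed
      then have "g * (1 / n) \<le> g * (a / 4 * g)" using g by (intro mult_left_mono) auto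
      then have "g / n \<le> a / 4 * g\<^sup>2" by (simp add: power2_eq_square mult_ac)
      moreover have "g - \<gamma> (Suc n) \<le> g / n"
        using mult_left_mono[OF powr_Suc_diff_le[OF \<alpha> n1], of c] c n1
        by (simp add: g_def \<gamma> right_diff_distrib)
      ultimately have "g - \<gamma> (Suc n) \<le> a / 4 * g\<^sup>2" by linarith
      then have "C * (g - \<gamma> (Suc n)) \<le> C * (a / 4 * g\<^sup>2)" using C0 by (rule mult_left_mono)
      then show ?thesis by (simp add: right_diff_distrib mult.assoc)
    qed
    finally show ?case .
  qed
  \<comment> \<open>The finitely many indices before \<open>N\<close> go into the constant.\<close>
  define C' where "C' = max C (Max ((\<lambda>n. y n / \<gamma> n) ` {1..N}))"
  have "y n \<le> (C' * c) * real n powr (- \<alpha>)" if n: "n \<ge> 1" for n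
  proof -
    have "y n \<le> C' * \<gamma> n"
    proof (cases "n \<ge> N")
      case True
      have "C * \<gamma> n \<le> C' * \<gamma> n" using \<gamma>_pos[OF n] by (intro mult_right_mono) (auto simp: C'_def)
      then show ?thesis using large[OF True] by linarith
    next
      case False
      have "y n / \<gamma> n \<le> Max ((\<lambda>n. y n / \<gamma> n) ` {1..N})" using False n by (intro Max_ge) auto
      then have "y n / \<gamma> n \<le> C'" by (simp add: C'_def)
      then show ?thesis using \<gamma>_pos[OF n] by (simp add: pos_divide_le_eq)
    qed
    then show ?thesis using n by (simp add: \<gamma> mult.assoc)
  qed
  then show ?thesis by blast
qed

text \<open>For a negative argument \<open>- y\<close> the product of
  \<open>1 - y + y\<^sup>2\<close> with the lower Taylor bound of \<open>exp y\<close> is at least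
  1.\<close>

lemma exp_le_quadratic:
  fixes x :: real
  assumes "\<bar>x\<bar> \<le> 1"
  shows "exp x \<le> 1 + x + x\<^sup>2"
proof (cases "x \<ge> 0")
  case True
  then show ?thesis using exp_bound[of x] assms by simp
next
  case False
  define y where "y = - x"
  have y: "y > 0" using False by (simp add: y_def)
  have "(1 - y + y\<^sup>2) * (1 + y + y\<^sup>2 / 2) = 1 + (y\<^sup>2 + y ^ 3 + y ^ 4) / 2"
    by (simp add: power2_eq_square power3_eq_cube power4_eq_xxxx field_simps)
  then have "1 \<le> (1 - y + y\<^sup>2) * (1 + y + y\<^sup>2 / 2)" using y by simp
  also have "... \<le> (1 - y + y\<^sup>2) * exp y"
  proof (rule mult_left_mono)
    show "1 + y + y\<^sup>2 / 2 \<le> exp y" using exp_lower_Taylor_quadratic[of y] y by simp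
    have "0 \<le> (1 - y)\<^sup>2 + y" using y by simp
    also have "... \<le> 1 - y + y\<^sup>2" by (simp add: power2_eq_square algebra_simps)
    finally show "0 \<le> 1 - y + y\<^sup>2" .
  qed
  finally have "exp (- y) * 1 \<le> exp (- y) * ((1 - y + y\<^sup>2) * exp y)" by (intro mult_left_mono) auto
  moreover have "exp (- y) * ((1 - y + y\<^sup>2) * exp y) = 1 - y + y\<^sup>2"
  proof -
    have "exp (- y) * ((1 - y + y\<^sup>2) * exp y) = (1 - y + y\<^sup>2) * (exp y * exp (- y))" by (simp only: mult_ac)
    then show ?thesis by (simp only: exp_minus_inverse mult_1_right)
  qed
  ultimately have "exp (- y) \<le> 1 - y + y\<^sup>2" by (simp only: mult_1_right)
  then show ?thesis by (simp add: y_def)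
qed

text \<open>The square root is smooth at 0 and grows like the norm; subtracting \<open>exp 1\<close>
  makes the function vanish at 0, where it is then comparable with
  \<open>(norm x)\<^sup>2\<close>.\<close>

definition lyap :: "'a::real_inner \<Rightarrow> real" where
  "lyap x = exp (sqrt (1 + (norm x)\<^sup>2)) - exp 1"

lemma norm_sq_le_lyap: "(norm x)\<^sup>2 \<le> lyap x"
proof -
  define s where "s = sqrt (1 + (norm x)\<^sup>2)"
  have s: "s \<ge> 1" "s\<^sup>2 = 1 + (norm x)\<^sup>2" by (simp_all add: s_def)
  have "2 * ((s - 1) + (s - 1)\<^sup>2 / 2) = s\<^sup>2 - 1" by (simp add: power2_eq_square field_simps)
  then have "(norm x)\<^sup>2 = 2 * ((s - 1) + (s - 1)\<^sup>2 / 2)" using s(2) by simp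
  also have "... \<le> 2 * (exp (s - 1) - 1)" using exp_lower_Taylor_quadratic[of "s - 1"] s(1) by simp
  also have "... \<le> exp 1 * (exp (s - 1) - 1)"
    using exp_ge_add_one_self[of "1::real"] s(1) by (intro mult_right_mono) auto
  also have "... = lyap x" by (simp add: lyap_def s_def[symmetric] right_diff_distrib exp_add[symmetric])
  finally show ?thesis .
qed

lemma lyap_nonneg: "lyap x \<ge> 0"
  using norm_sq_le_lyap[of x] by (meson order_trans zero_le_power2)

text \<open>The exponential growth compensates the merely linear pull of the drift at infinity.\<close>

lemma lyap_le_drift:
  "lyap x / 4 \<le> exp (sqrt (1 + (norm x)\<^sup>2)) * (min ((norm x)\<^sup>2) (norm x) / sqrt (1 + (norm x)\<^sup>2))"
proof -
  define s where "s = sqrt (1 + (norm x)\<^sup>2)"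
  define r where "r = norm x"
  have r: "r \<ge> 0" and s: "s \<ge> 1" "s\<^sup>2 = 1 + r\<^sup>2" by (simp_all add: s_def r_def)
  have "(exp s - exp 1) / 4 \<le> exp s * (min (r\<^sup>2) r / s)"
  proof (cases "r \<ge> 1")
    case True
    have "s \<le> 2 * r" 
    proof (rule power2_le_imp_le)
      have "1 \<le> r\<^sup>2" using True by simp
      then show "s\<^sup>2 \<le> (2 * r)\<^sup>2" using s(2) by (simp add: power_mult_distrib)
    qed (use r in simp)
    then have "1 / 4 \<le> r / s" using s(1) r by (simp add: field_simps)
    moreover have "min (r\<^sup>2) r = r" using True by (simp add: power2_eq_square min_def)
    ultimately have "exp s * (1 / 4) \<le> exp s * (min (r\<^sup>2) r / s)" by (intro mult_left_mono) auto
    moreover have "(exp s - exp 1) / 4 \<le> exp s * (1 / 4)" by simp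
    ultimately show ?thesis by (rule order.trans[rotated])
  next
    case False
    have s2: "s \<le> 2"
    proof (rule power2_le_imp_le)
      have "r\<^sup>2 \<le> 1" using False r by (simp add: power_le_one)
      then show "s\<^sup>2 \<le> 2\<^sup>2" using s(2) by simp
    qed simp
    have m: "min (r\<^sup>2) r = r\<^sup>2" using False r by (simp add: power2_eq_square min_def mult_left_le)
    have "2 * (s - 1) \<le> s\<^sup>2 - 1" using zero_le_power2[of "s - 1"] by (simp add: power2_eq_square algebra_simps)
    then have a1: "s - 1 \<le> r\<^sup>2 / 2" using s(2) by simp
    have "1 - exp (- (s - 1)) \<le> s - 1" using exp_ge_add_one_self[of "- (s - 1)"] by linarith
    then have "exp s * (1 - exp (- (s - 1))) \<le> exp s * (r\<^sup>2 / 2)" using a1 by (intro mult_left_mono) auto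
    then have "exp s - exp 1 \<le> exp s * (r\<^sup>2 / 2)" by (simp add: right_diff_distrib exp_add[symmetric])
    then have "(exp s - exp 1) / 4 \<le> exp s * (r\<^sup>2 / 2) / 4" by (rule divide_right_mono) simp
    also have "exp s * (r\<^sup>2 / 2) / 4 \<le> exp s * (r\<^sup>2 / s)"
    proof -
      have "r\<^sup>2 / 8 \<le> r\<^sup>2 / s" using s2 s(1) by (intro divide_left_mono) auto
      then have "r\<^sup>2 / 2 / 4 \<le> r\<^sup>2 / s" by simp
      then have "exp s * (r\<^sup>2 / 2 / 4) \<le> exp s * (r\<^sup>2 / s)" by (intro mult_left_mono) auto
      then show ?thesis by simp
    qed
    finally show ?thesis unfolding m .
  qed
  then show ?thesis by (simp add: lyap_def s_def r_def)
qed

text \<open>The root grows by at most \<open>t\<close>, and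
  \<open>exp t \<le> 1 + t + t\<^sup>2\<close>. The 3 covers \<open>1/2\<close> from the quadratic
  part of \<open>t\<close> and 2 from \<open>t\<^sup>2\<close>.\<close>

lemma lyap_step:
  fixes x u :: "'a::real_inner"
  assumes u: "norm u \<le> 1" and g: "0 \<le> g" "g \<le> 1/2"
  shows "lyap (x + g *\<^sub>R u) \<le> lyap x + exp (sqrt (1 + (norm x)\<^sup>2)) * (g * inner x u / sqrt (1 + (norm x)\<^sup>2) + 3 * g\<^sup>2)"
proof -
  define s where "s = sqrt (1 + (norm x)\<^sup>2)"
  have s: "s \<ge> 1" "s\<^sup>2 = 1 + (norm x)\<^sup>2" by (simp_all add: s_def)
  have xs: "norm x \<le> s" unfolding s_def by (rule real_le_rsqrt) simp
  \<comment> \<open>The first-order increment of the root, with \<open>(norm u)\<^sup>2\<close>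
    replaced by its bound 1.\<close>
  define t where "t = (g * inner x u + g\<^sup>2 / 2) / s"
  have u2: "(norm u)\<^sup>2 \<le> 1" using u by (simp add: power_le_one)
  have xu: "\<bar>inner x u\<bar> \<le> s"
  proof -
    have "\<bar>inner x u\<bar> \<le> norm x * norm u" by (rule Cauchy_Schwarz_ineq2)
    also have "... \<le> s * 1" using xs u s by (intro mult_mono) auto
    finally show ?thesis by simp
  qed
  have t_abs: "\<bar>t\<bar> \<le> g + g\<^sup>2 / 2"
  proof -
    have "\<bar>g * inner x u + g\<^sup>2 / 2\<bar> \<le> g * s + g\<^sup>2 / 2 * s"
    proof -
      have "\<bar>g * inner x u\<bar> \<le> g * s" using xu g by (simp add: abs_mult mult_left_mono)
      moreover have "g\<^sup>2 / 2 \<le> g\<^sup>2 / 2 * s" using s(1) mult_left_mono[of 1 s "g\<^sup>2 / 2"] by simp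
      moreover have "g\<^sup>2 / 2 \<ge> 0" by simp
      ultimately show ?thesis by linarith
    qed
    then have "\<bar>g * inner x u + g\<^sup>2 / 2\<bar> / s \<le> (g * s + g\<^sup>2 / 2 * s) / s" using s(1) by (intro divide_right_mono) auto
    also have "... = g + g\<^sup>2 / 2" using s(1) by (simp add: add_divide_distrib)
    finally show ?thesis using s(1) by (simp add: t_def)
  qed
  have g2: "g\<^sup>2 \<le> g / 2" using g mult_left_mono[of g "1/2" g] by (simp add: power2_eq_square)
  have t1: "\<bar>t\<bar> \<le> 1" using t_abs g2 g by linarith
  have t2: "t\<^sup>2 \<le> 2 * g\<^sup>2"
  proof -
    have "\<bar>t\<bar> \<le> 5 / 4 * g" using t_abs g2 by linarith
    then have "\<bar>t\<bar>\<^sup>2 \<le> (5 / 4 * g)\<^sup>2" by (intro power_mono) auto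
    then have "t\<^sup>2 \<le> 25 / 16 * g\<^sup>2" by (simp add: power_mult_distrib power_divide)
    moreover have "25 / 16 * g\<^sup>2 \<le> 2 * g\<^sup>2" by (intro mult_right_mono) auto
    ultimately show ?thesis by linarith
  qed
  have "sqrt (1 + (norm (x + g *\<^sub>R u))\<^sup>2) \<le> s + t"
  proof (rule real_le_lsqrt)
    have "(norm (x + g *\<^sub>R u))\<^sup>2 = (norm x)\<^sup>2 + 2 * g * inner x u + g\<^sup>2 * (norm u)\<^sup>2"
      unfolding power2_norm_eq_inner by (simp add: inner_add_left inner_add_right inner_commute power2_eq_square algebra_simps)
    also have "... \<le> (norm x)\<^sup>2 + 2 * g * inner x u + g\<^sup>2"
      using u2 mult_left_mono[of "(norm u)\<^sup>2" 1 "g\<^sup>2"] by simp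
    also have "... = (norm x)\<^sup>2 + 2 * s * t" using s(1) by (simp add: t_def field_simps)
    finally have "1 + (norm (x + g *\<^sub>R u))\<^sup>2 \<le> s\<^sup>2 + 2 * s * t" using s(2) by simp
    also have "... \<le> (s + t)\<^sup>2" by (simp add: power2_eq_square algebra_simps)
    finally show "1 + (norm (x + g *\<^sub>R u))\<^sup>2 \<le> (s + t)\<^sup>2" .
    show "0 \<le> s + t" using s(1) t1 by linarith
  qed
  then have "exp (sqrt (1 + (norm (x + g *\<^sub>R u))\<^sup>2)) \<le> exp s * exp t" by (simp add: exp_add[symmetric])
  also have "... \<le> exp s * (1 + (g * inner x u / s + 3 * g\<^sup>2))"
  proof (rule mult_left_mono)
    have "exp t \<le> 1 + t + t\<^sup>2" by (rule exp_le_quadratic[OF t1])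
    also have "... \<le> 1 + (g * inner x u / s + g\<^sup>2 / 2) + 2 * g\<^sup>2"
    proof -
      have "g\<^sup>2 / 2 / s \<le> g\<^sup>2 / 2 / 1" using s(1) by (intro divide_left_mono) auto
      then show ?thesis using t2 unfolding t_def add_divide_distrib by simp
    qed
    also have "... \<le> 1 + (g * inner x u / s + 3 * g\<^sup>2)" by simp
    finally show "exp t \<le> 1 + (g * inner x u / s + 3 * g\<^sup>2)" .
  qed simp
  finally show ?thesis by (simp add: lyap_def s_def[symmetric] distrib_left)
qed

section \<open>The averaged algorithm\<close>

locale sgd = inverse_moments M X m for M :: "'w measure"
    and X :: "'w \<Rightarrow> 'a::{real_inner, banach, second_countable_topology}" and m :: 'a +
  fixes Xs :: "nat \<Rightarrow> 'w \<Rightarrow> 'a" and Z\<^sub>0 :: "'w \<Rightarrow> 'a" and \<gamma> :: "nat \<Rightarrow> real" and c \<alpha> :: real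
  assumes median: "is_geometric_median M X m"
    and line: "not_on_straight_line M X"
    and input: "algorithm_input M X Xs Z\<^sub>0"
    and c: "c > 0" and \<alpha>: "1/2 < \<alpha>" "\<alpha> < 1"
    and \<gamma>0: "\<gamma> 0 > 0" and \<gamma>: "\<And>n. n \<ge> 1 \<Longrightarrow> \<gamma> n = c * real n powr (- \<alpha>)"
begin

text \<open>Starting point and samples as one independent family.\<close>

definition W :: "nat \<Rightarrow> 'w \<Rightarrow> 'a" where "W n = (if n = 0 then Z\<^sub>0 else Xs n)"

abbreviation "Z \<equiv> median_sgd \<gamma> Xs Z\<^sub>0"

definition T :: "nat \<Rightarrow> 'w \<Rightarrow> 'a" where "T n w = Z n w - m"

definition past :: "nat \<Rightarrow> 'w \<Rightarrow> nat \<Rightarrow> 'a" where "past n w = restrict (\<lambda>i. W i w) {..n}"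

text \<open>Here the sequence of inputs \<open>Z\<^sub>0, X\<^sub>1, X\<^sub>2, \<dots>\<close> is itself the sample point.\<close>

definition zf :: "nat \<Rightarrow> (nat \<Rightarrow> 'a) \<Rightarrow> 'a" where
  "zf n p = median_sgd \<gamma> (\<lambda>i p. p i) (\<lambda>p. p 0) n p"

lemma \<gamma>_pos: "\<gamma> n > 0"
  using \<gamma>0 \<gamma>[of n] c by (cases "n = 0") auto

lemma indep_W: "indep_vars (\<lambda>_. borel) W UNIV"
  using input by (simp add: algorithm_input_def W_def[abs_def])

lemma W_measurable [measurable]: "W n \<in> borel_measurable M"
  using indep_W by (simp add: indep_vars_def)

lemma Xs_measurable [measurable]: "Xs (Suc n) \<in> borel_measurable M"
  using W_measurable[of "Suc n"] by (simp add: W_def)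

lemma Xs_integral:
  fixes f :: "'a \<Rightarrow> 'b::{banach, second_countable_topology}"
  assumes "f \<in> borel_measurable borel"
  shows "(\<integral>x. f x \<partial>distr M borel (Xs (Suc n))) = (LINT w|M. f (X w))"
proof -
  have "distr M borel (Xs (Suc n)) = distr M borel X" using input by (simp add: algorithm_input_def)
  then show ?thesis using assms by (simp add: integral_distr)
qed

lemma Z_Suc: "Z (Suc n) w = Z n w + \<gamma> n *\<^sub>R sgn (Xs (Suc n) w - Z n w)"
  by (simp add: sgn_div_norm Let_def)

lemma T_Suc: "T (Suc n) w = T n w + \<gamma> n *\<^sub>R sgn (Xs (Suc n) w - Z n w)"
  unfolding T_def Z_Suc by simp

lemma zf_Suc: "zf (Suc n) p = zf n p + \<gamma> n *\<^sub>R sgn (p (Suc n) - zf n p)"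
  by (simp add: zf_def sgn_div_norm Let_def)

lemma zf_measurable: "k \<le> n \<Longrightarrow> zf k \<in> borel_measurable (PiM {..n} (\<lambda>_. borel))"
proof (induction k)
  case 0
  then show ?case by (simp add: zf_def[abs_def])
next
  case (Suc k)
  then have [measurable]: "zf k \<in> borel_measurable (PiM {..n} (\<lambda>_. borel))" by simp
  have [measurable]: "(\<lambda>p. p (Suc k)) \<in> borel_measurable (PiM {..n} (\<lambda>_. borel :: 'a measure))"
    using Suc.prems by (intro measurable_component_singleton) simp
  show ?case unfolding zf_Suc[abs_def] by measurable
qed

text \<open>Iterate \<open>k\<close> can be read from every longer past, so quantities of different
  times become functions of a single block.\<close>

lemma Z_eq_zf: "k \<le> n \<Longrightarrow> Z k w = zf k (past n w)"
proof (induction k)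
  case 0
  then show ?case by (simp add: zf_def past_def W_def)
next
  case (Suc k)
  have "past n w (Suc k) = Xs (Suc k) w" using Suc.prems by (simp add: past_def W_def)
  then show ?case unfolding Z_Suc zf_Suc using Suc by simp
qed

lemma Z_measurable [measurable]: "Z n \<in> borel_measurable M"
proof (induction n)
  case 0
  then show ?case using W_measurable[of 0] by (simp add: W_def[abs_def])
next
  case (Suc n)
  note Suc [measurable]
  show ?case unfolding Z_Suc[abs_def] by measurable
qed

lemma T_measurable [measurable]: "T n \<in> borel_measurable M"
  unfolding T_def by measurable

lemma drift_measurable [measurable]: "drift \<in> borel_measurable borel"
  unfolding drift_def by measurable

lemma norm_drift_le: "norm (drift z) \<le> 1"
proof -
  have "norm (drift z) \<le> (LINT w|M. 1)"
    unfolding drift_def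
    by (intro order.trans[OF integral_norm_bound] integral_mono integrable_norm) (auto simp: norm_sgn)
  then show ?thesis by (simp add: prob_space)
qed

lemma norm_sgn_le_1: "norm (sgn (x :: 'a)) \<le> 1"
  by (simp add: norm_sgn)

text \<open>The bound grows with \<open>n\<close>. It serves only to make all integrals exist, the
  exponential ones included.\<close>

lemma T_bounded: "\<exists>B\<ge>0. \<forall>w\<in>space M. norm (T n w) \<le> B"
proof (induction n)
  case 0
  obtain B where B: "\<And>w. w \<in> space M \<Longrightarrow> norm (Z\<^sub>0 w) \<le> B"
    using input by (auto simp: algorithm_input_def bounded_iff)
  have "norm (T 0 w) \<le> \<bar>B\<bar> + norm m" if "w \<in> space M" for w
    using B[OF that] norm_triangle_ineq4[of "Z\<^sub>0 w" m] by (simp add: T_def)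
  then show ?case by (intro exI[of _ "\<bar>B\<bar> + norm m"]) auto
next
  case (Suc n)
  then obtain B where B: "B \<ge> 0" "\<And>w. w \<in> space M \<Longrightarrow> norm (T n w) \<le> B" by blast
  have "norm (T (Suc n) w) \<le> B + \<gamma> n" if "w \<in> space M" for w
  proof -
    have "norm (T (Suc n) w) \<le> norm (T n w) + \<gamma> n * norm (sgn (Xs (Suc n) w - Z n w))"
      unfolding T_Suc using \<gamma>_pos[of n] norm_triangle_ineq[of "T n w" "\<gamma> n *\<^sub>R sgn (Xs (Suc n) w - Z n w)"] by simp
    also have "... \<le> B + \<gamma> n * 1"
      using B(2)[OF that] \<gamma>_pos[of n] norm_sgn_le_1 by (intro add_mono mult_left_mono) auto
    finally show ?thesis by simp
  qed
  then show ?case using B(1) \<gamma>_pos[of n] by (intro exI[of _ "B + \<gamma> n"]) auto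
qed

text \<open>The inner integral is the conditional expectation given the past: the new sample is
  independent of it and distributed like \<open>X\<close>.\<close>

lemma step_integral:
  fixes g :: "(nat \<Rightarrow> 'a) \<Rightarrow> 'a \<Rightarrow> real"
  assumes g [measurable]: "case_prod g \<in> borel_measurable (PiM {..n} (\<lambda>_. borel) \<Otimes>\<^sub>M borel)"
    and int: "integrable M (\<lambda>w. g (past n w) (Xs (Suc n) w))"
  shows "(LINT w|M. g (past n w) (Xs (Suc n) w)) = (LINT w|M. (LINT w'|M. g (past n w) (X w')))"
proof -
  have "(LINT w|M. g (past n w) (Xs (Suc n) w)) = (\<integral>w. (\<integral>y. g (past n w) y \<partial>distr M borel (Xs (Suc n))) \<partial>M)"
    using integral_past_next[OF indep_W, of "Suc n" "{..n}" g] int by (simp add: past_def W_def)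
  also have "... = (LINT w|M. (LINT w'|M. g (past n w) (X w')))"
  proof (rule Bochner_Integration.integral_cong[OF refl])
    fix w
    have "past n w \<in> space (PiM {..n} (\<lambda>_. borel))" by (simp add: past_def space_PiM)
    then have "g (past n w) \<in> borel_measurable borel" using g by measurable
    then show "(\<integral>y. g (past n w) y \<partial>distr M borel (Xs (Suc n))) = (LINT w'|M. g (past n w) (X w'))"
      by (rule Xs_integral)
  qed
  finally show ?thesis .
qed

lemma integrable_T_compose:
  fixes f :: "'a \<Rightarrow> real"
  assumes [measurable]: "f \<in> borel_measurable borel" and b: "\<And>B. B \<ge> 0 \<Longrightarrow> \<exists>C. \<forall>x. norm x \<le> B \<longrightarrow> \<bar>f x\<bar> \<le> C"
  shows "integrable M (\<lambda>w. f (T n w))"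
proof -
  obtain B where B: "B \<ge> 0" "\<And>w. w \<in> space M \<Longrightarrow> norm (T n w) \<le> B" using T_bounded by blast
  obtain C where C: "\<And>x. norm x \<le> B \<Longrightarrow> \<bar>f x\<bar> \<le> C" using b[OF B(1)] by blast
  show ?thesis
    by (rule integrable_const_bound[where B = C]) (auto intro!: AE_I2 C B)
qed

abbreviation "msq n \<equiv> LINT w|M. (norm (T n w))\<^sup>2"

abbreviation "mlyap n \<equiv> LINT w|M. lyap (T n w)"

lemma T_sq_integrable [simp]: "integrable M (\<lambda>w. (norm (T n w))\<^sup>2)"
  by (rule integrable_T_compose) (auto intro!: power_mono exI)

lemma T_integrable [simp]: "integrable M (T n)"
  by (rule norm_le_root_mean_square(1)) simp_all

lemma continuous_on_lyap: "continuous_on UNIV (lyap :: 'a \<Rightarrow> real)"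
  unfolding lyap_def by (intro continuous_intros) 

lemma lyap_measurable [measurable]: "(lyap :: 'a \<Rightarrow> real) \<in> borel_measurable borel"
  by (rule borel_measurable_continuous_onI[OF continuous_on_lyap])

lemma lyap_T_integrable [simp]: "integrable M (\<lambda>w. lyap (T n w))"
proof (rule integrable_T_compose)
  fix B :: real assume "B \<ge> 0"
  have "\<bar>lyap x\<bar> \<le> exp (sqrt (1 + B\<^sup>2))" if "norm x \<le> B" for x :: 'a
  proof -
    have "lyap x \<le> exp (sqrt (1 + (norm x)\<^sup>2))" by (simp add: lyap_def)
    also have "... \<le> exp (sqrt (1 + B\<^sup>2))" using power_mono[OF that, of 2] by simp
    finally show ?thesis using lyap_nonneg[of x] by simp
  qed
  then show "\<exists>C. \<forall>x. norm x \<le> B \<longrightarrow> \<bar>lyap (x :: 'a)\<bar> \<le> C" by blast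
qed measurable

text \<open>Averaging over the new sample replaces the sign in the linear term of
  \<open>lyap_step\<close> by the drift; \<open>drift_inward\<close> and
  \<open>lyap_le_drift\<close> bound the result by \<open>- (k / 4)\<close> times the mean of
  \<open>lyap\<close>.\<close>

lemma lyap_recursion:
  "\<exists>a>0. \<forall>n. \<gamma> n \<le> 1/2 \<longrightarrow> mlyap (Suc n)
     \<le> (1 - a * \<gamma> n + 3 * (\<gamma> n)\<^sup>2) * mlyap n + 3 * exp 1 * (\<gamma> n)\<^sup>2"
proof -
  obtain k where k: "k > 0" "\<And>h. inner (drift (m + h)) h \<le> - k * min ((norm h)\<^sup>2) (norm h)"
    using drift_inward[OF median line] by blast
  define s where "s x = sqrt (1 + (norm x)\<^sup>2)" for x :: 'a
  have s: "s x \<ge> 1" for x by (simp add: s_def)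
  have s_meas [measurable]: "s \<in> borel_measurable borel" unfolding s_def by measurable
  have "mlyap (Suc n)
     \<le> (1 - k / 4 * \<gamma> n + 3 * (\<gamma> n)\<^sup>2) * mlyap n + 3 * exp 1 * (\<gamma> n)\<^sup>2"
    if g: "\<gamma> n \<le> 1/2" for n
  proof -
    \<comment> \<open>The linear term of the Lyapunov increment as a function of the past and the
      new sample.\<close>
    define G where "G p y = exp (s (zf n p - m)) * (inner (zf n p - m) (sgn (y - zf n p)) / s (zf n p - m))" for p y
    note zf_measurable[OF order.refl, of n, measurable]
    have [measurable]: "case_prod G \<in> borel_measurable (PiM {..n} (\<lambda>_. borel) \<Otimes>\<^sub>M borel)"
      unfolding G_def by measurable
    have G_past: "G (past n w) y = exp (s (T n w)) * (inner (T n w) (sgn (y - Z n w)) / s (T n w))" for w y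
      unfolding G_def Z_eq_zf[OF order.refl, symmetric] T_def ..
    have exp_int: "integrable M (\<lambda>w. exp (s (T n w)))"
    proof (rule Bochner_Integration.integrable_cong[THEN iffD1, OF refl _ Bochner_Integration.integrable_add[OF lyap_T_integrable[of n]]])
      show "lyap (T n w) + exp 1 = exp (s (T n w))" for w by (simp add: lyap_def s_def)
    qed simp
    \<comment> \<open>As \<open>norm x \<le> s x\<close>, the quotients are at most 1 and
      \<open>exp (s (T n w))\<close> dominates the integrands.\<close>
    have quot: "\<bar>inner x u / s x\<bar> \<le> 1" if "norm u \<le> 1" for x u :: 'a
    proof -
      have "\<bar>inner x u\<bar> \<le> norm x * norm u" by (rule Cauchy_Schwarz_ineq2)
      also have "... \<le> norm x * 1" using that by (intro mult_left_mono) auto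
      also have "... \<le> s x" unfolding s_def by (simp add: real_le_rsqrt)
      finally show ?thesis using s[of x] by (simp add: abs_divide)
    qed
    have damp: "norm (exp v * q) \<le> norm (exp v)" if "\<bar>q\<bar> \<le> 1" for v q :: real
      using that by (simp add: abs_mult mult_left_le)
    have G_int: "integrable M (\<lambda>w. G (past n w) (Xs (Suc n) w))"
      unfolding G_past
    proof (rule Bochner_Integration.integrable_bound[OF exp_int])
      show "AE w in M. norm (exp (s (T n w)) * (inner (T n w) (sgn (Xs (Suc n) w - Z n w)) / s (T n w))) \<le> norm (exp (s (T n w)))"
        by (intro AE_I2 damp quot norm_sgn_le_1)
    qed measurable
    have D_int: "integrable M (\<lambda>w. exp (s (T n w)) * (inner (T n w) (drift (Z n w)) / s (T n w)))"
    proof (rule Bochner_Integration.integrable_bound[OF exp_int])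
      show "AE w in M. norm (exp (s (T n w)) * (inner (T n w) (drift (Z n w)) / s (T n w))) \<le> norm (exp (s (T n w)))"
        by (intro AE_I2 damp quot norm_drift_le)
    qed measurable
    have "(LINT w|M. G (past n w) (Xs (Suc n) w)) = (LINT w|M. (LINT w'|M. G (past n w) (X w')))"
      by (rule step_integral[OF _ G_int]) measurable
    also have "... = (LINT w|M. exp (s (T n w)) * (inner (T n w) (drift (Z n w)) / s (T n w)))"
      unfolding G_past by (simp add: drift_def)
    also have "... \<le> (LINT w|M. - (k / 4) * lyap (T n w))"
    proof (rule integral_mono[OF D_int])
      fix w
      have "m + T n w = Z n w" by (simp add: T_def)
      then have "inner (T n w) (drift (Z n w)) \<le> - k * min ((norm (T n w))\<^sup>2) (norm (T n w))"
        using k(2)[of "T n w"] by (simp add: inner_commute)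
      then have "exp (s (T n w)) * (inner (T n w) (drift (Z n w)) / s (T n w))
          \<le> exp (s (T n w)) * ((- k * min ((norm (T n w))\<^sup>2) (norm (T n w))) / s (T n w))"
        using s[of "T n w"] by (intro mult_left_mono divide_right_mono) auto
      also have "... = - k * (exp (s (T n w)) * (min ((norm (T n w))\<^sup>2) (norm (T n w)) / s (T n w)))" by simp
      also have "... \<le> - k * (lyap (T n w) / 4)"
        using lyap_le_drift[of "T n w"] k(1) unfolding s_def by (intro mult_left_mono_neg) auto
      finally show "exp (s (T n w)) * (inner (T n w) (drift (Z n w)) / s (T n w)) \<le> - (k / 4) * lyap (T n w)" by simp
    qed simp
    finally have G_le: "(LINT w|M. G (past n w) (Xs (Suc n) w)) \<le> - (k / 4) * mlyap n" by simp
    have "mlyap (Suc n) \<le> (LINT w|M. (1 + 3 * (\<gamma> n)\<^sup>2) * lyap (T n w) + \<gamma> n * G (past n w) (Xs (Suc n) w) + 3 * exp 1 * (\<gamma> n)\<^sup>2)"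
    proof (rule integral_mono)
      fix w
      have "lyap (T (Suc n) w) \<le> lyap (T n w) + exp (s (T n w)) * (\<gamma> n * inner (T n w) (sgn (Xs (Suc n) w - Z n w)) / s (T n w) + 3 * (\<gamma> n)\<^sup>2)"
        unfolding T_Suc s_def using \<gamma>_pos[of n] g by (intro lyap_step norm_sgn_le_1) auto
      also have "... = lyap (T n w) + \<gamma> n * G (past n w) (Xs (Suc n) w) + 3 * (\<gamma> n)\<^sup>2 * exp (s (T n w))"
        unfolding G_past by (simp add: algebra_simps)
      \<comment> \<open>This splitting produces both the factor
        \<open>1 + 3 * (\<gamma> n)\<^sup>2\<close> and the additive term with
        \<open>exp 1\<close>.\<close>
      also have "exp (s (T n w)) = lyap (T n w) + exp 1" by (simp add: lyap_def s_def)
      finally show "lyap (T (Suc n) w) \<le> (1 + 3 * (\<gamma> n)\<^sup>2) * lyap (T n w) + \<gamma> n * G (past n w) (Xs (Suc n) w) + 3 * exp 1 * (\<gamma> n)\<^sup>2"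
        by (simp add: algebra_simps)
    qed (use G_int in simp_all)
    also have "... = (1 + 3 * (\<gamma> n)\<^sup>2) * mlyap n + \<gamma> n * (LINT w|M. G (past n w) (Xs (Suc n) w)) + 3 * exp 1 * (\<gamma> n)\<^sup>2"
      using G_int by (simp add: prob_space)
    also have "... \<le> (1 + 3 * (\<gamma> n)\<^sup>2) * mlyap n + \<gamma> n * (- (k / 4) * mlyap n) + 3 * exp 1 * (\<gamma> n)\<^sup>2"
      using G_le \<gamma>_pos[of n] by (intro add_mono mult_left_mono) auto
    finally show ?thesis by (simp add: algebra_simps)
  qed
  then show ?thesis using k(1) by (intro exI[of _ "k / 4"]) auto
qed

lemma mean_square_rate: "\<exists>C\<ge>0. \<forall>n\<ge>1. msq n \<le> C * real n powr (- \<alpha>)"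
proof -
  obtain a where a: "a > 0" "\<And>n. \<gamma> n \<le> 1/2 \<Longrightarrow> mlyap (Suc n)
     \<le> (1 - a * \<gamma> n + 3 * (\<gamma> n)\<^sup>2) * mlyap n + 3 * exp 1 * (\<gamma> n)\<^sup>2"
    using lyap_recursion by blast
  have "\<exists>C. \<forall>n\<ge>1. mlyap n \<le> C * real n powr (- \<alpha>)"
  proof (rule stochastic_recursion_rate[where \<gamma> = \<gamma> and c = c and a = a and b = 3 and d = "3 * exp 1"])
    show "mlyap n \<ge> 0" for n
      by (intro integral_nonneg_AE) (simp add: lyap_nonneg)
    show "mlyap (Suc n)
      \<le> (1 - a * \<gamma> n + 3 * (\<gamma> n)\<^sup>2) * mlyap n + 3 * exp 1 * (\<gamma> n)\<^sup>2"
      if "\<gamma> n \<le> 1/2" for n using that by (rule a(2))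
    show "\<gamma> n = c * real n powr (- \<alpha>)" if "n \<ge> 1" for n using that by (rule \<gamma>)
  qed (use \<alpha> c a(1) in auto)
  then obtain C where C: "\<And>n. n \<ge> 1 \<Longrightarrow> mlyap n \<le> C * real n powr (- \<alpha>)" by blast
  have "msq n \<le> \<bar>C\<bar> * real n powr (- \<alpha>)" if "n \<ge> 1" for n
  proof -
    have "msq n \<le> mlyap n"
      by (intro integral_mono norm_sq_le_lyap) auto
    also have "... \<le> \<bar>C\<bar> * real n powr (- \<alpha>)" using C[OF that] by (rule order.trans) (simp add: mult_right_mono)
    finally show ?thesis .
  qed
  then show ?thesis by (intro exI[of _ "\<bar>C\<bar>"]) auto
qed

section \<open>Linearisation around the median\<close>

definition U :: "nat \<Rightarrow> 'w \<Rightarrow> 'a" where "U n w = sgn (Xs (Suc n) w - m)"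

text \<open>Noise at the iterate minus noise at \<open>m\<close>. Both are centred given the past,
  the latter because \<open>drift m = 0\<close>.\<close>

definition D :: "nat \<Rightarrow> 'w \<Rightarrow> 'a" where
  "D n w = sgn (Xs (Suc n) w - Z n w) - U n w - drift (Z n w)"

definition \<delta> :: "nat \<Rightarrow> 'w \<Rightarrow> 'a" where "\<delta> n w = drift (Z n w) + \<Gamma> (T n w)"

lemma drift_m: "drift m = 0" by (rule drift_median[OF median])

lemma U_measurable [measurable]: "U n \<in> borel_measurable M" unfolding U_def by measurable

lemma D_measurable [measurable]: "D n \<in> borel_measurable M" unfolding D_def by measurable

lemma Gamma_measurable [measurable]: "\<Gamma> \<in> borel_measurable borel"
  using bounded_linear_Gamma by (intro borel_measurable_continuous_onI linear_continuous_on)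

lemma \<delta>_measurable [measurable]: "\<delta> n \<in> borel_measurable M" unfolding \<delta>_def by measurable

lemma norm_D_le: "norm (D n w) \<le> 3"
proof -
  have "norm (D n w) \<le> norm (sgn (Xs (Suc n) w - Z n w)) + norm (U n w) + norm (drift (Z n w))"
    unfolding D_def using norm_triangle_ineq4[of "sgn (Xs (Suc n) w - Z n w) - U n w" "drift (Z n w)"]
      norm_triangle_ineq4[of "sgn (Xs (Suc n) w - Z n w)" "U n w"] by linarith
  also have "... \<le> 1 + 1 + 1" unfolding U_def by (intro add_mono norm_sgn_le_1 norm_drift_le)
  finally show ?thesis by simp
qed

lemma linearised_step:
  assumes "n \<ge> 1"
  shows "\<Gamma> (T n w) = (1 / \<gamma> n) *\<^sub>R (T n w - T (Suc n) w) + U n w + D n w + \<delta> n w"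
  unfolding T_Suc \<delta>_def D_def using \<gamma>_pos[of n] by simp

lemma D_sq_integrable [simp]: "integrable M (\<lambda>w. (norm (D n w))\<^sup>2)"
  using power_mono[OF norm_D_le norm_ge_zero, where n = 2]
  by (intro integrable_const_bound[where B = "3\<^sup>2"]) auto

text \<open>\<open>D i\<close> is a function of the past up to \<open>j\<close>, and averaging
  \<open>D j\<close> over the sample \<open>Xs (Suc j)\<close> leaves
  \<open>drift (Z j) - drift m - drift (Z j) = 0\<close>.\<close>

lemma D_orthogonal_less:
  assumes "i < j"
  shows "(LINT w|M. inner (D i w) (D j w)) = 0"
proof -
  define d where "d p = sgn (p (Suc i) - zf i p) - sgn (p (Suc i) - m) - drift (zf i p)" for p
  define g where "g p y = inner (d p) (sgn (y - zf j p) - sgn (y - m) - drift (zf j p))" for p y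
  have [measurable]: "zf i \<in> borel_measurable (PiM {..j} (\<lambda>_. borel))" "zf j \<in> borel_measurable (PiM {..j} (\<lambda>_. borel))"
    using assms by (auto intro: zf_measurable)
  have [measurable]: "(\<lambda>p. p (Suc i)) \<in> borel_measurable (PiM {..j} (\<lambda>_. borel :: 'a measure))"
    using assms by (intro measurable_component_singleton) simp
  have [measurable]: "d \<in> borel_measurable (PiM {..j} (\<lambda>_. borel))" unfolding d_def by measurable
  have g_meas [measurable]: "case_prod g \<in> borel_measurable (PiM {..j} (\<lambda>_. borel) \<Otimes>\<^sub>M borel)"
    unfolding g_def by measurable
  have "past j w (Suc i) = Xs (Suc i) w" for w using assms by (simp add: past_def W_def)
  then have d_past: "d (past j w) = D i w" for w
    using assms Z_eq_zf[of i j w] by (simp add: d_def D_def U_def)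
  have g_past: "g (past j w) y = inner (D i w) (sgn (y - Z j w) - sgn (y - m) - drift (Z j w))" for w y
    unfolding g_def d_past Z_eq_zf[OF order.refl, symmetric] ..
  have eq: "g (past j w) (Xs (Suc j) w) = inner (D i w) (D j w)" for w
    unfolding g_past by (simp add: D_def U_def)
  have "(LINT w|M. g (past j w) (Xs (Suc j) w)) = (LINT w|M. (LINT w'|M. g (past j w) (X w')))"
  proof (rule step_integral[OF g_meas])
    have "\<bar>inner (D i w) (D j w)\<bar> \<le> 3 * 3" for w
      by (rule order.trans[OF Cauchy_Schwarz_ineq2 mult_mono'[OF norm_D_le norm_D_le norm_ge_zero norm_ge_zero]])
    then show "integrable M (\<lambda>w. g (past j w) (Xs (Suc j) w))"
      unfolding eq by (intro integrable_const_bound[where B = "3 * 3"]) auto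
  qed
  also have "... = (LINT w|M. 0)"
  proof (rule Bochner_Integration.integral_cong[OF refl])
    fix w
    have "(LINT w'|M. g (past j w) (X w')) = inner (D i w) (LINT w'|M. sgn (X w' - Z j w) - sgn (X w' - m) - drift (Z j w))"
      unfolding g_past by (intro integral_inner_right) auto
    also have "(LINT w'|M. sgn (X w' - Z j w) - sgn (X w' - m) - drift (Z j w)) = drift (Z j w) - drift m - drift (Z j w)"
      by (simp add: drift_def prob_space)
    finally show "(LINT w'|M. g (past j w) (X w')) = 0" by (simp add: drift_m)
  qed
  finally show ?thesis unfolding eq by simp
qed

lemma D_orthogonal: "i \<noteq> j \<Longrightarrow> (LINT w|M. inner (D i w) (D j w)) = 0"
  using D_orthogonal_less[of i j] D_orthogonal_less[of j i]
  by (cases "i < j") (auto simp: inner_commute)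

text \<open>As \<open>drift m = 0\<close>, the drift at \<open>z\<close> is the mean of a sign
  difference, and Jensen applies.\<close>

lemma norm_drift_sq_le: "(norm (drift z))\<^sup>2 \<le> 4 * inv_sq * (norm (z - m))\<^sup>2"
proof -
  let ?f = "\<lambda>w. sgn (X w - z) - sgn (X w - m)"
  have sq: "integrable M (\<lambda>w. (norm (?f w))\<^sup>2)"
  proof (rule integrable_const_bound[where B = "2\<^sup>2"])
    have "norm (?f w) \<le> 1 + 1" for w
      by (intro order.trans[OF norm_triangle_ineq4] add_mono norm_sgn_le_1)
    then have "(norm (?f w))\<^sup>2 \<le> (1 + 1)\<^sup>2" for w by (rule power_mono) simp
    then show "AE w in M. norm ((norm (?f w))\<^sup>2) \<le> 2\<^sup>2" by simp
  qed measurable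
  have "norm (drift z) = norm (LINT w|M. ?f w)" using drift_m by (simp add: drift_def)
  also have "... \<le> (LINT w|M. norm (?f w))" by (rule integral_norm_bound)
  also have "... \<le> sqrt (LINT w|M. (norm (?f w))\<^sup>2)" by (rule norm_le_root_mean_square(2)[OF _ sq]) measurable
  also have "... \<le> sqrt (4 * inv_sq * (norm (z - m))\<^sup>2)" by (intro real_sqrt_le_mono mean_square_sgn_diff)
  finally have "(norm (drift z))\<^sup>2 \<le> (sqrt (4 * inv_sq * (norm (z - m))\<^sup>2))\<^sup>2" by (rule power_mono) simp
  then show ?thesis using inv_sq_nonneg by simp
qed

text \<open>The parallelogram bound doubles two contributions of \<open>4 * inv_sq\<close>, from the
  sign difference and from the drift; hence 16.\<close>

lemma D_mean_square: "(LINT w|M. (norm (D n w))\<^sup>2) \<le> 16 * inv_sq * msq n"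
proof -
  define g where "g p y = (norm (sgn (y - zf n p) - sgn (y - m)))\<^sup>2" for p and y :: 'a
  note zf_measurable[OF order.refl, of n, measurable]
  have g_meas [measurable]: "case_prod g \<in> borel_measurable (PiM {..n} (\<lambda>_. borel) \<Otimes>\<^sub>M borel)"
    unfolding g_def by measurable
  have g_past: "g (past n w) y = (norm (sgn (y - Z n w) - sgn (y - m)))\<^sup>2" for w y
    unfolding g_def Z_eq_zf[OF order.refl, symmetric] ..
  have g_bd: "\<bar>g p y\<bar> \<le> 4" for p y
  proof -
    have "norm (sgn (y - zf n p) - sgn (y - m)) \<le> 1 + 1"
      by (intro order.trans[OF norm_triangle_ineq4] add_mono norm_sgn_le_1)
    then have "(norm (sgn (y - zf n p) - sgn (y - m)))\<^sup>2 \<le> (1 + 1)\<^sup>2" by (rule power_mono) simp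
    then show ?thesis by (simp add: g_def)
  qed
  have past_meas [measurable]: "past n \<in> measurable M (PiM {..n} (\<lambda>_. borel))" unfolding past_def by measurable
  have g_int: "integrable M (\<lambda>w. g (past n w) (Xs (Suc n) w))"
    by (rule integrable_const_bound[where B = 4]) (use g_bd in auto)
  have "(LINT w|M. g (past n w) (Xs (Suc n) w)) = (LINT w|M. (LINT w'|M. g (past n w) (X w')))"
    by (rule step_integral[OF g_meas g_int])
  also have "... \<le> (LINT w|M. 4 * inv_sq * (norm (T n w))\<^sup>2)"
  proof (rule integral_mono)
    show "integrable M (\<lambda>w. LINT w'|M. g (past n w) (X w'))"
    proof (rule integrable_const_bound[where B = 4])
      have "\<bar>\<integral>w'. g (past n w) (X w') \<partial>M\<bar> \<le> (LINT w'|M. 4)" for w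
        unfolding g_past
        by (intro order.trans[OF integral_abs_bound] integral_mono integrable_abs integrable_const_bound[where B = 4])
          (use g_bd[of "past n w", unfolded g_past] in auto)
      then show "AE w in M. norm (LINT w'|M. g (past n w) (X w')) \<le> 4" by (simp add: prob_space)
      show "(\<lambda>w. LINT w'|M. g (past n w) (X w')) \<in> borel_measurable M" by measurable
    qed
    show "(LINT w'|M. g (past n w) (X w')) \<le> 4 * inv_sq * (norm (T n w))\<^sup>2" for w
      unfolding g_past T_def by (rule mean_square_sgn_diff)
  qed simp
  finally have 1: "(LINT w|M. g (past n w) (Xs (Suc n) w)) \<le> 4 * inv_sq * msq n" by simp
  have "(LINT w|M. (norm (D n w))\<^sup>2) \<le> (LINT w|M. 2 * g (past n w) (Xs (Suc n) w) + 8 * inv_sq * (norm (T n w))\<^sup>2)"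
  proof (rule integral_mono)
    fix w
    have par: "(norm (x - y))\<^sup>2 \<le> 2 * (norm x)\<^sup>2 + 2 * (norm y)\<^sup>2" for x y :: 'a
    proof -
      have "(norm (x - y))\<^sup>2 + (norm (x + y))\<^sup>2 = 2 * (norm x)\<^sup>2 + 2 * (norm y)\<^sup>2"
        unfolding power2_norm_eq_inner by (simp add: inner_add_left inner_add_right inner_diff_left inner_diff_right inner_commute)
      then show ?thesis using zero_le_power2[of "norm (x + y)"] by linarith
    qed
    have "(norm (D n w))\<^sup>2 \<le> 2 * g (past n w) (Xs (Suc n) w) + 2 * (norm (drift (Z n w)))\<^sup>2"
      unfolding D_def U_def g_past by (rule par)
    also have "... \<le> 2 * g (past n w) (Xs (Suc n) w) + 2 * (4 * inv_sq * (norm (T n w))\<^sup>2)"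
      unfolding T_def using norm_drift_sq_le by (intro add_mono mult_left_mono) auto
    finally show "(norm (D n w))\<^sup>2 \<le> 2 * g (past n w) (Xs (Suc n) w) + 8 * inv_sq * (norm (T n w))\<^sup>2" by simp
  qed (use g_int in simp_all)
  also have "... \<le> 16 * inv_sq * msq n"
    using 1 g_int by simp
  finally show ?thesis .
qed

end

context sgd begin

abbreviation "\<Sigma> \<equiv> Sigma_op M X m"

section \<open>Size of the remainder\<close>

lemma D_sum_bound:
  assumes C: "C \<ge> 0" "\<And>n. n \<ge> 1 \<Longrightarrow> msq n \<le> C * real n powr (- \<alpha>)"
  shows "integrable M (\<lambda>w. \<Sum>n=1..N. D n w)"
    "(LINT w|M. norm (\<Sum>n=1..N. D n w)) \<le> sqrt (16 * inv_sq * C * (real N powr (1 - \<alpha>) / (1 - \<alpha>)))"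
proof -
  have sq: "integrable M (\<lambda>w. (norm (\<Sum>n=1..N. D n w))\<^sup>2)"
    "(LINT w|M. (norm (\<Sum>n=1..N. D n w))\<^sup>2) = (\<Sum>n=1..N. LINT w|M. (norm (D n w))\<^sup>2)"
    using D_orthogonal by (intro mean_square_orthogonal_sum; simp)+
  show "integrable M (\<lambda>w. \<Sum>n=1..N. D n w)" by (rule norm_le_root_mean_square(1)[OF _ sq(1)]) measurable
  have "(LINT w|M. norm (\<Sum>n=1..N. D n w)) \<le> sqrt (\<Sum>n=1..N. LINT w|M. (norm (D n w))\<^sup>2)"
    using norm_le_root_mean_square(2)[OF _ sq(1)] sq(2) by simp
  also have "... \<le> sqrt (\<Sum>n=1..N. 16 * inv_sq * (C * real n powr (- \<alpha>)))"
    using C(2) inv_sq_nonneg by (intro real_sqrt_le_mono sum_mono order.trans[OF D_mean_square] mult_left_mono) auto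
  also have "(\<Sum>n=1..N. 16 * inv_sq * (C * real n powr (- \<alpha>))) = 16 * inv_sq * C * (\<Sum>n=1..N. real n powr (- \<alpha>))"
    by (simp add: sum_distrib_left mult.assoc)
  also have "sqrt ... \<le> sqrt (16 * inv_sq * C * (real N powr (1 - \<alpha>) / (1 - \<alpha>)))"
    using C(1) inv_sq_nonneg \<alpha> by (intro real_sqrt_le_mono mult_left_mono sum_powr_le) auto
  finally show "(LINT w|M. norm (\<Sum>n=1..N. D n w)) \<le> sqrt (16 * inv_sq * C * (real N powr (1 - \<alpha>) / (1 - \<alpha>)))" .
qed

lemma norm_\<delta>_le: "norm (\<delta> n w) \<le> 12 * inv_sq * (norm (T n w))\<^sup>2"
  using drift_taylor[of "T n w"] by (simp add: \<delta>_def T_def drift_m)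

lemma \<delta>_integrable [simp]: "integrable M (\<delta> n)"
  by (rule Bochner_Integration.integrable_bound[OF integrable_mult_right[OF T_sq_integrable[of n], of "12 * inv_sq"]])
    (use norm_\<delta>_le inv_sq_nonneg in auto)

text \<open>No cancellation is used, the norms are simply added: for this bound to be
  \<open>o(sqrt N)\<close>, \<open>\<alpha> > 1/2\<close> is required.\<close>

lemma \<delta>_sum_bound:
  assumes C: "C \<ge> 0" "\<And>n. n \<ge> 1 \<Longrightarrow> msq n \<le> C * real n powr (- \<alpha>)"
  shows "(LINT w|M. norm (\<Sum>n=1..N. \<delta> n w)) \<le> 12 * inv_sq * C * (real N powr (1 - \<alpha>) / (1 - \<alpha>))"
proof -
  have "(LINT w|M. norm (\<Sum>n=1..N. \<delta> n w)) \<le> (LINT w|M. (\<Sum>n=1..N. 12 * inv_sq * (norm (T n w))\<^sup>2))"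
    using norm_\<delta>_le by (intro integral_mono order.trans[OF norm_sum] sum_mono) auto
  also have "... = (\<Sum>n=1..N. 12 * inv_sq * msq n)" by simp
  also have "... \<le> (\<Sum>n=1..N. 12 * inv_sq * (C * real n powr (- \<alpha>)))"
    using C(2) inv_sq_nonneg by (intro sum_mono mult_left_mono) auto
  also have "... = 12 * inv_sq * C * (\<Sum>n=1..N. real n powr (- \<alpha>))"
    by (simp add: sum_distrib_left mult.assoc)
  also have "... \<le> 12 * inv_sq * C * (real N powr (1 - \<alpha>) / (1 - \<alpha>))"
    using C(1) inv_sq_nonneg \<alpha> by (intro mult_left_mono sum_powr_le) auto
  finally show ?thesis .
qed

lemma inverse_\<gamma>: "n \<ge> 1 \<Longrightarrow> 1 / \<gamma> n = real n powr \<alpha> / c"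
  using c by (simp add: \<gamma> powr_minus field_simps)

text \<open>
  Abel summation: adding the boundary term turns the increments of the left-hand side into
  \<open>(1 / \<gamma> (N + 1) - 1 / \<gamma> N) T (N + 1)\<close>, and \<open>(b\<^sup>2 - a\<^sup>2) / b \<le> 2 (b - a)\<close> with
  \<open>b = (N + 1) powr (\<alpha> / 2)\<close> makes their sizes telescope.
\<close>

lemma telescoped_bound:
  assumes K: "K \<ge> 0" "\<And>n. n \<ge> 1 \<Longrightarrow> (LINT w|M. norm (T n w)) \<le> K * real n powr (- (\<alpha> / 2))" and N: "N \<ge> 1"
  shows "(LINT w|M. norm ((\<Sum>n=1..N. (1 / \<gamma> n) *\<^sub>R (T n w - T (Suc n) w)) + (1 / \<gamma> N) *\<^sub>R T (Suc N) w))
    \<le> 2 * (K / c) * real N powr (\<alpha> / 2)"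
  using N
proof (induction rule: dec_induct)
  case base
  have "(LINT w|M. norm ((1 / \<gamma> 1) *\<^sub>R T 1 w)) \<le> (1 / \<gamma> 1) * K"
    using K(2)[of 1] \<gamma>_pos[of 1] by (simp add: divide_right_mono)
  also have "... = K / c" using inverse_\<gamma>[of 1] by simp
  also have "... \<le> 2 * (K / c)" using divide_nonneg_pos[OF K(1) c] by linarith
  finally show ?case by (simp add: scaleR_diff_right)
next
  case (step N)
  let ?A = "\<lambda>N w. (\<Sum>n=1..N. (1 / \<gamma> n) *\<^sub>R (T n w - T (Suc n) w)) + (1 / \<gamma> N) *\<^sub>R T (Suc N) w"
  define b a where "b = real (Suc N) powr (\<alpha> / 2)" and "a = real N powr (\<alpha> / 2)"
  have ab: "0 < a" "a \<le> b" "b > 0" using step \<alpha> by (auto simp: a_def b_def intro!: powr_mono2)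
  have sq: "real (Suc N) powr \<alpha> = b\<^sup>2" "real N powr \<alpha> = a\<^sup>2"
    by (simp_all add: a_def b_def power2_eq_square powr_add[symmetric])
  have coef: "1 / \<gamma> (Suc N) - 1 / \<gamma> N = (b\<^sup>2 - a\<^sup>2) / c"
    using inverse_\<gamma>[of "Suc N"] inverse_\<gamma>[of N] step unfolding sq by (simp add: diff_divide_distrib)
  have "?A (Suc N) w = ?A N w + (1 / \<gamma> (Suc N) - 1 / \<gamma> N) *\<^sub>R T (Suc N) w" for w
    by (simp add: scaleR_diff_right scaleR_diff_left)
  then have A: "?A (Suc N) w = ?A N w + ((b\<^sup>2 - a\<^sup>2) / c) *\<^sub>R T (Suc N) w" for w unfolding coef .
  have ab2: "b\<^sup>2 - a\<^sup>2 \<ge> 0" using ab by (simp add: power_mono)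
  have "(LINT w|M. norm (?A (Suc N) w)) \<le> (LINT w|M. norm (?A N w) + (b\<^sup>2 - a\<^sup>2) / c * norm (T (Suc N) w))"
    unfolding A
  proof (rule integral_mono)
    show "norm (?A N w + ((b\<^sup>2 - a\<^sup>2) / c) *\<^sub>R T (Suc N) w) \<le> norm (?A N w) + (b\<^sup>2 - a\<^sup>2) / c * norm (T (Suc N) w)" for w
      using norm_triangle_ineq[of "?A N w" "((b\<^sup>2 - a\<^sup>2) / c) *\<^sub>R T (Suc N) w"] ab2 c by simp
  qed simp_all
  also have "... = (LINT w|M. norm (?A N w)) + (b\<^sup>2 - a\<^sup>2) / c * (LINT w|M. norm (T (Suc N) w))"
    by (subst Bochner_Integration.integral_add) simp_all
  also have "... \<le> 2 * (K / c) * a + (b\<^sup>2 - a\<^sup>2) / c * (K / b)"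
  proof (intro add_mono mult_left_mono)
    show "(LINT w|M. norm (?A N w)) \<le> 2 * (K / c) * a" using step.IH unfolding a_def .
    show "(LINT w|M. norm (T (Suc N) w)) \<le> K / b"
    proof -
      have "(LINT w|M. norm (T (Suc N) w)) \<le> K * real (Suc N) powr (- (\<alpha> / 2))" by (rule K(2)) simp
      also have "... = K / b" by (simp only: b_def powr_minus divide_inverse)
      finally show ?thesis .
    qed
  qed (use ab2 c in simp)
  also have "(b\<^sup>2 - a\<^sup>2) / c * (K / b) = (K / c) * ((b - a) * ((b + a) / b))"
  proof -
    have "b\<^sup>2 - a\<^sup>2 = (b - a) * (b + a)" by (simp add: power2_eq_square algebra_simps)
    then show ?thesis by (simp add: mult_ac)
  qed
  also have "... \<le> (K / c) * ((b - a) * 2)"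
  proof (intro mult_left_mono)
    show "(b + a) / b \<le> 2" using ab by (simp add: pos_divide_le_eq)
  qed (use K(1) c ab in auto)
  also have "2 * (K / c) * a + (K / c) * ((b - a) * 2) = 2 * (K / c) * b" by (simp add: algebra_simps)
  finally show ?case by (simp add: b_def)
qed

definition rem :: "nat \<Rightarrow> 'w \<Rightarrow> 'a" where
  "rem N w = (\<Sum>n=1..N. (1 / \<gamma> n) *\<^sub>R (T n w - T (Suc n) w)) + (\<Sum>n=1..N. D n w) + (\<Sum>n=1..N. \<delta> n w)"

lemma D_integrable [simp]: "integrable M (D n)"
  by (rule norm_le_root_mean_square(1)) simp_all

lemma rem_integrable [simp]: "integrable M (rem N)"
  unfolding rem_def by simp

lemma Gamma_sum_T: "\<Gamma> (\<Sum>n=1..N. T n w) = rem N w + (\<Sum>n=1..N. U n w)"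
proof -
  interpret G: bounded_linear "\<Gamma>" by (rule bounded_linear_Gamma)
  have "\<Gamma> (\<Sum>n=1..N. T n w) = (\<Sum>n=1..N. \<Gamma> (T n w))" by (rule G.sum)
  also have "... = (\<Sum>n=1..N. (1 / \<gamma> n) *\<^sub>R (T n w - T (Suc n) w) + U n w + D n w + \<delta> n w)"
    by (intro sum.cong refl linearised_step) simp
  also have "... = rem N w + (\<Sum>n=1..N. U n w)" by (simp add: rem_def sum.distrib)
  finally show ?thesis .
qed

text \<open>After division by \<open>sqrt N\<close> the three parts have exponents
  \<open>(\<alpha> - 1) / 2\<close>, \<open>- \<alpha> / 2\<close> and
  \<open>1/2 - \<alpha>\<close>: \<open>\<alpha> < 1\<close> settles the telescoped part,
  \<open>\<alpha> > 1/2\<close> the quadratic one.\<close>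

lemma rem_negligible: "(\<lambda>N. (1 / sqrt (real N)) * (LINT w|M. norm (rem N w))) \<longlonglongrightarrow> 0"
proof -
  obtain C where C: "C \<ge> 0" "\<And>n. n \<ge> 1 \<Longrightarrow> msq n \<le> C * real n powr (- \<alpha>)"
    using mean_square_rate by blast
  define K where "K = sqrt C"
  have K0: "K \<ge> 0" using C(1) by (simp add: K_def)
  have K: "(LINT w|M. norm (T n w)) \<le> K * real n powr (- (\<alpha> / 2))" if "n \<ge> 1" for n
  proof -
    have "(LINT w|M. norm (T n w)) \<le> sqrt (msq n)"
      by (rule norm_le_root_mean_square(2)) simp_all
    also have "... \<le> sqrt (C * real n powr (- \<alpha>))" by (rule real_sqrt_le_mono[OF C(2)[OF that]])
    also have "... = K * real n powr (- (\<alpha> / 2))"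
      using powr_half_sqrt_powr[of "real n" "- \<alpha>"] by (simp add: K_def real_sqrt_mult)
    finally show ?thesis .
  qed
  \<comment> \<open>The 3 is 2 from the Abel summation plus 1 for its boundary term, which is not
    part of \<open>rem\<close> and is removed again.\<close>
  define b1 b2 b3 where "b1 = 3 * (K / c)" and "b2 = sqrt (16 * inv_sq * C / (1 - \<alpha>))"
    and "b3 = 12 * inv_sq * C / (1 - \<alpha>)"
  have bound: "(LINT w|M. norm (rem N w))
      \<le> b1 * real N powr (\<alpha> / 2) + b2 * real N powr ((1 - \<alpha>) / 2) + b3 * real N powr (1 - \<alpha>)" if N: "N \<ge> 1" for N
  proof -
    let ?A = "\<lambda>w. (\<Sum>n=1..N. (1 / \<gamma> n) *\<^sub>R (T n w - T (Suc n) w)) + (1 / \<gamma> N) *\<^sub>R T (Suc N) w"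
    let ?D = "\<lambda>w. \<Sum>n=1..N. D n w" and ?\<delta> = "\<lambda>w. \<Sum>n=1..N. \<delta> n w"
    have last: "1 / \<gamma> N * (LINT w|M. norm (T (Suc N) w)) \<le> K / c * real N powr (\<alpha> / 2)"
    proof -
      have "1 / \<gamma> N * (LINT w|M. norm (T (Suc N) w)) \<le> 1 / \<gamma> N * (K * real (Suc N) powr (- (\<alpha> / 2)))"
        using K[of "Suc N"] \<gamma>_pos[of N] by (intro mult_left_mono) auto
      also have "... \<le> 1 / \<gamma> N * (K * real N powr (- (\<alpha> / 2)))"
        using \<gamma>_pos[of N] K0 N \<alpha> by (intro mult_left_mono powr_mono2') auto
      also have "... = K / c * (real N powr \<alpha> * real N powr (- (\<alpha> / 2)))"
        using inverse_\<gamma>[OF N] by simp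
      also have "real N powr \<alpha> * real N powr (- (\<alpha> / 2)) = real N powr (\<alpha> / 2)"
        by (simp add: powr_add[symmetric])
      finally show ?thesis .
    qed
    have "(LINT w|M. norm (rem N w)) \<le> (LINT w|M. norm (?A w) + 1 / \<gamma> N * norm (T (Suc N) w) + norm (?D w) + norm (?\<delta> w))"
    proof (rule integral_mono)
      fix w
      have "rem N w = (?A w - (1 / \<gamma> N) *\<^sub>R T (Suc N) w) + ?D w + ?\<delta> w" by (simp add: rem_def)
      then have "norm (rem N w) \<le> norm (?A w) + norm ((1 / \<gamma> N) *\<^sub>R T (Suc N) w) + norm (?D w) + norm (?\<delta> w)"
        by (simp only:) (intro order.trans[OF norm_triangle_ineq] add_mono norm_triangle_ineq4 order.refl)
      then show "norm (rem N w) \<le> norm (?A w) + 1 / \<gamma> N * norm (T (Suc N) w) + norm (?D w) + norm (?\<delta> w)"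
        using \<gamma>_pos[of N] by simp
    qed simp_all
    also have "... = (LINT w|M. norm (?A w)) + 1 / \<gamma> N * (LINT w|M. norm (T (Suc N) w)) + (LINT w|M. norm (?D w)) + (LINT w|M. norm (?\<delta> w))"
      by simp
    also have "... \<le> 2 * (K / c) * real N powr (\<alpha> / 2) + K / c * real N powr (\<alpha> / 2)
        + sqrt (16 * inv_sq * C * (real N powr (1 - \<alpha>) / (1 - \<alpha>))) + 12 * inv_sq * C * (real N powr (1 - \<alpha>) / (1 - \<alpha>))"
      by (intro add_mono telescoped_bound[OF K0 K N] last D_sum_bound(2)[OF C] \<delta>_sum_bound[OF C])
    also have "sqrt (16 * inv_sq * C * (real N powr (1 - \<alpha>) / (1 - \<alpha>))) = b2 * real N powr ((1 - \<alpha>) / 2)"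
      by (simp add: b2_def real_sqrt_mult real_sqrt_divide powr_half_sqrt_powr)
    finally show ?thesis by (simp add: b1_def b3_def algebra_simps)
  qed
  have pw: "1 / sqrt (real N) * real N powr e = real N powr (e - 1/2)" if "N \<ge> 1" for N e
    using that by (simp add: powr_diff powr_half_sqrt)
  have z: "(\<lambda>N. real N powr e) \<longlonglongrightarrow> 0" if "e < 0" for e
    using that by (rule tendsto_neg_powr[OF _ filterlim_real_sequentially])
  show ?thesis
  proof (rule tendsto_sandwich[OF _ _ tendsto_const])
    show "\<forall>\<^sub>F N in sequentially. 0 \<le> (1 / sqrt (real N)) * (LINT w|M. norm (rem N w))"
      by (intro always_eventually allI mult_nonneg_nonneg integral_nonneg_AE) auto
    show "\<forall>\<^sub>F N in sequentially. (1 / sqrt (real N)) * (LINT w|M. norm (rem N w))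
       \<le> b1 * real N powr (\<alpha> / 2 - 1/2) + b2 * real N powr ((1 - \<alpha>) / 2 - 1/2) + b3 * real N powr (1 - \<alpha> - 1/2)"
      using eventually_ge_at_top[of 1]
    proof eventually_elim
      case (elim N)
      have "(1 / sqrt (real N)) * (LINT w|M. norm (rem N w))
        \<le> (1 / sqrt (real N)) * (b1 * real N powr (\<alpha> / 2) + b2 * real N powr ((1 - \<alpha>) / 2) + b3 * real N powr (1 - \<alpha>))"
        by (intro mult_left_mono bound elim) simp
      also have "... = b1 * (1 / sqrt (real N) * real N powr (\<alpha> / 2)) + b2 * (1 / sqrt (real N) * real N powr ((1 - \<alpha>) / 2))
          + b3 * (1 / sqrt (real N) * real N powr (1 - \<alpha>))"
        by (simp add: algebra_simps add_divide_distrib)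
      finally show ?case unfolding pw[OF elim] .
    qed
    have "(\<lambda>N. b1 * real N powr (\<alpha> / 2 - 1/2) + b2 * real N powr ((1 - \<alpha>) / 2 - 1/2) + b3 * real N powr (1 - \<alpha> - 1/2))
       \<longlonglongrightarrow> b1 * 0 + b2 * 0 + b3 * 0"
      using \<alpha> by (intro tendsto_intros z) auto
    then show "(\<lambda>N. b1 * real N powr (\<alpha> / 2 - 1/2) + b2 * real N powr ((1 - \<alpha>) / 2 - 1/2) + b3 * real N powr (1 - \<alpha> - 1/2))
       \<longlonglongrightarrow> 0" by simp
  qed
qed

section \<open>The limit of the averages\<close>

lemma Sigma_eq: "\<Sigma> a = (LINT w|M. inner (sgn (X w - m)) a *\<^sub>R sgn (X w - m))"
  by (simp add: Sigma_op_def operator_expectation_def tensor_def sgn_div_norm)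

lemma Sigma_integrable [simp]: "integrable M (\<lambda>w. inner (sgn (X w - m)) a *\<^sub>R sgn (X w - m))"
proof (rule integrable_const_bound[where B = "norm a"])
  have "norm (inner u a *\<^sub>R u) \<le> norm a" if "norm u \<le> 1" for u :: 'a
  proof -
    have "\<bar>inner u a\<bar> \<le> norm u * norm a" by (rule Cauchy_Schwarz_ineq2)
    also have "... \<le> 1 * norm a" using that by (intro mult_right_mono) auto
    finally have "\<bar>inner u a\<bar> * norm u \<le> norm a * 1" using that by (intro mult_mono) auto
    then show ?thesis by simp
  qed
  then show "AE w in M. norm (inner (sgn (X w - m)) a *\<^sub>R sgn (X w - m)) \<le> norm a"
    by (intro AE_I2) (simp only: norm_sgn_le_1)
qed measurable

lemma Sigma_inner: "inner (\<Sigma> a) b = (LINT w|M. inner (sgn (X w - m)) a * inner (sgn (X w - m)) b)"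
  unfolding Sigma_eq by (subst integral_inner_left[symmetric]) simp_all

lemma linear_Sigma: "linear \<Sigma>"
proof (rule linearI)
  show "\<Sigma> (a + b) = \<Sigma> a + \<Sigma> b" for a b
    unfolding Sigma_eq inner_add_right scaleR_add_left by (rule Bochner_Integration.integral_add) simp_all
  show "\<Sigma> (r *\<^sub>R a) = r *\<^sub>R \<Sigma> a" for r a
    by (simp add: Sigma_eq flip: scaleR_scaleR)
qed

text \<open>The decomposition is exact: for \<open>n \<ge> 1\<close> the scaled average is the
  normalised sum of the vectors \<open>H (U j w)\<close> plus \<open>H (rem n w)\<close> divided by
  \<open>sqrt n\<close>. Since \<open>H\<close> is symmetric, these vectors have covariance
  \<open>H \<circ> \<Sigma> \<circ> H\<close>.\<close>

theorem averaged_clt: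
  "\<exists>\<nu>. centered_gaussian_law \<nu> (inv (\<Gamma>) \<circ> \<Sigma> \<circ> inv (\<Gamma>)) \<and>
    converges_in_law M (\<lambda>n w. sqrt (real n) *\<^sub>R (averaged Z n w - m)) \<nu>"
proof -
  define H where "H = inv \<Gamma>"
  obtain k where k: "k > 0" "\<And>h. k * (norm h)\<^sup>2 \<le> inner (\<Gamma> h) h" using Gamma_coercive[OF line] by blast
  have bij: "bij \<Gamma>" and H_bl: "bounded_linear H"
    unfolding H_def by (rule coercive_bij[OF bounded_linear_Gamma k])+
  interpret H: bounded_linear H by (rule H_bl)
  have GH: "\<Gamma> (H x) = x" and HG: "H (\<Gamma> x) = x" for x
    unfolding H_def using bij by (simp_all add: bij_is_surj surj_f_inv_f bij_is_inj)
  have H_sym: "inner (H x) y = inner x (H y)" for x y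
    using Gamma_sym[of "H x" "H y"] by (simp add: GH)
  have [measurable]: "H \<in> borel_measurable borel"
    using H_bl by (intro borel_measurable_continuous_onI linear_continuous_on)
  obtain L where L: "L > 0" "\<And>x. norm (H x) \<le> norm x * L" using H.pos_bounded by blast
  define Q where "Q = H \<circ> \<Sigma> \<circ> H"
  \<comment> \<open>The shift by one: the average starts at \<open>Z 1\<close>, and the step after
    \<open>Z 1\<close> uses the second sample.\<close>
  define V where "V i w = H (U (Suc i) w)" for i w
  have V_W: "V i = (\<lambda>w. H (sgn (W (Suc (Suc i)) w - m)))" for i
    by (simp add: V_def U_def W_def fun_eq_iff)
  have V_meas [measurable]: "V i \<in> borel_measurable M" for i unfolding V_def by measurable
  have V_int: "(LINT w|M. f (V i w)) = (LINT w|M. f (H (sgn (X w - m))))"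
    if [measurable]: "f \<in> borel_measurable borel" for i and f :: "'a \<Rightarrow> 'b::{banach, second_countable_topology}"
    unfolding V_def U_def
    using Xs_integral[of "\<lambda>x. f (H (sgn (x - m)))" "Suc i"] by (simp add: integral_distr)
  interpret V: bounded_iid M V L
  proof
    \<comment> \<open>Blocks of one element renumber the independent family.\<close>
    have "indep_vars (\<lambda>i. PiM {Suc (Suc i)} (\<lambda>_. borel)) (\<lambda>i w. restrict (\<lambda>j. W j w) {Suc (Suc i)}) UNIV"
      by (rule indep_vars_restrict[OF indep_W]) (auto simp: disjoint_family_on_def)
    from indep_vars_compose2[OF this, of "\<lambda>i f. H (sgn (f (Suc (Suc i)) - m))" "\<lambda>_. borel"]
    show "indep_vars (\<lambda>_. borel) V UNIV" unfolding V_W by simp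
    show "distr M borel (V n) = distr M borel (V 0)" for n
    proof -
      have "distr M borel (V n) = distr (distr M borel X) borel (\<lambda>x. H (sgn (x - m)))" for n
      proof -
        have "distr M borel (V n) = distr (distr M borel (Xs (Suc (Suc n)))) borel (\<lambda>x. H (sgn (x - m)))"
          by (subst distr_distr) (auto simp: V_def[abs_def] U_def comp_def)
        then show ?thesis using input by (simp add: algorithm_input_def)
      qed
      then show ?thesis by simp
    qed
    show "norm (V n w) \<le> L" for n w
      unfolding V_def U_def using L(1) norm_sgn_le_1[of "Xs (Suc (Suc n)) w - m"]
      by (intro order.trans[OF L(2)] mult_left_le_one_le) auto
    have "(LINT w|M. V 0 w) = (LINT w|M. H (sgn (X w - m)))" using V_int[of "\<lambda>x. x" 0] by simp
    also have "... = H (drift m)" unfolding drift_def by (intro integral_bounded_linear[OF H_bl]) simp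
    finally show "(LINT w|M. V 0 w) = 0" by (simp add: drift_m H.zero)
  qed
  have Q_form: "inner (Q h) h = (LINT w|M. (inner h (V 0 w))\<^sup>2)" for h
  proof -
    have "inner (Q h) h = (LINT w|M. (inner h (H (sgn (X w - m))))\<^sup>2)"
      by (simp add: Q_def H_sym Sigma_inner power2_eq_square inner_commute[of h])
    then show ?thesis using V_int[of "\<lambda>x. (inner h x)\<^sup>2" 0] by simp
  qed
  have psd: "psd_op Q"
    unfolding psd_op_def
  proof (intro conjI allI)
    show "linear Q" unfolding Q_def by (intro linear_compose linear_Sigma H.linear_axioms)
    show "inner (Q h) k = inner h (Q k)" for h k
      by (simp add: Q_def H_sym Sigma_inner inner_commute[of _ "\<Sigma> _"] mult.commute flip: H_sym[of h])
    show "inner (Q h) h \<ge> 0" for h unfolding Q_form by (intro integral_nonneg_AE) simp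
  qed
  obtain \<nu> where \<nu>: "centered_gaussian_law \<nu> Q" using V.ex_gaussian[OF psd Q_form] by blast
  define Y where "Y n w = sqrt (real n) *\<^sub>R (averaged Z n w - m)" for n w
  have diff: "Y n w - V.S n w = (1 / sqrt (real n)) *\<^sub>R H (rem n w)" for n w
  proof (cases "n = 0")
    case False
    have "(\<Sum>j=1..n. T j w) = H (rem n w) + (\<Sum>j=1..n. H (U j w))"
      using arg_cong[OF Gamma_sum_T[where N = n and w = w], of H] by (simp add: HG H.add H.sum)
    moreover have "(\<Sum>j=1..n. H (U j w)) = (\<Sum>i<n. V i w)"
      by (simp add: V_def sum.atLeast1_atMost_eq)
    moreover have "Y n w = (1 / sqrt (real n)) *\<^sub>R (\<Sum>j=1..n. T j w)"
    proof -
      have "(\<Sum>j=1..n. T j w) = real n *\<^sub>R (averaged Z n w - m)"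
        using False by (simp add: T_def sum_subtractf averaged_def scaleR_diff_right sum_constant_scaleR)
      then show ?thesis using False by (simp add: Y_def real_div_sqrt)
    qed
    ultimately show ?thesis by (simp add: V.S_def scaleR_add_right)
  qed (simp add: Y_def V.S_def)
  have Hrem: "integrable M (\<lambda>w. H (rem n w))" for n by (rule integrable_bounded_linear[OF H_bl rem_integrable])
  have "converges_in_law M Y \<nu>"
  proof (rule V.converges_in_law_gaussian[OF \<nu> Q_form])
    show "Y n \<in> borel_measurable M" for n
      unfolding Y_def averaged_def by measurable
    show "integrable M (\<lambda>w. Y n w - V.S n w)" for n unfolding diff using Hrem by simp
    show "(\<lambda>n. LINT w|M. norm (Y n w - V.S n w)) \<longlonglongrightarrow> 0"
    proof (rule Lim_null_comparison)
      show "(\<lambda>n. L * ((1 / sqrt (real n)) * (LINT w|M. norm (rem n w)))) \<longlonglongrightarrow> 0"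
        using tendsto_mult_left[OF rem_negligible, of L] by simp
      have "(LINT w|M. norm (Y n w - V.S n w)) \<le> L * ((1 / sqrt (real n)) * (LINT w|M. norm (rem n w)))" for n
      proof -
        have "(LINT w|M. norm (Y n w - V.S n w)) \<le> (LINT w|M. (1 / sqrt (real n)) * (norm (rem n w) * L))"
        proof (rule integral_mono)
          show "norm (Y n w - V.S n w) \<le> (1 / sqrt (real n)) * (norm (rem n w) * L)" for w
            unfolding diff using L(2)[of "rem n w"] by (simp add: divide_right_mono)
        qed (unfold diff, use Hrem in simp_all)
        also have "... = L * ((1 / sqrt (real n)) * (LINT w|M. norm (rem n w)))" by (simp add: mult_ac)
        finally show ?thesis .
      qed
      then show "\<forall>\<^sub>F n in sequentially. norm (LINT w|M. norm (Y n w - V.S n w)) \<le> L * ((1 / sqrt (real n)) * (LINT w|M. norm (rem n w)))"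
        by (simp add: integral_nonneg_AE)
    qed
  qed
  then show ?thesis using \<nu> unfolding Q_def H_def Y_def[abs_def] by blast
qed

end

theorem theorem3p4:
  fixes M :: "'w measure"
    and X :: "'w \<Rightarrow> 'a::{real_inner, banach, second_countable_topology}"
    and Xs :: "nat \<Rightarrow> 'w \<Rightarrow> 'a"
    and Z\<^sub>0 :: "'w \<Rightarrow> 'a"
    and m :: 'a
    and \<gamma> :: "nat \<Rightarrow> real"
    and c\<^sub>\<gamma> \<alpha> :: real
  assumes "prob_space M"
    and "X \<in> borel_measurable M"
    and "is_geometric_median M X m"
    and A1: "not_on_straight_line M X"
    and A2: "mixture_condition M X m"
    and A3: "inverse_square_moment_bounded_near M X m"
    and "algorithm_input M X Xs Z\<^sub>0"
    and "c\<^sub>\<gamma> > 0" and "1/2 < \<alpha>" and "\<alpha> < 1"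
    and "\<gamma> 0 > 0"
    and "\<And>n. n \<ge> 1 \<Longrightarrow> \<gamma> n = c\<^sub>\<gamma> * real n powr (- \<alpha>)"
  shows "\<exists>\<nu>. centered_gaussian_law \<nu>
               (inv (Gamma_op M X m) \<circ> Sigma_op M X m \<circ> inv (Gamma_op M X m)) \<and>
             converges_in_law M
               (\<lambda>n \<omega>. sqrt (real n) *\<^sub>R (averaged (median_sgd \<gamma> Xs Z\<^sub>0) n \<omega> - m)) \<nu>"
proof -
  interpret prob_space M by fact
  have X [measurable]: "X \<in> borel_measurable M" by fact
  let ?r = "\<lambda>w. norm (X w - m)"
  obtain A C where "A > 0" and AC: "\<And>h. norm h \<le> A \<Longrightarrow>
      (\<integral>\<^sup>+w. inverse ((ennreal (norm (X w - (m + h))))\<^sup>2) \<partial>M) \<le> ennreal C"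
    using A3 unfolding inverse_square_moment_bounded_near_def by blast
  \<comment> \<open>At \<open>h = 0\<close> the bound concerns the inverse second moment at
    \<open>m\<close> itself.\<close>
  then have "(\<integral>\<^sup>+w. inverse ((ennreal (?r w))\<^sup>2) \<partial>M) \<le> ennreal C"
    using AC[of 0] by simp
  then have fin: "(\<integral>\<^sup>+w. inverse ((ennreal (?r w))\<^sup>2) \<partial>M) < \<infinity>"
    by (rule order.strict_trans1) simp
  \<comment> \<open>On the extended scale the inverse of 0 is infinite, so finiteness excludes an
    atom at \<open>m\<close>.\<close>
  have "AE w in M. inverse ((ennreal (?r w))\<^sup>2) \<noteq> \<infinity>"
    using fin by (intro nn_integral_PInf_AE) auto
  then have ne: "AE w in M. X w \<noteq> m" by eventually_elim auto
  have "integrable M (\<lambda>w. 1 / (?r w)\<^sup>2)"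
  proof (rule integrableI_nonneg)
    have "(\<integral>\<^sup>+w. ennreal (1 / (?r w)\<^sup>2) \<partial>M) \<le> (\<integral>\<^sup>+w. inverse ((ennreal (?r w))\<^sup>2) \<partial>M)"
    proof (rule nn_integral_mono)
      fix w
      \<comment> \<open>Real division gives 0 where \<open>X w = m\<close>; there the inequality is
        strict.\<close>
      show "ennreal (1 / (?r w)\<^sup>2) \<le> inverse ((ennreal (?r w))\<^sup>2)"
        by (cases "X w = m") (simp_all add: ennreal_power inverse_ennreal inverse_eq_divide)
    qed
    then show "(\<integral>\<^sup>+w. ennreal (1 / (?r w)\<^sup>2) \<partial>M) < \<infinity>" using fin by (rule order.strict_trans1)
  qed auto
  with ne interpret sgd M X m Xs Z\<^sub>0 \<gamma> c\<^sub>\<gamma> \<alpha>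
    using assms by unfold_locales auto
  show ?thesis by (rule averaged_clt)
qed

end
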